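(* Let $G$ be a finitely generated group and let $\Gamma$ be a Schreier graph of $G$ which is transient with respect to the simple random walk on it. Then for any strictly non-degenerate finitely supported probability measure $\mu$ on $G$ either (i) there exists an end $\omega\in\partial\Gamma$ such that for any $\gamma\in\Gamma$ a.e. sample path of the induced random walk $(\Gamma,\mu)$ issued from $\gamma$ converges to $\omega$, or (ii) the space $\operatorname{Fun}(\Gamma,\partial\Gamma)$ of sections of the end bundle over $\Gamma$, endowed with the distribution of the family $(\lim_n \gamma.g_n)_{\gamma\in\Gamma}$ of limit ends, where $(g_n)$ is the random walk $(G,\mu)$ issued from the identity, is a non-trivial $\mu$-boundary, so that the Poisson boundary of the random walk $(G,\mu)$ is also non-trivial.
   Context: **Schreier graphs.** A Schreier graph of a finitely generated group $G$ is determined by a transitive right action $(\gamma,g)\mapsto\gamma.g$ of $G$ on a set $\Gamma$ (equivalently $\Gamma\cong H\backslash G$ for a subgroup $H$) and a finite symmetric generating set $K$ of $G$: the vertex set is $\Gamma$ and each $\gamma$ is joined by edges to $\gamma.k$, $k\in K$. The simple random walk on it moves from $\gamma$ to $\gamma.k$ with $k$ uniformly distributed on $K$. $\partial\Gamma$ is the space of ends of this connected locally finite graph, and convergence to an end is in the end compactification. Transient means that almost every sample path leaves every finite set forever. **Induced random walk and end fields.** For a probability measure $\mu$ on $G$, the induced random walk $(\Gamma,\mu)$ moves from $\gamma$ to $\gamma.g$ with probability $\mu(g)$; issued from $\gamma$, it is the image $(\gamma.g_n)$ of the random walk $(g_n)$ on $G$ issued from the identity. $\operatorname{Fun}(\Gamma,\partial\Gamma)=(\partial\Gamma)^\Gamma$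 is the space of all functions from the vertex set of $\Gamma$ to $\partial\Gamma$ (sections of the end bundle $\Gamma\times\partial\Gamma\to\Gamma$), with the product Borel structure and the left $G$-action $(\mathbf{S}^g\varphi)(\gamma)=\varphi(\gamma.g)$. **Random walks and boundaries.** The random walk $(G,\mu)$ is the Markov chain on $G$ moving from $g$ to $gh$ with probability $\mu(h)$. The walk issued from the identity is $g_n=h_1h_2\cdots h_n$ with $h_i$ i.i.d. of law $\mu$; $\mathbf{P}$ is its law on $G^{\mathbb{Z}_+}$. $\mu$ is strictly non-degenerate if the semigroup generated by $\operatorname{supp}\mu$ is $G$. The Poisson boundary $\partial_\mu G$ is the space of ergodic components of the time shift on $G^{\mathbb{Z}_+}$ with respect to the $\sigma$-finite Markov measure $\mathbf{P}_\#$ whose initial distribution is the counting measure on $G$; it carries the left $G$-action induced by coordinatewise left translation of paths, and the harmonic measure $\nu$, the image of $\mathbf{P}$. A $\mu$-boundary is a measure $G$-space $(B,\lambda)$ which is a $G$-equivariant measurable quotient of the Poisson boundary, with $\lambda$ the image of $\nu$. A $\mu$-boundary (in particular the Poisson boundary itself) is non-trivial if its measure is not a point measure. *)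

theory Defs
  imports
    "HOL-Probability.Probability"
    "HOL-Algebra.Generated_Groups"
    "HOL-Algebra.Group_Action"
    "Graph_Theory.Digraph_Component"
begin

section \<open>Schreier graphs\<close>

text \<open>\<open>K\<close> is required to be non-empty (relevant only for the trivial group) because the simple
  random walk needs the uniform distribution on \<open>K\<close>.\<close>

locale schreier_data = group G for G (structure) +
  fixes \<Gamma> :: "'x set" and act :: "'x \<Rightarrow> 'a \<Rightarrow> 'x" and K :: "'a set"
  assumes nonempty: "\<Gamma> \<noteq> {}"
    and act_closed: "\<lbrakk>\<gamma> \<in> \<Gamma>; g \<in> carrier G\<rbrakk> \<Longrightarrow> act \<gamma> g \<in> \<Gamma>"
    and act_one: "\<gamma> \<in> \<Gamma> \<Longrightarrow> act \<gamma> \<one> = \<gamma>"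
    and act_mult: "\<lbrakk>\<gamma> \<in> \<Gamma>; g \<in> carrier G; h \<in> carrier G\<rbrakk> \<Longrightarrow> act \<gamma> (g \<otimes> h) = act (act \<gamma> g) h"
    and act_transitive: "\<lbrakk>\<gamma> \<in> \<Gamma>; \<gamma>' \<in> \<Gamma>\<rbrakk> \<Longrightarrow> \<exists>g\<in>carrier G. act \<gamma> g = \<gamma>'"
    and K_carrier: "K \<subseteq> carrier G"
    and K_finite: "finite K"
    and K_nonempty: "K \<noteq> {}"
    and K_symmetric: "k \<in> K \<Longrightarrow> inv k \<in> K"
    and K_generates: "generate G K = carrier G"

definition schreier_graph :: "'x set \<Rightarrow> ('x \<Rightarrow> 'a \<Rightarrow> 'x) \<Rightarrow> 'a set \<Rightarrow> ('x, 'x \<times> 'a) pre_digraph"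
  where "schreier_graph \<Gamma> act K =
    \<lparr>verts = \<Gamma>, arcs = \<Gamma> \<times> K, tail = fst, head = (\<lambda>(\<gamma>, k). act \<gamma> k)\<rparr>"


section \<open>Ends\<close>

text \<open>Undirected graphs are symmetric digraphs here, so that strong components are
  connected components.\<close>

definition complement_components :: "('x, 'e) pre_digraph \<Rightarrow> 'x set \<Rightarrow> 'x set set"
  where "complement_components D F = pre_digraph.sccs_verts (induce_subgraph D (verts D - F))"

text \<open>The inverse limit of the components of complements of finite vertex sets. The chosen
  components are automatically infinite: if \<open>\<omega> F\<close> were finite, then \<open>\<omega> (F \<union> \<omega> F)\<close>
  would be a non-empty subset of \<open>\<omega> F\<close> disjoint from \<open>\<omega> F\<close>.\<close>

definition ends :: "('x, 'e) pre_digraph \<Rightarrow> ('x set \<Rightarrow> 'x set) set"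
  where "ends D = {\<omega> \<in> (\<Pi>\<^sub>E F\<in>{F. finite F \<and> F \<subseteq> verts D}. complement_components D F).
    \<forall>F F'. finite F' \<and> F' \<subseteq> verts D \<and> F \<subseteq> F' \<longrightarrow> \<omega> F' \<subseteq> \<omega> F}"

definition end_compactification :: "('x, 'e) pre_digraph \<Rightarrow> ('x + ('x set \<Rightarrow> 'x set)) topology"
  where "end_compactification D = topology_generated_by
    ({{Inl v} | v. v \<in> verts D} \<union>
     {Inl ` C \<union> Inr ` {\<omega> \<in> ends D. \<omega> F = C} | F C.
        finite F \<and> F \<subseteq> verts D \<and> C \<in> complement_components D F})"

definition converges_to_end :: "('x, 'e) pre_digraph \<Rightarrow> (nat \<Rightarrow> 'x) \<Rightarrow> ('x set \<Rightarrow> 'x set) \<Rightarrow> bool"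
  where "converges_to_end D x \<omega> \<longleftrightarrow>
    \<omega> \<in> ends D \<and> limitin (end_compactification D) (\<lambda>n. Inl (x n)) (Inr \<omega>) sequentially"

text \<open>Sequences without a limit end are sent to an arbitrary fixed end.\<close>

definition limit_end :: "('x, 'e) pre_digraph \<Rightarrow> (nat \<Rightarrow> 'x) \<Rightarrow> ('x set \<Rightarrow> 'x set)"
  where "limit_end D x =
    (if \<exists>\<omega>. converges_to_end D x \<omega> then THE \<omega>. converges_to_end D x \<omega> else SOME \<omega>. \<omega> \<in> ends D)"

definition borel_of :: "'s topology \<Rightarrow> 's measure"
  where "borel_of X = sigma (topspace X) {U. openin X U}"

definition end_space :: "('x, 'e) pre_digraph \<Rightarrow> ('x set \<Rightarrow> 'x set) measure"
  where "end_space D = borel_of (pullback_topology (ends D) Inr (end_compactification D))"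

definition end_fields :: "('x, 'e) pre_digraph \<Rightarrow> ('x \<Rightarrow> 'x set \<Rightarrow> 'x set) measure"
  where "end_fields D = (\<Pi>\<^sub>M \<gamma>\<in>verts D. end_space D)"

definition end_field_action ::
    "('x, 'e) pre_digraph \<Rightarrow> ('x \<Rightarrow> 'a \<Rightarrow> 'x) \<Rightarrow> 'a \<Rightarrow> ('x \<Rightarrow> 'x set \<Rightarrow> 'x set) \<Rightarrow> 'x \<Rightarrow> 'x set \<Rightarrow> 'x set"
  where "end_field_action D act g = (\<lambda>\<phi>\<in>space (end_fields D). \<lambda>\<gamma>\<in>verts D. \<phi> (act \<gamma> g))"


section \<open>Random walks\<close>

definition path_space :: "'s set \<Rightarrow> (nat \<Rightarrow> 's) measure"
  where "path_space S = (\<Pi>\<^sub>M n\<in>UNIV. count_space S)"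

text \<open>The restriction to the carrier only discards a null set; it makes the paths stay in the
  state space everywhere.\<close>

definition increments :: "('a, 'm) monoid_scheme \<Rightarrow> 'a pmf \<Rightarrow> (nat \<Rightarrow> 'a) measure"
  where "increments G \<mu> = (\<Pi>\<^sub>M n\<in>UNIV. restrict_space (measure_pmf \<mu>) (carrier G))"

primrec trajectory :: "('s \<Rightarrow> 'a \<Rightarrow> 's) \<Rightarrow> 's \<Rightarrow> (nat \<Rightarrow> 'a) \<Rightarrow> nat \<Rightarrow> 's"
  where
    "trajectory act s h 0 = s"
  | "trajectory act s h (Suc n) = act (trajectory act s h n) (h n)"

text \<open>Law of the Markov chain on \<open>S\<close> that starts at \<open>s\<close> and moves from \<open>y\<close> to \<open>act y g\<close> with
  probability \<open>\<mu> g\<close>.\<close>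

definition walk_law ::
    "('a, 'm) monoid_scheme \<Rightarrow> 's set \<Rightarrow> ('s \<Rightarrow> 'a \<Rightarrow> 's) \<Rightarrow> 'a pmf \<Rightarrow> 's \<Rightarrow> (nat \<Rightarrow> 's) measure"
  where "walk_law G S act \<mu> s = distr (increments G \<mu>) (path_space S) (trajectory act s)"

definition group_walk :: "('a, 'm) monoid_scheme \<Rightarrow> 'a pmf \<Rightarrow> (nat \<Rightarrow> 'a) measure"
  where "group_walk G \<mu> = walk_law G (carrier G) (mult G) \<mu> \<one>\<^bsub>G\<^esub>"

definition transient_walk :: "'s set \<Rightarrow> ('s \<Rightarrow> (nat \<Rightarrow> 's) measure) \<Rightarrow> bool"
  where "transient_walk S Q \<longleftrightarrow>
    (\<forall>s\<in>S. AE y in Q s. \<forall>F. finite F \<and> F \<subseteq> S \<longrightarrow> (\<forall>\<^sub>F n in sequentially. y n \<notin> F))"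

inductive_set semigroup_generated :: "('a, 'm) monoid_scheme \<Rightarrow> 'a set \<Rightarrow> 'a set"
  for G and A where
    incl: "a \<in> A \<Longrightarrow> a \<in> semigroup_generated G A"
  | mult: "\<lbrakk>a \<in> semigroup_generated G A; b \<in> semigroup_generated G A\<rbrakk>
      \<Longrightarrow> a \<otimes>\<^bsub>G\<^esub> b \<in> semigroup_generated G A"

definition strictly_nondegenerate :: "('a, 'm) monoid_scheme \<Rightarrow> 'a pmf \<Rightarrow> bool"
  where "strictly_nondegenerate G \<mu> \<longleftrightarrow> semigroup_generated G (set_pmf \<mu>) = carrier G"

definition limit_end_field ::
    "('x, 'e) pre_digraph \<Rightarrow> ('x \<Rightarrow> 'a \<Rightarrow> 'x) \<Rightarrow> (nat \<Rightarrow> 'a) \<Rightarrow> 'x \<Rightarrow> 'x set \<Rightarrow> 'x set"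
  where "limit_end_field D act x = (\<lambda>\<gamma>\<in>verts D. limit_end D (\<lambda>n. act \<gamma> (x n)))"

definition limit_end_law ::
    "('a, 'm) monoid_scheme \<Rightarrow> ('x, 'e) pre_digraph \<Rightarrow> ('x \<Rightarrow> 'a \<Rightarrow> 'x) \<Rightarrow> 'a pmf
      \<Rightarrow> ('x \<Rightarrow> 'x set \<Rightarrow> 'x set) measure"
  where "limit_end_law G D act \<mu> = distr (group_walk G \<mu>) (end_fields D) (limit_end_field D act)"


section \<open>The Poisson boundary\<close>

text \<open>The \<open>\<sigma>\<close>-finite Markov measure with the counting measure as initial distribution.\<close>

definition counting_walk :: "('a, 'm) monoid_scheme \<Rightarrow> 'a pmf \<Rightarrow> (nat \<Rightarrow> 'a) measure"
  where "counting_walk G \<mu> =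
    distr (count_space (carrier G) \<Otimes>\<^sub>M increments G \<mu>) (path_space (carrier G))
      (\<lambda>(g, h). trajectory (mult G) g h)"

definition path_shift :: "(nat \<Rightarrow> 's) \<Rightarrow> nat \<Rightarrow> 's"
  where "path_shift x = (\<lambda>n. x (Suc n))"

definition path_translate :: "('a, 'm) monoid_scheme \<Rightarrow> 'a \<Rightarrow> (nat \<Rightarrow> 'a) \<Rightarrow> nat \<Rightarrow> 'a"
  where "path_translate G g x = (\<lambda>n. g \<otimes>\<^bsub>G\<^esub> x n)"

definition standard_borel :: "'b measure \<Rightarrow> bool"
  where "standard_borel B \<longleftrightarrow>
    (\<exists>X. completely_metrizable_space X \<and> second_countable X \<and>
      space B = topspace X \<and> sets B = sets (borel_of X))"

text \<open>In the sense of Rokhlin, the space of ergodic components of a transformation \<open>T\<close> of a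
  measure space \<open>M\<close> is the standard Borel space \<open>B\<close> (unique modulo null sets), given
  together with the projection \<open>\<pi>\<close> of \<open>M\<close> onto it, for which the pull-back of the
  \<open>\<sigma>\<close>-algebra of \<open>B\<close> is, modulo null sets, the \<open>\<sigma>\<close>-algebra of \<open>T\<close>-invariant sets.
  Only the measurable structure of \<open>B\<close> is used.\<close>

definition ergodic_components :: "'s measure \<Rightarrow> ('s \<Rightarrow> 's) \<Rightarrow> 'b measure \<Rightarrow> ('s \<Rightarrow> 'b) \<Rightarrow> bool"
  where "ergodic_components M T B \<pi> \<longleftrightarrow>
    standard_borel B \<and> \<pi> \<in> measurable M B \<and> (AE x in M. \<pi> (T x) = \<pi> x) \<and>
    (\<forall>A\<in>sets M. (AE x in M. T x \<in> A \<longleftrightarrow> x \<in> A) \<longrightarrow>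
      (\<exists>C\<in>sets B. AE x in M. x \<in> A \<longleftrightarrow> \<pi> x \<in> C))"

definition measurable_action :: "('a, 'm) monoid_scheme \<Rightarrow> 'b measure \<Rightarrow> ('a \<Rightarrow> 'b \<Rightarrow> 'b) \<Rightarrow> bool"
  where "measurable_action G B a \<longleftrightarrow>
    group_action G (space B) a \<and> (\<forall>g\<in>carrier G. a g \<in> measurable B B)"

text \<open>\<open>\<nu>\<close> carries both the measurable structure of the boundary and the harmonic measure on it.\<close>

definition poisson_boundary ::
    "('a, 'm) monoid_scheme \<Rightarrow> 'a pmf \<Rightarrow> 'b measure \<Rightarrow> ('a \<Rightarrow> 'b \<Rightarrow> 'b) \<Rightarrow> ((nat \<Rightarrow> 'a) \<Rightarrow> 'b) \<Rightarrow> bool"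
  where "poisson_boundary G \<mu> \<nu> a \<pi> \<longleftrightarrow>
    ergodic_components (counting_walk G \<mu>) path_shift \<nu> \<pi> \<and>
    measurable_action G \<nu> a \<and>
    (\<forall>g\<in>carrier G. AE x in counting_walk G \<mu>. \<pi> (path_translate G g x) = a g (\<pi> x)) \<and>
    \<nu> = distr (group_walk G \<mu>) \<nu> \<pi>"

definition equivariant_quotient ::
    "('a, 'm) monoid_scheme \<Rightarrow> 'b measure \<Rightarrow> ('a \<Rightarrow> 'b \<Rightarrow> 'b) \<Rightarrow> 'c measure \<Rightarrow> ('a \<Rightarrow> 'c \<Rightarrow> 'c) \<Rightarrow> bool"
  where "equivariant_quotient G \<nu> a \<kappa> b \<longleftrightarrow>
    measurable_action G \<kappa> b \<and>
    (\<exists>\<phi>\<in>measurable \<nu> \<kappa>. (\<forall>g\<in>carrier G. AE y in \<nu>. \<phi> (a g y) = b g (\<phi> y)) \<and> \<kappa> = distr \<nu> \<kappa> \<phi>)"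

definition nontrivial :: "'b measure \<Rightarrow> bool"
  where "nontrivial \<nu> \<longleftrightarrow> \<not> (\<exists>y\<in>space \<nu>. \<nu> = return \<nu> y)"


section \<open>Existence of the Poisson boundary\<close>

lemma sub_sigma_algebra_generated_mod_null:
  assumes fin: "finite_measure M" and F: "subalgebra M F" and H: "subalgebra F H"
    and P: "Int_stable P" "P \<subseteq> Pow (space M)" "space M \<in> P" "sets M = sigma_sets (space M) P"
    and e: "\<And>C. C \<in> P \<Longrightarrow> \<exists>e\<in>borel_measurable H. AE x in M. e x = nn_cond_exp M F (indicator C) x"
    and A: "A \<in> sets F"
  shows "\<exists>B\<in>sets H. AE x in M. x \<in> A \<longleftrightarrow> x \<in> B"
proof -
  interpret finite_measure M by fact
  interpret F: finite_measure_subalgebra M F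
    by unfold_locales (fact F)
  have HM: "subalgebra M H" using F H by (auto simp: subalgebra_def)
  interpret H: finite_measure_subalgebra M H
    by unfold_locales (fact HM)
  define b where "b = nn_cond_exp M H (indicator A)"
  have AM: "A \<in> sets M" using A F by (auto simp: subalgebra_def)
  have bH: "b \<in> borel_measurable H" unfolding b_def by simp
  have bF: "b \<in> borel_measurable F" by (rule measurable_from_subalg[OF H bH])
  have bM: "b \<in> borel_measurable M" by (rule measurable_from_subalg[OF F bF])
  have AF: "indicator A \<in> borel_measurable F" using A by simp
  have eq: "emeasure (density M (indicator A)) C = emeasure (density M b) C" if CP: "C \<in> P" for C
  proof -
    obtain e where eH: "e \<in> borel_measurable H" and e: "AE x in M. e x = nn_cond_exp M F (indicator C) x"
      using assms(8)[OF CP] by blast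
    have CM: "C \<in> sets M" using CP P(4) by auto
    note [measurable] = CM AM
    have "emeasure (density M (indicator A)) C = (\<integral>\<^sup>+ x. indicator A x * indicator C x \<partial>M)"
      using CM AM by (simp add: emeasure_density)
    also have "\<dots> = (\<integral>\<^sup>+ x. indicator A x * nn_cond_exp M F (indicator C) x \<partial>M)"
      by (rule F.nn_cond_exp_intg[symmetric, OF AF]) simp
    also have "\<dots> = (\<integral>\<^sup>+ x. e x * indicator A x \<partial>M)"
      by (rule nn_integral_cong_AE) (use e in \<open>auto simp: mult.commute\<close>)
    also have "\<dots> = (\<integral>\<^sup>+ x. e x * b x \<partial>M)"
      unfolding b_def by (rule H.nn_cond_exp_intg[symmetric, OF eH]) simp
    also have "\<dots> = (\<integral>\<^sup>+ x. b x * nn_cond_exp M F (indicator C) x \<partial>M)"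
      by (rule nn_integral_cong_AE) (use e in \<open>auto simp: mult.commute\<close>)
    also have "\<dots> = (\<integral>\<^sup>+ x. b x * indicator C x \<partial>M)"
      by (rule F.nn_cond_exp_intg[OF bF]) simp
    also have "\<dots> = emeasure (density M b) C"
      using CM bM by (simp add: emeasure_density)
    finally show ?thesis .
  qed
  have "density M (indicator A) = density M b"
  proof (rule measure_eqI_generator_eq[where E=P and \<Omega>="space M" and A="\<lambda>_. space M"])
    show "emeasure (density M (indicator A)) (space M) \<noteq> \<infinity>"
      using AM by (simp add: emeasure_density less_top)
  qed (use P eq in auto)
  then have "AE x in M. indicator A x = b x"
    using density_unique_iff[of "indicator A" b] AM bM by simp
  then have "AE x in M. x \<in> A \<longleftrightarrow> x \<in> {x \<in> space M. b x = 1}"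
    using AE_space by eventually_elim (auto simp: indicator_def split: if_splits)
  moreover have "{x \<in> space M. b x = 1} \<in> sets H"
  proof -
    have "{x \<in> space H. b x = 1} \<in> sets H" using bH by simp
    then show ?thesis using HM by (simp add: subalgebra_def)
  qed
  ultimately show ?thesis by blast
qed

definition cylinders :: "'s set \<Rightarrow> (nat \<Rightarrow> 's) set set"
  where "cylinders S = insert {} ((\<lambda>l. {x \<in> Pi UNIV (\<lambda>_. S). map x [0..<length l] = l}) ` lists S)"

lemma space_path_space: "space (path_space S) = Pi UNIV (\<lambda>_. S)"
  by (auto simp: path_space_def space_PiM PiE_def)

lemma countable_cylinders: "countable S \<Longrightarrow> countable (cylinders S)"
  unfolding cylinders_def by (intro countable_insert countable_image countable_lists)

lemma Int_stable_cylinders: "Int_stable (cylinders S)"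
proof (rule Int_stableI)
  have aux: "{x \<in> Pi UNIV (\<lambda>_. S). map x [0..<length l] = l} \<inter> {x \<in> Pi UNIV (\<lambda>_. S). map x [0..<length m] = m}
      \<in> cylinders S" if "l \<in> lists S" "m \<in> lists S" "length l \<le> length m" for l m
  proof (cases "take (length l) m = l")
    case True
    have "map x [0..<length l] = l" if "map x [0..<length m] = m" for x
    proof -
      have "l = take (length l) (map x [0..<length m])" using True that by simp
      also have "\<dots> = map x [0..<length l]" using \<open>length l \<le> length m\<close> by (simp add: take_map)
      finally show ?thesis by simp
    qed
    then have "{x \<in> Pi UNIV (\<lambda>_. S). map x [0..<length l] = l} \<inter> {x \<in> Pi UNIV (\<lambda>_. S). map x [0..<length m] = m}
      = {x \<in> Pi UNIV (\<lambda>_. S). map x [0..<length m] = m}" by auto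
    then show ?thesis using that unfolding cylinders_def by auto
  next
    case False
    have "False" if "map x [0..<length l] = l" "map x [0..<length m] = m" for x
    proof -
      have "take (length l) m = take (length l) (map x [0..<length m])" using that by simp
      also have "\<dots> = map x [0..<length l]" using \<open>length l \<le> length m\<close> by (simp add: take_map)
      finally show False using that False by simp
    qed
    then have "{x \<in> Pi UNIV (\<lambda>_. S). map x [0..<length l] = l} \<inter> {x \<in> Pi UNIV (\<lambda>_. S). map x [0..<length m] = m} = {}"
      by blast
    then show ?thesis unfolding cylinders_def by simp
  qed
  fix a b assume "a \<in> cylinders S" "b \<in> cylinders S"
  then consider "a = {} \<or> b = {}"
    | l m where "l \<in> lists S" "m \<in> lists S" "a = {x \<in> Pi UNIV (\<lambda>_. S). map x [0..<length l] = l}"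
       "b = {x \<in> Pi UNIV (\<lambda>_. S). map x [0..<length m] = m}"
    unfolding cylinders_def by blast
  then show "a \<inter> b \<in> cylinders S"
  proof cases
    case 1 then show ?thesis by (auto simp: cylinders_def)
  next
    case 2 then show ?thesis using aux[of l m] aux[of m l] by (metis Int_commute nat_le_linear)
  qed
qed

lemma component_measurable: "(\<lambda>x. x n) \<in> measurable (path_space S) (count_space S)"
  unfolding path_space_def by (rule measurable_component_singleton[OF UNIV_I, of n "\<lambda>_. count_space S"])

lemma map_upt_eq_iff: "map x [0..<length l] = l \<longleftrightarrow> (\<forall>i<length l. x i = l ! i)"
  by (metis (no_types, lifting) length_map length_upt minus_nat.diff_0 nth_equalityI nth_map_upt add_0)

lemma sets_path_space:
  assumes "countable S"
  shows "sets (path_space S) = sigma_sets (Pi UNIV (\<lambda>_. S)) (cylinders S)"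
proof
  have sub: "cylinders S \<subseteq> Pow (Pi UNIV (\<lambda>_. S))" by (auto simp: cylinders_def)
  interpret C: sigma_algebra "Pi UNIV (\<lambda>_. S)" "sigma_sets (Pi UNIV (\<lambda>_. S)) (cylinders S)"
    by (rule sigma_algebra_sigma_sets[OF sub])
  have "cylinders S \<subseteq> sets (path_space S)"
  proof
    fix A assume "A \<in> cylinders S"
    then consider "A = {}" | l where "l \<in> lists S" "A = {x \<in> Pi UNIV (\<lambda>_. S). map x [0..<length l] = l}"
      unfolding cylinders_def by blast
    then show "A \<in> sets (path_space S)"
    proof cases
      case 2
      have "A = {x \<in> space (path_space S). \<forall>i\<in>{..<length l}. x i = l ! i}"
        unfolding 2(2) map_upt_eq_iff space_path_space lessThan_iff Ball_def ..
      also have "\<dots> \<in> sets (path_space S)"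
      proof (rule sets.sets_Collect_countable_All')
        fix i assume "i \<in> {..<length l}"
        then have "l ! i \<in> S" using 2 by auto
        then have "(\<lambda>x. x i) -` {l ! i} \<inter> space (path_space S) \<in> sets (path_space S)"
          by (intro measurable_sets[OF component_measurable]) auto
        moreover have "(\<lambda>x. x i) -` {l ! i} \<inter> space (path_space S) = {x \<in> space (path_space S). x i = l ! i}"
          by auto
        ultimately show "{x \<in> space (path_space S). x i = l ! i} \<in> sets (path_space S)" by simp
      qed auto
      finally show ?thesis .
    qed simp
  qed
  then show "sigma_sets (Pi UNIV (\<lambda>_. S)) (cylinders S) \<subseteq> sets (path_space S)"
    using sets.sigma_sets_subset[of "cylinders S" "path_space S"] by (simp add: space_path_space)
  have gen: "sets (path_space S)
      = sigma_sets (Pi UNIV (\<lambda>_. S)) {{f \<in> Pi UNIV (\<lambda>_. S). f i \<in> A} | i A. A \<subseteq> S}"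
    unfolding path_space_def sets_PiM_single by (simp add: PiE_def)
  show "sets (path_space S) \<subseteq> sigma_sets (Pi UNIV (\<lambda>_. S)) (cylinders S)"
    unfolding gen
  proof (rule C.sigma_sets_subset, safe)
    fix i A assume "A \<subseteq> S"
    have eq: "{f \<in> Pi UNIV (\<lambda>_. S). f i \<in> A} =
      (\<Union>l\<in>{l \<in> lists S. length l = Suc i \<and> l ! i \<in> A}. {x \<in> Pi UNIV (\<lambda>_. S). map x [0..<length l] = l})"
      (is "?L = ?R")
    proof
      show "?R \<subseteq> ?L"
      proof
        fix x assume "x \<in> ?R"
        then obtain l where l: "length l = Suc i" "l ! i \<in> A" "x \<in> Pi UNIV (\<lambda>_. S)"
          "map x [0..<length l] = l" by blast
        have "x i = l ! i" using l(1) iffD1[OF map_upt_eq_iff l(4)] by simp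
        then show "x \<in> ?L" using l(2,3) by simp
      qed
      show "?L \<subseteq> ?R"
      proof
        fix x assume x: "x \<in> ?L"
        define l where "l = map x [0..<Suc i]"
        have l: "length l = Suc i" "l ! i = x i" unfolding l_def by (simp_all del: upt_Suc)
        have "l \<in> lists S" using x unfolding l_def by (auto simp: Pi_iff)
        have m: "map x [0..<length l] = l" by (subst l(1)) (rule l_def[symmetric])
        show "x \<in> ?R"
          by (rule UN_I[of l]) (use \<open>l \<in> lists S\<close> l(1) l(2) m x in simp_all)
      qed
    qed
    show "{f \<in> Pi UNIV (\<lambda>_. S). f i \<in> A} \<in> sigma_sets (Pi UNIV (\<lambda>_. S)) (cylinders S)"
      unfolding eq
    proof (rule C.countable_UN'')
      show "countable {l \<in> lists S. length l = Suc i \<and> l ! i \<in> A}"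
        by (rule countable_subset[OF _ countable_lists[OF assms]]) blast
      fix l assume "l \<in> {l \<in> lists S. length l = Suc i \<and> l ! i \<in> A}"
      then show "{x \<in> Pi UNIV (\<lambda>_. S). map x [0..<length l] = l} \<in> sigma_sets (Pi UNIV (\<lambda>_. S)) (cylinders S)"
        unfolding cylinders_def by (intro sigma_sets.Basic) blast
    qed
  qed
qed

lemma standard_borel_borel: "standard_borel (borel :: 'b::polish_space measure)"
  unfolding standard_borel_def
proof (intro exI conjI)
  show "completely_metrizable_space (euclidean :: 'b topology)"
    by (rule completely_metrizable_space_euclidean)
  show "second_countable (euclidean :: 'b topology)"
  proof -
    obtain B :: "'b set set" where B: "countable B" "topological_basis B"
      using ex_countable_basis by blast
    show ?thesis
      unfolding second_countable_def open_openin[symmetric]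
    proof (intro exI conjI ballI allI impI)
      show "open V" if "V \<in> B" for V using topological_basis_open[OF B(2) that] .
      fix U :: "'b set" and x assume U: "open U \<and> x \<in> U"
      obtain V where "V \<in> B" "x \<in> V" "V \<subseteq> U"
        by (rule topological_basisE[OF B(2) conjunct1[OF U] conjunct2[OF U]])
      then show "\<exists>V\<in>B. x \<in> V \<and> V \<subseteq> U" by (intro bexI conjI)
    qed (rule B(1))
  qed
  show "space (borel :: 'b measure) = topspace euclidean" by simp
  show "sets (borel :: 'b measure) = sets (borel_of euclidean)"
    by (simp only: borel_of_def borel_def topspace_euclidean open_openin[symmetric])
qed

lemma sets_path_measures [simp]:
  "sets (group_walk G \<mu>) = sets (path_space (carrier G))"
  "sets (counting_walk G \<mu>) = sets (path_space (carrier G))"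
  by (simp_all add: group_walk_def walk_law_def counting_walk_def)

lemma space_path_measures [simp]:
  "space (group_walk G \<mu>) = Pi UNIV (\<lambda>_. carrier G)"
  "space (counting_walk G \<mu>) = Pi UNIV (\<lambda>_. carrier G)"
  by (simp_all add: group_walk_def walk_law_def counting_walk_def space_path_space)

lemma measurable_path_shift: "path_shift \<in> measurable (path_space S) (path_space S)"
proof -
  have "(\<lambda>x n. x (Suc n)) \<in> measurable (path_space S) (Pi\<^sub>M UNIV (\<lambda>_. count_space S))"
    by (rule measurable_PiM_single') (auto simp: space_path_space PiE_def component_measurable)
  then show ?thesis by (simp add: path_shift_def[abs_def] path_space_def)
qed

lemma (in group) measurable_path_translate:
  assumes "g \<in> carrier G"
  shows "path_translate G g \<in> measurable (path_space (carrier G)) (path_space (carrier G))"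
proof -
  have "(\<lambda>x n. g \<otimes> x n) \<in> measurable (path_space (carrier G)) (Pi\<^sub>M UNIV (\<lambda>_. count_space (carrier G)))"
  proof (rule measurable_PiM_single')
    fix n
    have "(\<lambda>y. g \<otimes> y) \<in> measurable (count_space (carrier G)) (count_space (carrier G))"
      using assms by auto
    then show "(\<lambda>x. g \<otimes> x n) \<in> measurable (path_space (carrier G)) (count_space (carrier G))"
      by (rule measurable_compose[OF component_measurable])
  qed (use assms in \<open>auto simp: space_path_space PiE_def\<close>)
  then show ?thesis by (simp add: path_translate_def[abs_def] path_space_def)
qed

locale countable_group_walk = group G for G (structure) +
  fixes \<mu> :: "'a pmf"
  assumes countable_carrier: "countable (carrier G)" and support: "set_pmf \<mu> \<subseteq> carrier G"
begin

abbreviation "step \<equiv> restrict_space (measure_pmf \<mu>) (carrier G)"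

lemma prob_space_step: "prob_space step"
proof
  have "emeasure (measure_pmf \<mu>) (carrier G) = 1"
    using support by (simp add: measure_pmf.emeasure_eq_measure measure_pmf.prob_eq_1 AE_measure_pmf_iff subset_iff)
  then show "emeasure step (space step) = 1"
    by (simp add: space_restrict_space emeasure_restrict_space)
qed

lemma sets_step: "sets step = sets (count_space (carrier G))"
  by (auto simp: sets_restrict_space)

lemma prob_space_increments: "prob_space (increments G \<mu>)"
  unfolding increments_def by (rule prob_space_PiM) (rule prob_space_step)

lemma measurable_increment: "(\<lambda>h. h n) \<in> measurable (increments G \<mu>) (count_space (carrier G))"
proof -
  have "(\<lambda>h. h n) \<in> measurable (increments G \<mu>) step"
    unfolding increments_def by (rule measurable_component_singleton) simp
  then show ?thesis by (simp cong: measurable_cong_sets add: measurable_cong_sets[OF refl sets_step])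
qed

lemma measurable_trajectory_pair:
  "(\<lambda>(g, h). trajectory (mult G) g h) \<in> measurable (count_space (carrier G) \<Otimes>\<^sub>M increments G \<mu>) (path_space (carrier G))"
proof -
  let ?M = "count_space (carrier G) \<Otimes>\<^sub>M increments G \<mu>"
  have comp: "(\<lambda>p. trajectory (mult G) (fst p) (snd p) n) \<in> measurable ?M (count_space (carrier G))" for n
  proof (induction n)
    case 0 then show ?case by simp
  next
    case (Suc n)
    have inc: "(\<lambda>p. snd p n) \<in> measurable ?M (count_space (carrier G))"
      by (rule measurable_compose[OF measurable_snd measurable_increment])
    have cd: "countable (carrier G \<times> carrier G)" using countable_carrier by simp
    have "(\<lambda>p. (trajectory (mult G) (fst p) (snd p) n, snd p n)) \<in> measurable ?M (count_space (carrier G) \<Otimes>\<^sub>M count_space (carrier G))"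
      by (rule measurable_Pair[OF Suc inc])
    moreover have "(\<lambda>q. fst q \<otimes> snd q) \<in> measurable (count_space (carrier G) \<Otimes>\<^sub>M count_space (carrier G)) (count_space (carrier G))"
      unfolding pair_measure_countable[OF countable_carrier countable_carrier]
        measurable_count_space_eq1 by auto
    ultimately have "(\<lambda>p. fst (trajectory (mult G) (fst p) (snd p) n, snd p n) \<otimes> snd (trajectory (mult G) (fst p) (snd p) n, snd p n))
        \<in> measurable ?M (count_space (carrier G))"
      by (rule measurable_compose)
    then show ?case by (simp only: trajectory.simps fst_conv snd_conv)
  qed
  have "(\<lambda>p n. trajectory (mult G) (fst p) (snd p) n) \<in> measurable ?M (Pi\<^sub>M UNIV (\<lambda>_. count_space (carrier G)))"
  proof (rule measurable_PiM_single')
    show "(\<lambda>p n. trajectory (mult G) (fst p) (snd p) n) \<in> space ?M \<rightarrow> (\<Pi>\<^sub>E i\<in>UNIV. space (count_space (carrier G)))"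
      using measurable_space[OF comp] by (auto simp: PiE_def)
  qed (rule comp)
  then show ?thesis by (simp add: path_space_def case_prod_unfold)
qed

lemma pair_sigma_finite: "pair_sigma_finite (count_space (carrier G)) (increments G \<mu>)"
  by (intro pair_sigma_finite.intro sigma_finite_measure_count_space_countable countable_carrier
      prob_space_imp_sigma_finite prob_space_increments)

lemma AE_counting_walk:
  assumes "{x \<in> space (path_space (carrier G)). P x} \<in> sets (path_space (carrier G))"
  shows "(AE x in counting_walk G \<mu>. P x) \<longleftrightarrow>
    (\<forall>g\<in>carrier G. AE h in increments G \<mu>. P (trajectory (mult G) g h))"
proof -
  interpret pair_sigma_finite "count_space (carrier G)" "increments G \<mu>" by (rule pair_sigma_finite)
  let ?M = "count_space (carrier G) \<Otimes>\<^sub>M increments G \<mu>"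
  have "(AE x in counting_walk G \<mu>. P x) \<longleftrightarrow> (AE p in ?M. P (trajectory (mult G) (fst p) (snd p)))"
    unfolding counting_walk_def
    by (subst AE_distr_iff[OF measurable_trajectory_pair assms]) (simp add: case_prod_unfold)
  also have "\<dots> \<longleftrightarrow> (AE g in count_space (carrier G). AE h in increments G \<mu>. P (trajectory (mult G) g h))"
  proof (rule AE_pair_iff[symmetric])
    have "(\<lambda>(g, h). trajectory (mult G) g h) -` {x \<in> space (path_space (carrier G)). P x} \<inter> space ?M \<in> sets ?M"
      by (rule measurable_sets[OF measurable_trajectory_pair assms])
    also have "(\<lambda>(g, h). trajectory (mult G) g h) -` {x \<in> space (path_space (carrier G)). P x} \<inter> space ?M
      = {p \<in> space ?M. P (trajectory (mult G) (fst p) (snd p))}"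
      using measurable_space[OF measurable_trajectory_pair] by (auto simp: case_prod_unfold)
    finally show "{p \<in> space ?M. P (trajectory (mult G) (fst p) (snd p))} \<in> sets ?M" .
  qed
  also have "\<dots> \<longleftrightarrow> (\<forall>g\<in>carrier G. AE h in increments G \<mu>. P (trajectory (mult G) g h))"
    by (simp add: AE_count_space)
  finally show ?thesis .
qed

lemma trajectory_translate:
  assumes "h \<in> space (increments G \<mu>)" "g \<in> carrier G" "g' \<in> carrier G"
  shows "path_translate G g (trajectory (mult G) g' h) = trajectory (mult G) (g \<otimes> g') h"
proof -
  have h: "h n \<in> carrier G" for n
    using measurable_space[OF measurable_increment assms(1)] by simp
  have t: "trajectory (mult G) g' h n \<in> carrier G" for n
    by (induction n) (use h assms in auto)
  have "g \<otimes> trajectory (mult G) g' h n = trajectory (mult G) (g \<otimes> g') h n" for n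
    by (induction n) (use h t assms in \<open>auto simp: m_assoc[symmetric]\<close>)
  then show ?thesis by (auto simp: path_translate_def)
qed

lemma AE_translate:
  assumes "g \<in> carrier G" and AE: "AE x in counting_walk G \<mu>. P x"
  shows "AE x in counting_walk G \<mu>. P (path_translate G g x)"
proof -
  let ?N = "path_space (carrier G)"
  obtain A where A: "{x \<in> space (counting_walk G \<mu>). \<not> P x} \<subseteq> A" "A \<in> null_sets (counting_walk G \<mu>)"
    using AE_E[OF AE] by (metis null_setsI)
  have AN: "A \<in> sets ?N" using A(2) by auto
  have *: "{x \<in> space ?N. x \<notin> A} \<in> sets ?N"
    using AN by (simp add: Diff_eq[symmetric] set_diff_eq[symmetric] sets.compl_sets)
  have t: "path_translate G g \<in> measurable ?N ?N" by (rule measurable_path_translate[OF assms(1)])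
  have "{x \<in> space ?N. path_translate G g x \<notin> A} = path_translate G g -` {x \<in> space ?N. x \<notin> A} \<inter> space ?N"
    using measurable_space[OF t] by auto
  then have **: "{x \<in> space ?N. path_translate G g x \<notin> A} \<in> sets ?N"
    using measurable_sets[OF t *] by simp
  have "AE x in counting_walk G \<mu>. x \<notin> A" by (rule AE_not_in[OF A(2)])
  then have "\<forall>k\<in>carrier G. AE h in increments G \<mu>. trajectory (mult G) k h \<notin> A"
    unfolding AE_counting_walk[OF *] .
  then have "\<forall>k\<in>carrier G. AE h in increments G \<mu>. trajectory (mult G) (g \<otimes> k) h \<notin> A"
    using assms(1) by simp
  then have "\<forall>k\<in>carrier G. AE h in increments G \<mu>. path_translate G g (trajectory (mult G) k h) \<notin> A"
    using AE_space[of "increments G \<mu>"] trajectory_translate assms(1)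
    by (auto elim!: AE_mp intro!: AE_I2)
  then have "AE x in counting_walk G \<mu>. path_translate G g x \<notin> A"
    unfolding AE_counting_walk[OF **] .
  then show ?thesis
    using AE_space
  proof eventually_elim
    case (elim x)
    then have "path_translate G g x \<in> space (counting_walk G \<mu>)"
      using measurable_space[OF t, of x] by (simp add: space_path_space)
    then show ?case using elim A(1) by blast
  qed
qed

lemma sigma_finite_counting_walk: "sigma_finite_measure (counting_walk G \<mu>)"
proof
  interpret P: prob_space "increments G \<mu>" by (rule prob_space_increments)
  let ?N = "path_space (carrier G)"
  let ?A = "\<lambda>g. {x \<in> space ?N. x 0 = g}"
  have sets: "?A g \<in> sets ?N" if "g \<in> carrier G" for g
  proof -
    have "(\<lambda>x. x 0) -` {g} \<inter> space ?N \<in> sets ?N"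
      by (rule measurable_sets[OF component_measurable]) (use that in simp)
    also have "(\<lambda>x. x 0) -` {g} \<inter> space ?N = ?A g" by auto
    finally show ?thesis .
  qed
  have mass: "emeasure (counting_walk G \<mu>) (?A g) = 1" if "g \<in> carrier G" for g
  proof -
    have "emeasure (counting_walk G \<mu>) (?A g)
      = emeasure (count_space (carrier G) \<Otimes>\<^sub>M increments G \<mu>)
         ((\<lambda>(g, h). trajectory (mult G) g h) -` ?A g \<inter> space (count_space (carrier G) \<Otimes>\<^sub>M increments G \<mu>))"
      unfolding counting_walk_def by (rule emeasure_distr[OF measurable_trajectory_pair sets[OF that]])
    also have "(\<lambda>(g, h). trajectory (mult G) g h) -` ?A g \<inter> space (count_space (carrier G) \<Otimes>\<^sub>M increments G \<mu>)
      = {g} \<times> space (increments G \<mu>)"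
      using measurable_space[OF measurable_trajectory_pair] that
      by (fastforce simp: space_pair_measure)
    also have "emeasure (count_space (carrier G) \<Otimes>\<^sub>M increments G \<mu>) ({g} \<times> space (increments G \<mu>)) = 1"
      using that by (subst P.emeasure_pair_measure_Times) (auto simp: P.emeasure_space_1)
    finally show ?thesis .
  qed
  show "\<exists>A. countable A \<and> A \<subseteq> sets (counting_walk G \<mu>) \<and> \<Union> A = space (counting_walk G \<mu>) \<and>
      (\<forall>a\<in>A. emeasure (counting_walk G \<mu>) a \<noteq> \<infinity>)"
  proof (intro exI conjI ballI)
    show "countable (?A ` carrier G)" by (rule countable_image[OF countable_carrier])
    show "?A ` carrier G \<subseteq> sets (counting_walk G \<mu>)" using sets by auto
    show "\<Union> (?A ` carrier G) = space (counting_walk G \<mu>)"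
      unfolding space_path_measures space_path_space by blast
    show "emeasure (counting_walk G \<mu>) a \<noteq> \<infinity>" if "a \<in> ?A ` carrier G" for a
      using that mass by auto
  qed
qed


lemma AE_invariant_function:
  fixes f :: "_ \<Rightarrow> real"
  assumes "\<And>q. AE x in M. f (T x) < q \<longleftrightarrow> f x < q"
  shows "AE x in M. f (T x) = f x"
proof -
  have "AE x in M. \<forall>q::rat. f (T x) < of_rat q \<longleftrightarrow> f x < of_rat q"
    using assms by (simp add: AE_all_countable)
  then show ?thesis
  proof eventually_elim
    case (elim x)
    show ?case
    proof (rule linorder_cases[of "f (T x)" "f x"])
      assume "f (T x) < f x"
      then obtain q where "f (T x) < of_rat q" "of_rat q < f x" using of_rat_dense by blast
      then show ?thesis using elim by force
    next
      assume "f x < f (T x)"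
      then obtain q where "f x < of_rat q" "of_rat q < f (T x)" using of_rat_dense by blast
      then show ?thesis using elim by force
    qed
  qed
qed

definition invariant_sets :: "(nat \<Rightarrow> 'a) set set"
  where "invariant_sets = {A \<in> sets (path_space (carrier G)).
    AE x in counting_walk G \<mu>. path_shift x \<in> A \<longleftrightarrow> x \<in> A}"

lemma shift_space:
  "x \<in> Pi UNIV (\<lambda>_. carrier G) \<Longrightarrow> path_shift x \<in> Pi UNIV (\<lambda>_. carrier G)"
  by (auto simp: path_shift_def)

lemma translate_space:
  "g \<in> carrier G \<Longrightarrow> x \<in> Pi UNIV (\<lambda>_. carrier G) \<Longrightarrow> path_translate G g x \<in> Pi UNIV (\<lambda>_. carrier G)"
  by (auto simp: path_translate_def)

lemma sigma_algebra_invariant_sets: "sigma_algebra (Pi UNIV (\<lambda>_. carrier G)) invariant_sets"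
  unfolding sigma_algebra_iff2
proof (intro conjI ballI allI impI)
  let ?\<Omega> = "Pi UNIV (\<lambda>_. carrier G)"
  have top: "?\<Omega> \<in> sets (path_space (carrier G))"
    using sets.top[of "path_space (carrier G)"] by (simp add: space_path_space)
  show "invariant_sets \<subseteq> Pow ?\<Omega>"
    using sets.sets_into_space[of _ "path_space (carrier G)"]
    by (auto simp: invariant_sets_def space_path_space)
  show "{} \<in> invariant_sets" by (simp add: invariant_sets_def)
  show "?\<Omega> - A \<in> invariant_sets" if "A \<in> invariant_sets" for A
  proof -
    have A: "A \<in> sets (path_space (carrier G))" "AE x in counting_walk G \<mu>. path_shift x \<in> A \<longleftrightarrow> x \<in> A"
      using that by (auto simp: invariant_sets_def)
    have "AE x in counting_walk G \<mu>. path_shift x \<in> ?\<Omega> - A \<longleftrightarrow> x \<in> ?\<Omega> - A"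
      using A(2) AE_space
      by eventually_elim (use shift_space in \<open>simp only: space_path_measures Diff_iff simp_thms\<close>)
    then show ?thesis using A(1) top unfolding invariant_sets_def by blast
  qed
  show "\<Union> (range A) \<in> invariant_sets" if "range A \<subseteq> invariant_sets" for A :: "nat \<Rightarrow> _"
  proof -
    have A: "A n \<in> sets (path_space (carrier G))" "AE x in counting_walk G \<mu>. path_shift x \<in> A n \<longleftrightarrow> x \<in> A n" for n
      using that by (auto simp: invariant_sets_def)
    have "AE x in counting_walk G \<mu>. \<forall>n. path_shift x \<in> A n \<longleftrightarrow> x \<in> A n"
      using A(2) by (simp add: AE_all_countable)
    then have "AE x in counting_walk G \<mu>. path_shift x \<in> \<Union> (range A) \<longleftrightarrow> x \<in> \<Union> (range A)"
      by eventually_elim blast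
    then show ?thesis using A(1) unfolding invariant_sets_def by blast
  qed
qed

lemma translate_invariant_set:
  assumes "g \<in> carrier G" "A \<in> invariant_sets"
  shows "path_translate G g -` A \<inter> Pi UNIV (\<lambda>_. carrier G) \<in> invariant_sets"
proof -
  let ?\<Omega> = "Pi UNIV (\<lambda>_. carrier G)"
  have A: "A \<in> sets (path_space (carrier G))" "AE x in counting_walk G \<mu>. path_shift x \<in> A \<longleftrightarrow> x \<in> A"
    using assms(2) by (auto simp: invariant_sets_def)
  have "path_translate G g -` A \<inter> ?\<Omega> \<in> sets (path_space (carrier G))"
    using measurable_sets[OF measurable_path_translate[OF assms(1)] A(1)] by (simp add: space_path_space)
  moreover have "AE x in counting_walk G \<mu>.
      path_shift x \<in> path_translate G g -` A \<inter> ?\<Omega> \<longleftrightarrow> x \<in> path_translate G g -` A \<inter> ?\<Omega>"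
    using AE_translate[OF assms(1) A(2)] AE_space
  proof eventually_elim
    case (elim x)
    have "path_shift (path_translate G g x) = path_translate G g (path_shift x)"
      by (simp add: path_shift_def path_translate_def)
    then show ?case using elim shift_space by simp
  qed
  ultimately show ?thesis by (simp add: invariant_sets_def)
qed

text \<open>The Poisson boundary exists: it is realized on sequences of reals by conditional probabilities
  of translated cylinder sets with respect to the invariant \<open>\<sigma>\<close>-algebra.\<close>

lemma poisson_boundary_exists:
  "\<exists>(\<nu> :: (nat \<Rightarrow> real) measure) a \<pi>. poisson_boundary G \<mu> \<nu> a \<pi>"
proof -
  let ?\<Omega> = "Pi UNIV (\<lambda>_. carrier G)" and ?N = "path_space (carrier G)" and ?M = "counting_walk G \<mu>"
  interpret CW: sigma_finite_measure ?M by (rule sigma_finite_counting_walk)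
  obtain w where w: "w \<in> borel_measurable ?M" "integral\<^sup>N ?M w \<noteq> \<infinity>"
    "\<forall>x\<in>space ?M. 0 < w x \<and> w x < \<infinity>"
    using CW.Ex_finite_integrable_function by auto
  define M where "M = density ?M w"
  have sets_M: "sets M = sets ?N" and space_M: "space M = ?\<Omega>" by (simp_all add: M_def)
  have AE_M: "(AE x in M. P x) \<longleftrightarrow> (AE x in ?M. P x)" for P
  proof -
    have "(AE x in M. P x) \<longleftrightarrow> (AE x in ?M. 0 < w x \<longrightarrow> P x)"
      unfolding M_def by (rule AE_density[OF w(1)])
    also have "\<dots> \<longleftrightarrow> (AE x in ?M. P x)"
      by (rule AE_cong) (use w(3) in auto)
    finally show ?thesis .
  qed
  have fin: "finite_measure M"
  proof
    have "emeasure M (space M) = (\<integral>\<^sup>+x. w x * indicator (space ?M) x \<partial>?M)"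
      unfolding M_def space_density by (rule emeasure_density[OF w(1) sets.top])
    also have "\<dots> = integral\<^sup>N ?M w" by (rule nn_integral_cong) simp
    finally show "emeasure M (space M) \<noteq> \<infinity>" using w(2) by simp
  qed
  define F where "F = sigma ?\<Omega> invariant_sets"
  have space_F: "space F = ?\<Omega>" and sets_F: "sets F = invariant_sets"
    using sigma_algebra.sets_measure_of_eq[OF sigma_algebra_invariant_sets]
      sigma_algebra.space_measure_of_eq[OF sigma_algebra_invariant_sets]
    by (simp_all add: F_def)
  have F: "subalgebra M F"
    by (auto simp: subalgebra_def space_F space_M sets_F sets_M invariant_sets_def)
  define cyl where "cyl = from_nat_into (cylinders (carrier G))"
  have cyl: "range cyl = cylinders (carrier G)"
    unfolding cyl_def
    by (rule range_from_nat_into[OF _ countable_cylinders[OF countable_carrier]]) (simp add: cylinders_def)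
  define e where "e k x = enn2real (nn_cond_exp M F (indicator (cyl k)) x)" for k x
  have e_F: "e k \<in> borel_measurable F" for k
    unfolding e_def[abs_def] by (intro borel_measurable_enn2real borel_measurable_nn_cond_exp)
  define Z where "Z = carrier G \<times> (UNIV :: nat set)"
  have Z: "countable Z" "infinite Z"
  proof -
    show "countable Z" unfolding Z_def using countable_carrier by simp
    show "infinite Z" unfolding Z_def by (auto simp: finite_cartesian_product_iff)
  qed
  define z where "z = from_nat_into Z"
  define j where "j = to_nat_on Z"
  have z_Z: "z i \<in> Z" for i unfolding z_def using Z(2) by (intro from_nat_into) auto
  have z1: "fst (z i) \<in> carrier G" for i using z_Z[of i] by (auto simp: Z_def)
  have zj: "z (j p) = p" if "p \<in> Z" for p
    unfolding z_def j_def using Z(1) that by (rule from_nat_into_to_nat_on)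
  have jz: "j (z i) = i" for i
    unfolding z_def j_def using Z by (rule to_nat_on_from_nat_into_infinite)
  define \<pi> where "\<pi> x i = e (snd (z i)) (path_translate G (fst (z i)) x)" for x i
  define a :: "'a \<Rightarrow> (nat \<Rightarrow> real) \<Rightarrow> (nat \<Rightarrow> real)"
    where "a g b i = b (j (fst (z i) \<otimes> g, snd (z i)))" for g b i

  have tF: "path_translate G g \<in> measurable F F" if "g \<in> carrier G" for g
    by (rule measurableI)
       (use translate_invariant_set[OF that] translate_space[OF that] in \<open>simp_all add: space_F sets_F\<close>)
  have \<pi>F_i: "(\<lambda>x. \<pi> x i) \<in> borel_measurable F" for i
    unfolding \<pi>_def by (rule measurable_compose[OF tF[OF z1] e_F])
  have \<pi>_F: "\<pi> \<in> borel_measurable F"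
    by (rule measurable_coordinatewise_then_product) (rule \<pi>F_i)
  have \<pi>_M: "\<pi> \<in> borel_measurable M" by (rule measurable_from_subalg[OF F \<pi>_F])
  have \<pi>_N: "\<pi> \<in> borel_measurable ?N"
    by (subst measurable_cong_sets[OF sets_M[symmetric] refl]) (rule \<pi>_M)

  have inv: "AE x in ?M. \<pi> (path_shift x) = \<pi> x"
  proof -
    have "AE x in ?M. \<pi> (path_shift x) i = \<pi> x i" for i
    proof (rule AE_invariant_function)
      fix q :: real
      have "{x \<in> space F. \<pi> x i < q} \<in> sets F"
        by (rule borel_measurable_less[OF \<pi>F_i]) simp
      then have "AE x in ?M. path_shift x \<in> {x \<in> ?\<Omega>. \<pi> x i < q} \<longleftrightarrow> x \<in> {x \<in> ?\<Omega>. \<pi> x i < q}"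
        unfolding space_F sets_F invariant_sets_def by blast
      then show "AE x in ?M. \<pi> (path_shift x) i < q \<longleftrightarrow> \<pi> x i < q"
        using AE_space by eventually_elim (use shift_space in simp)
    qed
    then have "AE x in ?M. \<forall>i. \<pi> (path_shift x) i = \<pi> x i" by (simp add: AE_all_countable)
    then show ?thesis by eventually_elim (rule ext, simp)
  qed

  define H where "H = vimage_algebra ?\<Omega> \<pi> (borel :: (nat \<Rightarrow> real) measure)"
  have space_H: "space H = ?\<Omega>" by (simp add: H_def)
  have sets_H: "sets H = (\<lambda>C. \<pi> -` C \<inter> ?\<Omega>) ` sets borel"
    unfolding H_def by (subst sets_vimage_algebra2) auto
  have HF: "subalgebra F H"
    unfolding subalgebra_def space_H space_F sets_H
    using measurable_sets[OF \<pi>_F] by (auto simp: space_F)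
  have \<pi>_H: "\<pi> \<in> borel_measurable H"
    unfolding H_def by (rule measurable_vimage_algebra1) simp
  have gen: "\<exists>C\<in>sets (borel :: (nat \<Rightarrow> real) measure). AE x in ?M. x \<in> A \<longleftrightarrow> \<pi> x \<in> C"
    if A: "A \<in> sets ?M" "AE x in ?M. path_shift x \<in> A \<longleftrightarrow> x \<in> A" for A
  proof -
    have "\<exists>B\<in>sets H. AE x in M. x \<in> A \<longleftrightarrow> x \<in> B"
    proof (rule sub_sigma_algebra_generated_mod_null[OF fin F HF Int_stable_cylinders])
      show "cylinders (carrier G) \<subseteq> Pow (space M)"
        unfolding space_M cylinders_def by auto
      show "space M \<in> cylinders (carrier G)"
        unfolding space_M cylinders_def by (intro insertI2 image_eqI[of _ _ "[]"]) auto
      show "sets M = sigma_sets (space M) (cylinders (carrier G))"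
        unfolding space_M sets_M by (rule sets_path_space[OF countable_carrier])
      show "A \<in> sets F" using A by (simp add: sets_F invariant_sets_def)
      fix C assume "C \<in> cylinders (carrier G)"
      then have "C \<in> range cyl" unfolding cyl .
      then obtain k where k: "C = cyl k" by (rule rangeE)
      have jZ: "(\<one>, k) \<in> Z" by (simp add: Z_def)
      interpret finite_measure M by (rule fin)
      interpret F: finite_measure_subalgebra M F by unfold_locales (rule F)
      have CM: "C \<in> sets M"
        using \<open>C \<in> cylinders (carrier G)\<close> sets_path_space[OF countable_carrier] by (simp add: sets_M sigma_sets.Basic)
      have "AE x in M. nn_cond_exp M F (indicator C) x \<le> nn_cond_exp M F (\<lambda>_. 1) x"
        by (rule F.nn_cond_exp_mono) (use CM in \<open>auto simp: indicator_def\<close>)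
      moreover have "AE x in M. 1 = nn_cond_exp M F (\<lambda>_. 1) x"
        by (rule F.nn_cond_exp_F_meas[of "\<lambda>_. 1"]) simp
      ultimately have "AE x in M. nn_cond_exp M F (indicator C) x \<le> 1"
        by eventually_elim simp
      then have ae: "AE x in M. ennreal (\<pi> x (j (\<one>, k))) = nn_cond_exp M F (indicator C) x"
        using AE_space
      proof eventually_elim
        case (elim x)
        have "path_translate G \<one> x = x"
          using elim(2) by (auto simp: path_translate_def space_M Pi_iff)
        then have "\<pi> x (j (\<one>, k)) = enn2real (nn_cond_exp M F (indicator C) x)"
          by (simp add: \<pi>_def zj[OF jZ] e_def k)
        then show ?case using elim(1) by (simp add: less_top order_le_less_trans[OF _ ennreal_one_less_top])
      qed
      have "(\<lambda>x. ennreal (\<pi> x (j (\<one>, k)))) \<in> borel_measurable H"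
        by (rule measurable_compose[OF measurable_product_then_coordinatewise[OF \<pi>_H] measurable_ennreal])
      then show "\<exists>e\<in>borel_measurable H. AE x in M. e x = nn_cond_exp M F (indicator C) x"
        by (rule bexI[where x="\<lambda>x. ennreal (\<pi> x (j (\<one>, k)))", rotated]) (rule ae)
    qed
    then obtain B where B: "B \<in> sets H" "AE x in M. x \<in> A \<longleftrightarrow> x \<in> B" by (rule bexE)
    obtain C where C: "B = \<pi> -` C \<inter> ?\<Omega>" "C \<in> sets (borel :: (nat \<Rightarrow> real) measure)"
      using B(1) unfolding sets_H by (rule imageE)
    have "AE x in M. x \<in> A \<longleftrightarrow> \<pi> x \<in> C"
      using B(2) AE_space by eventually_elim (simp add: space_M C(1))
    then have "AE x in ?M. x \<in> A \<longleftrightarrow> \<pi> x \<in> C" by (rule iffD1[OF AE_M])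
    then show ?thesis using C(2) by (rule bexI)
  qed

  have a_mult: "a (g \<otimes> h) b = a g (a h b)" if "g \<in> carrier G" "h \<in> carrier G" for g h b
  proof
    fix i
    have "(fst (z i) \<otimes> g, snd (z i)) \<in> Z" using z1 that by (simp add: Z_def)
    then show "a (g \<otimes> h) b i = a g (a h b) i"
      using z1 that by (simp add: a_def zj m_assoc)
  qed
  have a_one: "a \<one> b = b" for b
    using z1 jz by (auto simp: a_def)
  have a_inv: "a (inv g) (a g b) = b" "a g (a (inv g) b) = b" if "g \<in> carrier G" for g b
    using that by (simp_all add: a_mult[symmetric] a_one)
  have bij: "a g \<in> Bij UNIV" if "g \<in> carrier G" for g
  proof -
    have "bij (a g)"
      by (rule o_bij[of "a (inv g)"]) (simp_all add: fun_eq_iff a_inv[OF that])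
    then show ?thesis by (simp add: Bij_def extensional_def)
  qed
  have action: "group_action G UNIV a"
  proof -
    have "a \<in> hom G (BijGroup UNIV)"
    proof (rule homI)
      show "a g \<in> carrier (BijGroup UNIV)" if "g \<in> carrier G" for g
        using bij[OF that] by (simp add: BijGroup_def)
      show "a (g \<otimes> h) = a g \<otimes>\<^bsub>BijGroup UNIV\<^esub> a h" if "g \<in> carrier G" "h \<in> carrier G" for g h
        using bij that a_mult[OF that] by (simp add: BijGroup_def compose_def fun_eq_iff)
    qed
    then have "group_hom G (BijGroup UNIV) a"
      by (intro group_hom.intro group_hom_axioms.intro group_BijGroup is_group)
    then show ?thesis by (rule group_action.intro)
  qed

  define \<nu> where "\<nu> = distr (group_walk G \<mu>) (borel :: (nat \<Rightarrow> real) measure) \<pi>"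
  have sets_\<nu>: "sets \<nu> = sets borel" and space_\<nu>: "space \<nu> = UNIV" by (simp_all add: \<nu>_def)
  have "poisson_boundary G \<mu> \<nu> a \<pi>"
    unfolding poisson_boundary_def ergodic_components_def measurable_action_def space_\<nu> sets_\<nu>
  proof (intro conjI ballI impI)
    show "standard_borel \<nu>"
      using standard_borel_borel[where 'b="nat \<Rightarrow> real"]
      unfolding standard_borel_def by (simp add: sets_\<nu> space_\<nu>)
    show "\<pi> \<in> measurable ?M \<nu>"
      by (subst measurable_cong_sets[OF sets_path_measures(2) sets_\<nu>]) (rule \<pi>_N)
    show "group_action G UNIV a" by (rule action)
    show "a g \<in> measurable \<nu> \<nu>" if "g \<in> carrier G" for g
    proof -
      have "a g \<in> borel_measurable borel"
      proof (rule measurable_coordinatewise_then_product)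
        fix i
        have "(\<lambda>b :: nat \<Rightarrow> real. b (j (fst (z i) \<otimes> g, snd (z i)))) \<in> borel_measurable borel"
          by (rule measurable_product_then_coordinatewise) simp
        then show "(\<lambda>b. a g b i) \<in> borel_measurable borel" unfolding a_def .
      qed
      then show ?thesis by (subst measurable_cong_sets[OF sets_\<nu> sets_\<nu>])
    qed
    show "AE x in ?M. \<pi> (path_translate G g x) = a g (\<pi> x)" if g: "g \<in> carrier G" for g
      using AE_space
    proof eventually_elim
      case (elim x)
      show ?case
      proof
        fix i
        have "(fst (z i) \<otimes> g, snd (z i)) \<in> Z" using z1 g by (simp add: Z_def)
        moreover have "path_translate G (fst (z i)) (path_translate G g x) = path_translate G (fst (z i) \<otimes> g) x"
          using elim z1 g by (auto simp: path_translate_def m_assoc Pi_iff)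
        ultimately show "\<pi> (path_translate G g x) i = a g (\<pi> x) i"
          by (simp add: \<pi>_def a_def zj)
      qed
    qed
    show "\<nu> = distr (group_walk G \<mu>) \<nu> \<pi>"
      unfolding \<nu>_def by (rule distr_cong) simp_all
    show "AE x in ?M. \<pi> (path_shift x) = \<pi> x" by (rule inv)
    show "\<exists>C\<in>sets borel. AE x in ?M. x \<in> A \<longleftrightarrow> \<pi> x \<in> C"
      if "A \<in> sets ?M" "AE x in ?M. path_shift x \<in> A \<longleftrightarrow> x \<in> A" for A
      using that by (rule gen)
  qed
  then show ?thesis by (intro exI)
qed

end

lemma (in schreier_data) countable_carrier: "countable (carrier G)"
proof -
  have closed: "foldr (\<otimes>) l \<one> \<in> carrier G" if "l \<in> lists K" for l
    using that K_carrier by (induction l) auto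
  have append: "foldr (\<otimes>) (l @ m) \<one> = foldr (\<otimes>) l \<one> \<otimes> foldr (\<otimes>) m \<one>"
    if "l \<in> lists K" "m \<in> lists K" for l m
    using that(1)
  proof (induction l)
    case Nil then show ?case using closed[OF that(2)] by simp
  next
    case (Cons k l)
    then have "k \<in> carrier G" "foldr (\<otimes>) l \<one> \<in> carrier G" using K_carrier closed by auto
    then show ?case using Cons.IH closed[OF that(2)] by (simp add: m_assoc)
  qed
  have "\<exists>l\<in>lists K. g = foldr (\<otimes>) l \<one>" if "g \<in> generate G K" for g
    using that
  proof induction
    case one then show ?case by (intro bexI[of _ "[]"]) auto
  next
    case (incl h) then show ?case using K_carrier by (intro bexI[of _ "[h]"]) auto
  next
    case (inv h)
    then have "inv h \<in> K" by (rule K_symmetric)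
    then show ?case using K_carrier by (intro bexI[of _ "[inv h]"]) auto
  next
    case (eng g h)
    then obtain l m where "l \<in> lists K" "g = foldr (\<otimes>) l \<one>" "m \<in> lists K" "h = foldr (\<otimes>) m \<one>"
      by blast
    then show ?case using append by (intro bexI[of _ "l @ m"]) auto
  qed
  then have "carrier G \<subseteq> (\<lambda>l. foldr (\<otimes>) l \<one>) ` lists K" unfolding K_generates by blast
  then show ?thesis
    by (rule countable_subset) (intro countable_image countable_lists countable_finite K_finite)
qed

corollary (in schreier_data) poisson_boundary_exists:
  assumes "set_pmf \<mu> \<subseteq> carrier G"
  shows "\<exists>(\<nu> :: (nat \<Rightarrow> real) measure) a \<pi>. poisson_boundary G \<mu> \<nu> a \<pi>"
proof -
  interpret countable_group_walk G \<mu>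
    by unfold_locales (rule countable_carrier, rule assms)
  show ?thesis by (rule poisson_boundary_exists)
qed

end

(* The counting measure on the vertices is invariant under the action, so the Dirichlet form of the
   induced walk (Gamma, mu) is a weighted sum of squared increments although the walk need not be
   reversible. Writing generators as products of elements of supp mu bounds the form of the simple
   random walk by a multiple of the form of mu. Transience of the simple random walk means
   u(y)^2 <= c E(u) for finitely supported u; applied to the truncated Green function of mu, whose
   energy is at most its value at the pole, this bounds that function uniformly, so (Gamma, mu) is
   transient. As mu has finite support, a step can only change the component of the complement of
   a finite set F near F, which happens finitely often: almost every path converges to an end.

   The field of limit ends is invariant under the time shift and is determined by countably many
   cylinder events, hence factors equivariantly through the Poisson boundary. If its law is a point
   mass at a field psi, conditioning on the first step gives psi(gamma.g) = psi(gamma) for g in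
   supp mu, so psi is constant because supp mu generates G as a semigroup and G acts transitively. *)

theory Submission
  imports Defs
begin

section \<open>Convergence to ends\<close>

text \<open>The capacity inequality is available for finitely supported functions only. Green
  functions are therefore cut off at \<open>N\<close>: finite support of the step law keeps them
  finitely supported, their value at the pole is a finite number that may be cancelled, and all
  bounds are uniform in \<open>N\<close>. From the pole the bound is carried to other vertices by a
  path of positive probability. For the simple random walk, boundedness comes from last visits,
  whose probabilities are transition probabilities times the escape probability.

  All walks live on the space of increments: walks from different vertices are coupled through one
  group walk, and the Markov property is the splitting off of the first increment.

  The Poisson boundary is specified modulo null sets only. The factor map is rebuilt from countably
  many events of the boundary, on the measurable set where these events describe a field, with a
  fixed field elsewhere. Equivariance is checked for the walk started from the counting measure,
  because translation preserves its null sets but moves the walk issued from the identity off its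
  starting point.\<close>

context schreier_data
begin

abbreviation "schreier \<equiv> schreier_graph \<Gamma> act K"
abbreviation "comps \<equiv> complement_components schreier"

lemma act_inv:
  assumes "\<gamma> \<in> \<Gamma>" "g \<in> carrier G"
  shows "act (act \<gamma> g) (inv g) = \<gamma>" "act (act \<gamma> (inv g)) g = \<gamma>"
  using act_mult[of \<gamma> g "inv g"] act_mult[of \<gamma> "inv g" g] assms by (simp_all add: act_one)

lemma bij_betw_act: "g \<in> carrier G \<Longrightarrow> bij_betw (\<lambda>\<gamma>. act \<gamma> g) \<Gamma> \<Gamma>"
  by (rule bij_betw_byWitness[where f'="\<lambda>\<gamma>. act \<gamma> (inv g)"]) (auto simp: act_inv act_closed)

lemma countable_vertices: "countable \<Gamma>"
proof -
  obtain \<gamma> where "\<gamma> \<in> \<Gamma>" using nonempty by blast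
  then have "\<Gamma> \<subseteq> act \<gamma> ` carrier G" using act_transitive by blast
  then show ?thesis by (rule countable_subset) (intro countable_image countable_carrier)
qed

lemma verts_schreier [simp]: "verts schreier = \<Gamma>"
  by (simp add: schreier_graph_def)

lemma arcs_ends_schreier: "arcs_ends schreier = {(\<gamma>, act \<gamma> k) | \<gamma> k. \<gamma> \<in> \<Gamma> \<and> k \<in> K}"
  by (auto simp: arcs_ends_conv schreier_graph_def image_iff)

lemma wf_schreier: "wf_digraph schreier"
  using K_carrier by unfold_locales (auto simp: schreier_graph_def act_closed)

lemma symmetric_schreier: "symmetric schreier"
  unfolding symmetric_def
proof (rule symI)
  fix x y assume "(x, y) \<in> arcs_ends schreier"
  then obtain k where k: "x \<in> \<Gamma>" "k \<in> K" "y = act x k" by (auto simp: arcs_ends_schreier)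
  then have "x = act y (inv k)" "y \<in> \<Gamma>" "inv k \<in> K"
    using K_carrier K_symmetric by (auto simp: act_inv act_closed)
  then show "(y, x) \<in> arcs_ends schreier" unfolding arcs_ends_schreier by blast
qed

lemma wf_complement: "wf_digraph (schreier \<restriction> (\<Gamma> - F))"
  using wf_schreier by (rule wf_digraph.wellformed_induce_subgraph)

lemma symmetric_complement: "symmetric (schreier \<restriction> (\<Gamma> - F))"
  using induced_graph_imp_symmetric[OF symmetric_schreier wf_digraph.induced_induce[OF wf_schreier]]
  by simp

section \<open>Components of complements of finite sets\<close>

lemma component_reachable:
  "\<lbrakk>C \<in> comps F; x \<in> C; y \<in> C\<rbrakk> \<Longrightarrow> x \<rightarrow>\<^sup>*\<^bsub>schreier \<restriction> (\<Gamma> - F)\<^esub> y"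
  unfolding complement_components_def pre_digraph.sccs_verts_def by simp

lemma component_closed:
  assumes "C \<in> comps F" "x \<in> C" "x \<rightarrow>\<^sup>*\<^bsub>schreier \<restriction> (\<Gamma> - F)\<^esub> y"
  shows "y \<in> C"
  using assms symmetric_reachable[OF symmetric_complement assms(3)]
  unfolding complement_components_def pre_digraph.sccs_verts_def by auto

lemma component_nonempty: "C \<in> comps F \<Longrightarrow> C \<noteq> {}"
  unfolding complement_components_def pre_digraph.sccs_verts_def by simp

lemma component_subset: "C \<in> comps F \<Longrightarrow> C \<subseteq> \<Gamma> - F"
  using wf_digraph.sccs_verts_subsets[OF wf_complement] unfolding complement_components_def by simp

lemma components_disjoint: "\<lbrakk>C \<in> comps F; C' \<in> comps F; x \<in> C; x \<in> C'\<rbrakk> \<Longrightarrow> C = C'"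
  using component_reachable component_closed by blast

lemma components_eq: "comps F = pre_digraph.scc_of (schreier \<restriction> (\<Gamma> - F)) ` (\<Gamma> - F)"
  using wf_digraph.sccs_verts_conv_scc_of[OF wf_complement] unfolding complement_components_def by simp

lemma countable_components: "countable (comps F)"
  unfolding components_eq using countable_vertices by (intro countable_image) blast

lemma component_exists: "\<lbrakk>x \<in> \<Gamma>; x \<notin> F\<rbrakk> \<Longrightarrow> \<exists>C\<in>comps F. x \<in> C"
  unfolding components_eq using wf_digraph.in_scc_of_self[OF wf_complement, of x F] by auto

lemma component_step:
  assumes "C \<in> comps F" "x \<in> C" "k \<in> K" "act x k \<notin> F"
  shows "act x k \<in> C"
proof (rule component_closed[OF assms(1,2)])
  have x: "x \<in> \<Gamma> - F" using component_subset assms by blast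
  then have "act x k \<in> \<Gamma>" using assms K_carrier act_closed by blast
  then have "(x, k) \<in> arcs (schreier \<restriction> (\<Gamma> - F))" "tail schreier (x, k) = x" "head schreier (x, k) = act x k"
    using x assms by (auto simp: schreier_graph_def)
  then have "x \<rightarrow>\<^bsub>schreier \<restriction> (\<Gamma> - F)\<^esub> act x k"
    unfolding arcs_ends_conv by force
  then show "x \<rightarrow>\<^sup>*\<^bsub>schreier \<restriction> (\<Gamma> - F)\<^esub> act x k"
    by (rule wf_digraph.reachable_adjI[OF wf_complement])
qed

lemma component_mono:
  assumes "F \<subseteq> F'" "C \<in> comps F" "C' \<in> comps F'" "x \<in> C" "x \<in> C'"
  shows "C' \<subseteq> C"
proof
  fix y assume "y \<in> C'"
  have "x \<rightarrow>\<^sup>*\<^bsub>schreier \<restriction> (\<Gamma> - F')\<^esub> y"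
    by (rule component_reachable[OF assms(3,5) \<open>y \<in> C'\<close>])
  then have "x \<rightarrow>\<^sup>*\<^bsub>schreier \<restriction> (\<Gamma> - F)\<^esub> y"
    unfolding reachable_def
    by (rule rtrancl_on_mono[rotated 2]) (use assms(1) in \<open>auto simp: arcs_ends_conv\<close>)
  then show "y \<in> C"
    using component_closed[OF assms(2,4)] by simp
qed

section \<open>Ends, the end compactification and convergence\<close>

lemma end_component: "\<lbrakk>\<omega> \<in> ends schreier; finite F; F \<subseteq> \<Gamma>\<rbrakk> \<Longrightarrow> \<omega> F \<in> comps F"
  unfolding ends_def by (auto simp: PiE_iff)

lemma end_mono: "\<lbrakk>\<omega> \<in> ends schreier; finite F'; F' \<subseteq> \<Gamma>; F \<subseteq> F'\<rbrakk> \<Longrightarrow> \<omega> F' \<subseteq> \<omega> F"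
  unfolding ends_def by simp

lemma ends_eqI:
  assumes "\<omega> \<in> ends schreier" "\<omega>' \<in> ends schreier"
    and "\<And>F. \<lbrakk>finite F; F \<subseteq> \<Gamma>\<rbrakk> \<Longrightarrow> \<omega> F = \<omega>' F"
  shows "\<omega> = \<omega>'"
proof (rule PiE_ext)
  show "\<omega> \<in> (\<Pi>\<^sub>E F\<in>{F. finite F \<and> F \<subseteq> \<Gamma>}. comps F)" "\<omega>' \<in> (\<Pi>\<^sub>E F\<in>{F. finite F \<and> F \<subseteq> \<Gamma>}. comps F)"
    using assms(1,2) unfolding ends_def by auto
qed (use assms(3) in auto)

lemma openin_cylinder:
  "\<lbrakk>finite F; F \<subseteq> \<Gamma>; C \<in> comps F\<rbrakk>
    \<Longrightarrow> openin (end_compactification schreier) (Inl ` C \<union> Inr ` {\<omega> \<in> ends schreier. \<omega> F = C})"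
  unfolding end_compactification_def by (rule topology_generated_by_Basis) auto

text \<open>The topology is given by a subbasis, but one finite set suffices for a neighbourhood of
  an end. Intersections merge \<open>F\<close> and \<open>F'\<close> into their union: the component
  chosen at the union is non-empty and lies in the components chosen at \<open>F\<close> and at
  \<open>F'\<close>, so by disjointness it determines both.\<close>

lemma end_neighbourhood:
  assumes "openin (end_compactification schreier) U" "\<omega> \<in> ends schreier" "Inr \<omega> \<in> U"
  shows "\<exists>F. finite F \<and> F \<subseteq> \<Gamma> \<and> Inl ` \<omega> F \<subseteq> U \<and> (\<forall>\<omega>'\<in>ends schreier. \<omega>' F = \<omega> F \<longrightarrow> Inr \<omega>' \<in> U)"
proof -
  have "generate_topology_on
    ({{Inl v} | v. v \<in> verts schreier} \<union>
     {Inl ` C \<union> Inr ` {\<omega> \<in> ends schreier. \<omega> F = C} | F C.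
        finite F \<and> F \<subseteq> verts schreier \<and> C \<in> comps F}) U"
    using assms(1) unfolding end_compactification_def by (rule openin_topology_generated_by)
  then show ?thesis using assms(3)
  proof induction
    case Empty then show ?case by simp
  next
    case (Int U V)
    then have "Inr \<omega> \<in> U" "Inr \<omega> \<in> V" by auto
    obtain F where F: "finite F" "F \<subseteq> \<Gamma>" "Inl ` \<omega> F \<subseteq> U"
        "\<And>\<omega>'. \<lbrakk>\<omega>' \<in> ends schreier; \<omega>' F = \<omega> F\<rbrakk> \<Longrightarrow> Inr \<omega>' \<in> U"
      using Int.IH(1)[OF \<open>Inr \<omega> \<in> U\<close>] by auto
    obtain F' where F': "finite F'" "F' \<subseteq> \<Gamma>" "Inl ` \<omega> F' \<subseteq> V"
        "\<And>\<omega>'. \<lbrakk>\<omega>' \<in> ends schreier; \<omega>' F' = \<omega> F'\<rbrakk> \<Longrightarrow> Inr \<omega>' \<in> V"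
      using Int.IH(2)[OF \<open>Inr \<omega> \<in> V\<close>] by auto
    have fin: "finite (F \<union> F')" "F \<union> F' \<subseteq> \<Gamma>" using F F' by auto
    have agree: "\<omega>' E = \<omega> E"
      if "\<omega>' \<in> ends schreier" "\<omega>' (F \<union> F') = \<omega> (F \<union> F')" "finite E" "E \<subseteq> F \<union> F'" for \<omega>' E
    proof -
      have "\<omega> (F \<union> F') \<noteq> {}" using end_component[OF assms(2) fin] component_nonempty by blast
      then obtain x where x: "x \<in> \<omega> (F \<union> F')" by blast
      have E: "E \<subseteq> \<Gamma>" using that fin by blast
      have "x \<in> \<omega>' E" "x \<in> \<omega> E"
        using x that(2) end_mono[OF that(1) fin that(4)] end_mono[OF assms(2) fin that(4)] by blast+
      then show ?thesis
        using components_disjoint end_component that(1,3) assms(2) E by blast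
    qed
    have "Inl ` \<omega> (F \<union> F') \<subseteq> U \<inter> V"
      using end_mono[OF assms(2) fin, of F] end_mono[OF assms(2) fin, of F'] F(3) F'(3)
      by (fastforce simp: image_subset_iff)
    moreover have "Inr \<omega>' \<in> U \<inter> V" if "\<omega>' \<in> ends schreier" "\<omega>' (F \<union> F') = \<omega> (F \<union> F')" for \<omega>'
      using agree[OF that, of F] agree[OF that, of F'] F F' that(1) by auto
    ultimately show ?case using fin by (intro exI[of _ "F \<union> F'"]) simp
  next
    case (UN \<U>)
    then obtain V where "V \<in> \<U>" "Inr \<omega> \<in> V" by blast
    with UN.IH[of V] obtain F where "finite F" "F \<subseteq> \<Gamma>" "Inl ` \<omega> F \<subseteq> V"
      "\<forall>\<omega>'\<in>ends schreier. \<omega>' F = \<omega> F \<longrightarrow> Inr \<omega>' \<in> V" by blast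
    then show ?case using \<open>V \<in> \<U>\<close> by (intro exI[of _ F]) blast
  next
    case (Basis U)
    then obtain F C where U: "U = Inl ` C \<union> Inr ` {\<omega> \<in> ends schreier. \<omega> F = C}" "finite F" "F \<subseteq> \<Gamma>"
      by auto
    then have "\<omega> F = C" using Basis by auto
    then show ?case using U by (intro exI[of _ F]) auto
  qed
qed

lemma end_in_topspace: "\<omega> \<in> ends schreier \<Longrightarrow> Inr \<omega> \<in> topspace (end_compactification schreier)"
  using openin_subset[OF openin_cylinder[of "{}" "\<omega> {}"]] end_component[of \<omega> "{}"] by auto

text \<open>Cylinders of single finite sets form a neighbourhood basis at an end, which turns
  topological convergence into a combinatorial condition on tails.\<close>

lemma converges_to_end_iff:
  "converges_to_end schreier x \<omega> \<longleftrightarrow>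
    \<omega> \<in> ends schreier \<and> (\<forall>F. finite F \<and> F \<subseteq> \<Gamma> \<longrightarrow> (\<forall>\<^sub>F n in sequentially. x n \<in> \<omega> F))"
proof (intro iffI conjI allI impI)
  show \<omega>: "\<omega> \<in> ends schreier" if "converges_to_end schreier x \<omega>"
    using that by (simp add: converges_to_end_def)
  show "\<forall>\<^sub>F n in sequentially. x n \<in> \<omega> F" if "converges_to_end schreier x \<omega>" "finite F \<and> F \<subseteq> \<Gamma>" for F
  proof -
    have F: "finite F" "F \<subseteq> \<Gamma>" using that by auto
    note U = openin_cylinder[OF F end_component[OF \<omega>[OF that(1)] F]]
    have "\<forall>\<^sub>F n in sequentially. Inl (x n) \<in> Inl ` \<omega> F \<union> Inr ` {\<omega>' \<in> ends schreier. \<omega>' F = \<omega> F}"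
      using that(1) \<omega>[OF that(1)] U unfolding converges_to_end_def limitin_def by auto
    then show ?thesis by eventually_elim auto
  qed
next
  assume *: "\<omega> \<in> ends schreier \<and> (\<forall>F. finite F \<and> F \<subseteq> \<Gamma> \<longrightarrow> (\<forall>\<^sub>F n in sequentially. x n \<in> \<omega> F))"
  show "converges_to_end schreier x \<omega>"
    unfolding converges_to_end_def limitin_def
  proof (intro conjI allI impI)
    fix U assume "openin (end_compactification schreier) U \<and> Inr \<omega> \<in> U"
    then obtain F where F: "finite F" "F \<subseteq> \<Gamma>" "Inl ` \<omega> F \<subseteq> U" using end_neighbourhood * by meson
    then have "\<forall>\<^sub>F n in sequentially. x n \<in> \<omega> F" using * by blast
    then show "\<forall>\<^sub>F n in sequentially. Inl (x n) \<in> U" by eventually_elim (use F in blast)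
  qed (use * end_in_topspace in auto)
qed

lemma converges_to_end_unique:
  assumes "converges_to_end schreier x \<omega>" "converges_to_end schreier x \<omega>'"
  shows "\<omega> = \<omega>'"
proof (rule ends_eqI)
  show \<omega>: "\<omega> \<in> ends schreier" "\<omega>' \<in> ends schreier" using assms by (auto simp: converges_to_end_iff)
  fix F assume F: "finite F" "F \<subseteq> \<Gamma>"
  have "\<forall>\<^sub>F n in sequentially. x n \<in> \<omega> F \<and> x n \<in> \<omega>' F"
    using assms F by (intro eventually_conj) (auto simp: converges_to_end_iff)
  then obtain n where "x n \<in> \<omega> F" "x n \<in> \<omega>' F" unfolding eventually_sequentially by blast
  then show "\<omega> F = \<omega>' F" using components_disjoint end_component \<omega> F by blast
qed

lemma limit_end_eq: "converges_to_end schreier x \<omega> \<Longrightarrow> limit_end schreier x = \<omega>"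
  unfolding limit_end_def using converges_to_end_unique by (auto intro: the_equality)

text \<open>Components that contain a tail fit together by themselves: for
  \<open>F \<subseteq> F'\<close> they share a point of the path, so \<open>component_mono\<close>
  applies. The right-hand side quantifies over countable sets only, which makes convergence a
  measurable event.\<close>

lemma ex_converges_to_end_iff:
  "(\<exists>\<omega>. converges_to_end schreier x \<omega>) \<longleftrightarrow>
    (\<forall>F\<in>{F. finite F \<and> F \<subseteq> \<Gamma>}. \<exists>C\<in>comps F. \<forall>\<^sub>F n in sequentially. x n \<in> C)" (is "?L \<longleftrightarrow> ?R")
proof
  assume ?L then show ?R using end_component by (fastforce simp: converges_to_end_iff)
next
  assume R: ?R
  define \<omega> where "\<omega> = (\<lambda>F\<in>{F. finite F \<and> F \<subseteq> \<Gamma>}.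
    SOME C. C \<in> comps F \<and> (\<forall>\<^sub>F n in sequentially. x n \<in> C))"
  have \<omega>: "\<omega> F \<in> comps F" "\<forall>\<^sub>F n in sequentially. x n \<in> \<omega> F" if "finite F" "F \<subseteq> \<Gamma>" for F
  proof -
    have "\<exists>C. C \<in> comps F \<and> (\<forall>\<^sub>F n in sequentially. x n \<in> C)" using R that by blast
    then show "\<omega> F \<in> comps F" "\<forall>\<^sub>F n in sequentially. x n \<in> \<omega> F"
      unfolding \<omega>_def using someI_ex[of "\<lambda>C. C \<in> comps F \<and> (\<forall>\<^sub>F n in sequentially. x n \<in> C)"] that
      by simp_all
  qed
  have "\<omega> F' \<subseteq> \<omega> F" if F: "finite F'" "F' \<subseteq> \<Gamma>" "F \<subseteq> F'" for F F'
  proof -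
    have F2: "finite F" "F \<subseteq> \<Gamma>" using F by (auto intro: finite_subset)
    have "\<forall>\<^sub>F n in sequentially. x n \<in> \<omega> F \<and> x n \<in> \<omega> F'"
      using \<omega>(2)[OF F2] \<omega>(2)[OF F(1,2)] by (rule eventually_conj)
    then obtain n where "x n \<in> \<omega> F" "x n \<in> \<omega> F'" unfolding eventually_sequentially by blast
    then show ?thesis using component_mono[OF F(3)] \<omega>(1) F F2 by blast
  qed
  then have "\<omega> \<in> ends schreier" unfolding ends_def using \<omega>(1) by (auto simp: \<omega>_def)
  then show ?L using \<omega>(2) by (auto simp: converges_to_end_iff)
qed

lemma converges_to_end_Suc:
  "converges_to_end schreier (\<lambda>n. x (Suc n)) \<omega> \<longleftrightarrow> converges_to_end schreier x \<omega>"
  unfolding converges_to_end_iff using eventually_sequentially_Suc[of "\<lambda>n. x n \<in> _"] by simp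

lemma limit_end_Suc: "limit_end schreier (\<lambda>n. x (Suc n)) = limit_end schreier x"
  unfolding limit_end_def converges_to_end_Suc ..

section \<open>The Borel structure of the space of ends and of the space of end fields\<close>

lemma space_end_space: "space (end_space schreier) = ends schreier"
proof -
  have "space (end_space schreier) = Inr -` topspace (end_compactification schreier) \<inter> ends schreier"
    unfolding end_space_def borel_of_def topspace_pullback_topology[symmetric]
    by (rule space_measure_of) (auto dest: openin_subset)
  then show ?thesis using end_in_topspace by auto
qed

lemma countable_finite_subsets: "countable {F. finite F \<and> F \<subseteq> \<Gamma>}"
  by (rule countable_Collect_finite_subset[OF countable_vertices])

text \<open>An open set of ends is the union of the cylinders that it contains, and there are only
  countably many pairs of a finite set and a component of its complement.\<close>

lemma sets_end_space:
  "sets (end_space schreier) =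
    sigma_sets (ends schreier) {{\<omega> \<in> ends schreier. \<omega> F = C} | F C. finite F \<and> F \<subseteq> \<Gamma> \<and> C \<in> comps F}"
    (is "_ = sigma_sets _ ?E")
proof -
  let ?X = "pullback_topology (ends schreier) Inr (end_compactification schreier)"
  have top: "topspace ?X = ends schreier"
    using end_in_topspace by (auto simp: topspace_pullback_topology)
  have eq: "sets (end_space schreier) = sigma_sets (ends schreier) {U. openin ?X U}"
    unfolding end_space_def borel_of_def top
    by (subst sets_measure_of) (use openin_subset[of ?X] in \<open>auto simp: top\<close>)
  interpret S: sigma_algebra "ends schreier" "sigma_sets (ends schreier) ?E"
    by (rule sigma_algebra_sigma_sets) auto
  show ?thesis unfolding eq
  proof (rule sigma_sets_eqI)
    fix A assume "A \<in> ?E"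
    then obtain F C where A: "A = {\<omega> \<in> ends schreier. \<omega> F = C}" "finite F" "F \<subseteq> \<Gamma>" "C \<in> comps F"
      by blast
    have "A = Inr -` (Inl ` C \<union> Inr ` {\<omega> \<in> ends schreier. \<omega> F = C}) \<inter> ends schreier" using A by auto
    then have "openin ?X A" unfolding openin_pullback_topology using openin_cylinder A(2-4) by blast
    then show "A \<in> sigma_sets (ends schreier) {U. openin ?X U}" by (intro sigma_sets.Basic) simp
  next
    fix A assume "A \<in> {U. openin ?X U}"
    then obtain U where U: "openin (end_compactification schreier) U" "A = Inr -` U \<inter> ends schreier"
      by (auto simp: openin_pullback_topology)
    define I where "I = {p \<in> Sigma {F. finite F \<and> F \<subseteq> \<Gamma>} comps.
      {\<omega> \<in> ends schreier. \<omega> (fst p) = snd p} \<subseteq> A}"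
    have "A = (\<Union>p\<in>I. {\<omega> \<in> ends schreier. \<omega> (fst p) = snd p})"
    proof
      show "A \<subseteq> (\<Union>p\<in>I. {\<omega> \<in> ends schreier. \<omega> (fst p) = snd p})"
      proof
        fix \<omega> assume "\<omega> \<in> A"
        then have \<omega>: "\<omega> \<in> ends schreier" "Inr \<omega> \<in> U" using U by auto
        then obtain F where F: "finite F" "F \<subseteq> \<Gamma>" "\<forall>\<omega>'\<in>ends schreier. \<omega>' F = \<omega> F \<longrightarrow> Inr \<omega>' \<in> U"
          using end_neighbourhood[OF U(1) \<omega>] by auto
        then have "(F, \<omega> F) \<in> I" using \<omega> end_component U(2) by (auto simp: I_def)
        then show "\<omega> \<in> (\<Union>p\<in>I. {\<omega> \<in> ends schreier. \<omega> (fst p) = snd p})" using \<omega>(1) by (intro UN_I[of "(F, \<omega> F)"]) simp_all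
      qed
    qed (auto simp: I_def)
    also have "\<dots> \<in> sigma_sets (ends schreier) ?E"
    proof (rule S.countable_UN'')
      have "countable (Sigma {F. finite F \<and> F \<subseteq> \<Gamma>} comps)"
        by (intro countable_SIGMA countable_finite_subsets countable_components)
      then show "countable I" by (rule countable_subset[rotated]) (auto simp: I_def)
      show "{\<omega> \<in> ends schreier. \<omega> (fst p) = snd p} \<in> sigma_sets (ends schreier) ?E" if "p \<in> I" for p
        using that by (intro sigma_sets.Basic CollectI exI[of _ "fst p"] exI[of _ "snd p"]) (auto simp: I_def)
    qed
    finally show "A \<in> sigma_sets (ends schreier) ?E" .
  qed
qed

lemma cylinder_measurable:
  assumes "finite F" "F \<subseteq> \<Gamma>"
  shows "{\<omega> \<in> ends schreier. \<omega> F = C} \<in> sets (end_space schreier)"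
proof (cases "C \<in> comps F")
  case True then show ?thesis unfolding sets_end_space using assms by (intro sigma_sets.Basic) blast
next
  case False
  then have "{\<omega> \<in> ends schreier. \<omega> F = C} = {}" using end_component assms by blast
  then show ?thesis by (metis sets.empty_sets)
qed

lemma measurable_end_space:
  assumes "\<And>x. x \<in> space M \<Longrightarrow> f x \<in> ends schreier"
    and "\<And>F C. \<lbrakk>finite F; F \<subseteq> \<Gamma>; C \<in> comps F\<rbrakk> \<Longrightarrow> {x \<in> space M. f x F = C} \<in> sets M"
  shows "f \<in> measurable M (end_space schreier)"
proof (rule measurable_sigma_sets[OF sets_end_space])
  fix A assume "A \<in> {{\<omega> \<in> ends schreier. \<omega> F = C} | F C. finite F \<and> F \<subseteq> \<Gamma> \<and> C \<in> comps F}"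
  then obtain F C where A: "A = {\<omega> \<in> ends schreier. \<omega> F = C}" "finite F" "F \<subseteq> \<Gamma>" "C \<in> comps F"
    by blast
  have "f -` A \<inter> space M = {x \<in> space M. f x F = C}" using assms(1) A by auto
  then show "f -` A \<inter> space M \<in> sets M" using assms(2) A by simp
qed (use assms(1) in auto)

lemma space_end_fields: "space (end_fields schreier) = (\<Pi>\<^sub>E \<gamma>\<in>\<Gamma>. ends schreier)"
  by (simp add: end_fields_def space_PiM space_end_space)

lemma measurable_end_fields:
  assumes "\<And>x. x \<in> space M \<Longrightarrow> f x \<in> space (end_fields schreier)"
    and "\<And>\<gamma> F C. \<lbrakk>\<gamma> \<in> \<Gamma>; finite F; F \<subseteq> \<Gamma>; C \<in> comps F\<rbrakk> \<Longrightarrow> {x \<in> space M. f x \<gamma> F = C} \<in> sets M"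
  shows "f \<in> measurable M (end_fields schreier)"
  unfolding end_fields_def
proof (rule measurable_PiM_single')
  fix \<gamma> assume "\<gamma> \<in> verts schreier"
  then show "(\<lambda>x. f x \<gamma>) \<in> measurable M (end_space schreier)"
    using assms by (intro measurable_end_space) (auto simp: space_end_fields)
qed (use assms(1) in \<open>auto simp: space_end_fields space_end_space\<close>)

lemma end_field_coordinate_measurable:
  assumes "f \<in> measurable M (end_fields schreier)" "\<gamma> \<in> \<Gamma>" "finite F" "F \<subseteq> \<Gamma>"
  shows "{x \<in> space M. f x \<gamma> F = C} \<in> sets M"
proof -
  have m: "(\<lambda>x. f x \<gamma>) \<in> measurable M (end_space schreier)"
    using measurable_compose[OF assms(1)[unfolded end_fields_def] measurable_component_singleton] assms(2)
    by simp
  have "{x \<in> space M. f x \<gamma> F = C} = (\<lambda>x. f x \<gamma>) -` {\<omega> \<in> ends schreier. \<omega> F = C} \<inter> space M"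
    using measurable_space[OF m] by (auto simp: space_end_space)
  then show ?thesis using measurable_sets[OF m cylinder_measurable[OF assms(3,4)]] by simp
qed

lemma end_field_eq_iff:
  assumes "\<phi> \<in> space (end_fields schreier)" "\<psi> \<in> space (end_fields schreier)"
  shows "\<phi> = \<psi> \<longleftrightarrow> (\<forall>\<gamma>\<in>\<Gamma>. \<forall>F\<in>{F. finite F \<and> F \<subseteq> \<Gamma>}. \<forall>C\<in>comps F. \<phi> \<gamma> F = C \<longleftrightarrow> \<psi> \<gamma> F = C)"
    (is "_ \<longleftrightarrow> ?R")
proof
  assume R: ?R
  show "\<phi> = \<psi>"
  proof (rule PiE_ext)
    show "\<phi> \<in> (\<Pi>\<^sub>E \<gamma>\<in>\<Gamma>. ends schreier)" "\<psi> \<in> (\<Pi>\<^sub>E \<gamma>\<in>\<Gamma>. ends schreier)"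
      using assms by (simp_all add: space_end_fields)
    then show "\<phi> \<gamma> = \<psi> \<gamma>" if "\<gamma> \<in> \<Gamma>" for \<gamma>
    proof (intro ends_eqI)
      fix F assume F: "finite F" "F \<subseteq> \<Gamma>"
      have "\<phi> \<gamma> F \<in> comps F"
        using \<open>\<phi> \<in> (\<Pi>\<^sub>E \<gamma>\<in>\<Gamma>. ends schreier)\<close> that F by (auto intro: end_component)
      then show "\<phi> \<gamma> F = \<psi> \<gamma> F" using R that F by blast
    qed (use that in auto)
  qed
qed simp

text \<open>Countably many cylinder events separate fields. Measurability of this set allows almost
  sure equalities to pass through image measures and makes singletons of fields measurable.\<close>

lemma end_field_eq_measurable:
  assumes "f \<in> measurable M (end_fields schreier)" "g \<in> measurable M (end_fields schreier)"
  shows "{x \<in> space M. f x = g x} \<in> sets M"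
proof -
  have iff: "{x \<in> space M. f x \<gamma> F = C \<longleftrightarrow> g x \<gamma> F = C} \<in> sets M"
    if "\<gamma> \<in> \<Gamma>" "finite F" "F \<subseteq> \<Gamma>" for \<gamma> F C
    unfolding iff_conv_conj_imp
    by (intro sets.sets_Collect_conj sets.sets_Collect_imp
        end_field_coordinate_measurable[OF assms(1) that] end_field_coordinate_measurable[OF assms(2) that])
  have "{x \<in> space M. f x = g x} = {x \<in> space M. \<forall>\<gamma>\<in>\<Gamma>. \<forall>F\<in>{F. finite F \<and> F \<subseteq> \<Gamma>}. \<forall>C\<in>comps F.
      f x \<gamma> F = C \<longleftrightarrow> g x \<gamma> F = C}"
    by (intro Collect_cong conj_cong refl) (rule end_field_eq_iff[OF assms[THEN measurable_space]])
  also have "\<dots> \<in> sets M"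
    by (intro sets.sets_Collect_countable_All' countable_vertices countable_finite_subsets countable_components iff) auto
  finally show ?thesis .
qed

end

section \<open>Dirichlet forms and Green functions\<close>

context schreier_data
begin

section \<open>Finitely supported functions and sums over the vertices\<close>

definition finsupp :: "('x \<Rightarrow> real) \<Rightarrow> bool"
  where "finsupp u \<longleftrightarrow> finite {x \<in> \<Gamma>. u x \<noteq> 0}"

lemma finsupp_subset:
  assumes "finsupp u" "\<And>x. \<lbrakk>x \<in> \<Gamma>; u x = 0\<rbrakk> \<Longrightarrow> v x = 0"
  shows "finsupp v"
  using assms unfolding finsupp_def by (elim finite_subset[rotated]) auto

lemma finsupp_indicator [simp]: "finsupp (indicator {y})"
  unfolding finsupp_def by (rule finite_subset[of _ "{y}"]) (auto simp: indicator_def)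

lemma finsupp_zero [simp]: "finsupp (\<lambda>x. 0)"
  by (simp add: finsupp_def)

lemma finsupp_add [simp]: "\<lbrakk>finsupp u; finsupp v\<rbrakk> \<Longrightarrow> finsupp (\<lambda>x. u x + v x)"
  unfolding finsupp_def
  by (rule finite_subset[of _ "{x \<in> \<Gamma>. u x \<noteq> 0} \<union> {x \<in> \<Gamma>. v x \<noteq> 0}"]) auto

lemma finsupp_cmult [simp]: "finsupp u \<Longrightarrow> finsupp (\<lambda>x. c * u x)"
  by (erule finsupp_subset) simp

lemma finsupp_mult [simp]: "finsupp u \<Longrightarrow> finsupp (\<lambda>x. u x * v x)"
  by (erule finsupp_subset) simp

lemma finsupp_power2 [simp]: "finsupp u \<Longrightarrow> finsupp (\<lambda>x. (u x)\<^sup>2)"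
  by (erule finsupp_subset) simp

lemma finsupp_diff [simp]: "\<lbrakk>finsupp u; finsupp v\<rbrakk> \<Longrightarrow> finsupp (\<lambda>x. u x - v x)"
  using finsupp_add[of u "\<lambda>x. -1 * v x"] finsupp_cmult[of v "-1"] by simp

lemma finsupp_sum [simp]: "(\<And>i. i \<in> I \<Longrightarrow> finsupp (u i)) \<Longrightarrow> finsupp (\<lambda>x. \<Sum>i\<in>I. u i x)"
  by (induction I rule: infinite_finite_induct) auto

lemma finsupp_act [simp]:
  assumes "g \<in> carrier G" "finsupp u"
  shows "finsupp (\<lambda>x. u (act x g))"
proof -
  have "finite ((\<lambda>x. act x g) -` {x \<in> \<Gamma>. u x \<noteq> 0} \<inter> \<Gamma>)"
    using assms bij_betw_act[OF assms(1)]
    by (intro finite_vimage_IntI) (auto simp: finsupp_def bij_betw_def)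
  then show ?thesis
    unfolding finsupp_def by (rule rev_finite_subset) (use assms act_closed in auto)
qed

lemma finsupp_summable [simp]: "finsupp u \<Longrightarrow> u summable_on \<Gamma>"
  unfolding finsupp_def
  by (subst summable_on_cong_neutral[where T="{x \<in> \<Gamma>. u x \<noteq> 0}" and g=u]) auto

text \<open>Meant for finitely supported functions. Summing over all of \<open>\<Gamma>\<close>
  instead of a support makes invariance under the action a reindexing by a bijection.\<close>

definition vertex_sum :: "('x \<Rightarrow> real) \<Rightarrow> real"
  where "vertex_sum u = (\<Sum>\<^sub>\<infinity>x\<in>\<Gamma>. u x)"

lemma vertex_sum_add: "\<lbrakk>finsupp u; finsupp v\<rbrakk> \<Longrightarrow> vertex_sum (\<lambda>x. u x + v x) = vertex_sum u + vertex_sum v"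
  unfolding vertex_sum_def by (rule infsum_add) simp_all

lemma vertex_sum_cmult: "vertex_sum (\<lambda>x. c * u x) = c * vertex_sum u"
  unfolding vertex_sum_def by (rule infsum_cmult_right')

lemma vertex_sum_diff: "\<lbrakk>finsupp u; finsupp v\<rbrakk> \<Longrightarrow> vertex_sum (\<lambda>x. u x - v x) = vertex_sum u - vertex_sum v"
  using vertex_sum_add[of u "\<lambda>x. -1 * v x"] finsupp_cmult[of v "-1"] vertex_sum_cmult[of "-1" v] by simp

lemma vertex_sum_sum: "(\<And>i. i \<in> I \<Longrightarrow> finsupp (u i)) \<Longrightarrow> vertex_sum (\<lambda>x. \<Sum>i\<in>I. u i x) = (\<Sum>i\<in>I. vertex_sum (u i))"
proof (induction I rule: infinite_finite_induct)
  case (insert i I)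
  then show ?case by (simp add: vertex_sum_add)
qed (simp_all add: vertex_sum_def)

lemma vertex_sum_act: "g \<in> carrier G \<Longrightarrow> vertex_sum (\<lambda>x. u (act x g)) = vertex_sum u"
  unfolding vertex_sum_def by (rule infsum_reindex_bij_betw[OF bij_betw_act])

lemma vertex_sum_mono:
  "\<lbrakk>finsupp u; finsupp v; \<And>x. x \<in> \<Gamma> \<Longrightarrow> u x \<le> v x\<rbrakk> \<Longrightarrow> vertex_sum u \<le> vertex_sum v"
  unfolding vertex_sum_def by (rule infsum_mono) simp_all

lemma vertex_sum_nonneg: "(\<And>x. x \<in> \<Gamma> \<Longrightarrow> 0 \<le> u x) \<Longrightarrow> 0 \<le> vertex_sum u"
  unfolding vertex_sum_def by (rule infsum_nonneg)

lemma vertex_sum_cong: "(\<And>x. x \<in> \<Gamma> \<Longrightarrow> u x = v x) \<Longrightarrow> vertex_sum u = vertex_sum v"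
  unfolding vertex_sum_def by (rule infsum_cong)

lemma vertex_sum_indicator:
  assumes "y \<in> \<Gamma>" shows "vertex_sum (\<lambda>x. u x * indicator {y} x) = u y"
proof -
  have "vertex_sum (\<lambda>x. u x * indicator {y} x) = (\<Sum>\<^sub>\<infinity>x\<in>{y}. u x)"
    unfolding vertex_sum_def by (rule infsum_cong_neutral) (use assms in \<open>auto simp: indicator_def\<close>)
  then show ?thesis by simp
qed

section \<open>Markov operator, truncated Green function and Dirichlet form\<close>

definition markov :: "'a pmf \<Rightarrow> ('x \<Rightarrow> real) \<Rightarrow> 'x \<Rightarrow> real"
  where "markov \<mu> u x = (\<Sum>g\<in>set_pmf \<mu>. pmf \<mu> g * u (act x g))"

text \<open>The probability of being at \<open>y\<close> after \<open>n\<close> steps from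
  \<open>x\<close> (see \<open>measure_trajectory\<close>). The target comes first, so that partial
  application gives a function of the starting point, on which \<open>markov\<close> acts.\<close>

definition transition :: "'a pmf \<Rightarrow> nat \<Rightarrow> 'x \<Rightarrow> 'x \<Rightarrow> real"
  where "transition \<mu> n y = (markov \<mu> ^^ n) (indicator {y})"

definition green :: "'a pmf \<Rightarrow> nat \<Rightarrow> 'x \<Rightarrow> 'x \<Rightarrow> real"
  where "green \<mu> N y x = (\<Sum>n<N. transition \<mu> n y x)"

definition increment_energy :: "'a \<Rightarrow> ('x \<Rightarrow> real) \<Rightarrow> real"
  where "increment_energy g u = vertex_sum (\<lambda>x. (u (act x g) - u x)\<^sup>2)"

text \<open>Twice the usual Dirichlet form: the customary factor 1/2 is left out, which explains the
  factors 2 in the estimates below.\<close>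

definition energy :: "'a pmf \<Rightarrow> ('x \<Rightarrow> real) \<Rightarrow> real"
  where "energy \<mu> u = (\<Sum>g\<in>set_pmf \<mu>. pmf \<mu> g * increment_energy g u)"

lemma transition_Suc: "transition \<mu> (Suc n) y x = (\<Sum>g\<in>set_pmf \<mu>. pmf \<mu> g * transition \<mu> n y (act x g))"
  by (simp add: transition_def markov_def)

lemma transition_nonneg: "0 \<le> transition \<mu> n y x"
  by (induction n arbitrary: x) (auto simp: transition_Suc intro!: sum_nonneg, simp add: transition_def)

lemma green_Suc: "green \<mu> (Suc N) y x = green \<mu> N y x + transition \<mu> N y x"
  by (simp add: green_def)

lemma green_nonneg: "0 \<le> green \<mu> N y x"
  unfolding green_def by (intro sum_nonneg transition_nonneg)

lemma increment_energy_nonneg: "0 \<le> increment_energy g u"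
  unfolding increment_energy_def by (intro vertex_sum_nonneg) simp

lemma energy_nonneg: "0 \<le> energy \<mu> u"
  unfolding energy_def by (intro sum_nonneg mult_nonneg_nonneg increment_energy_nonneg) simp

context
  fixes \<mu> :: "'a pmf"
  assumes support: "set_pmf \<mu> \<subseteq> carrier G" and finite_support: "finite (set_pmf \<mu>)"
begin

lemma finsupp_markov [simp]: "finsupp u \<Longrightarrow> finsupp (markov \<mu> u)"
  unfolding markov_def[abs_def] using support by (intro finsupp_sum finsupp_cmult finsupp_act) auto

lemma finsupp_transition [simp]: "finsupp (transition \<mu> n y)"
  unfolding transition_def by (induction n) simp_all

lemma finsupp_green [simp]: "finsupp (green \<mu> N y)"
  unfolding green_def[abs_def] by simp

lemma sum_pmf_support: "(\<Sum>g\<in>set_pmf \<mu>. pmf \<mu> g) = 1"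
  by (rule sum_pmf_eq_1) (simp_all add: finite_support)

text \<open>No reversibility is needed: the counting measure on \<open>\<Gamma>\<close> is invariant under every \<open>g\<close>.\<close>

lemma energy_eq:
  assumes u: "finsupp u"
  shows "energy \<mu> u = 2 * vertex_sum (\<lambda>x. u x * (u x - markov \<mu> u x))"
proof -
  have inc: "increment_energy g u = 2 * vertex_sum (\<lambda>x. (u x)\<^sup>2) - 2 * vertex_sum (\<lambda>x. u x * u (act x g))"
    if "g \<in> set_pmf \<mu>" for g
  proof -
    have g: "g \<in> carrier G" using that support by blast
    have "increment_energy g u = vertex_sum (\<lambda>x. ((u (act x g))\<^sup>2 + (u x)\<^sup>2) - 2 * (u x * u (act x g)))"
      unfolding increment_energy_def by (rule vertex_sum_cong) (simp add: power2_eq_square algebra_simps)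
    also have "\<dots> = (vertex_sum (\<lambda>x. (u (act x g))\<^sup>2) + vertex_sum (\<lambda>x. (u x)\<^sup>2)) - 2 * vertex_sum (\<lambda>x. u x * u (act x g))"
      using u g by (simp add: vertex_sum_add vertex_sum_diff vertex_sum_cmult)
    also have "vertex_sum (\<lambda>x. (u (act x g))\<^sup>2) = vertex_sum (\<lambda>x. (u x)\<^sup>2)"
      by (rule vertex_sum_act[OF g])
    finally show ?thesis by simp
  qed
  have "energy \<mu> u = (\<Sum>g\<in>set_pmf \<mu>. pmf \<mu> g * (2 * vertex_sum (\<lambda>x. (u x)\<^sup>2) - 2 * vertex_sum (\<lambda>x. u x * u (act x g))))"
    unfolding energy_def by (rule sum.cong[OF refl]) (simp add: inc)
  also have "\<dots> = (\<Sum>g\<in>set_pmf \<mu>. pmf \<mu> g) * (2 * vertex_sum (\<lambda>x. (u x)\<^sup>2))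
      - 2 * (\<Sum>g\<in>set_pmf \<mu>. pmf \<mu> g * vertex_sum (\<lambda>x. u x * u (act x g)))"
    by (simp add: right_diff_distrib sum_subtractf sum_distrib_left sum_distrib_right mult_ac)
  also have "(\<Sum>g\<in>set_pmf \<mu>. pmf \<mu> g * vertex_sum (\<lambda>x. u x * u (act x g))) = vertex_sum (\<lambda>x. u x * markov \<mu> u x)"
    unfolding markov_def sum_distrib_left using u
    by (subst vertex_sum_sum) (auto simp: vertex_sum_cmult[symmetric] mult_ac intro: finsupp_subset[OF u])
  finally have "energy \<mu> u = 2 * (vertex_sum (\<lambda>x. (u x)\<^sup>2) - vertex_sum (\<lambda>x. u x * markov \<mu> u x))"
    by (simp add: sum_pmf_support)
  also have "vertex_sum (\<lambda>x. (u x)\<^sup>2) - vertex_sum (\<lambda>x. u x * markov \<mu> u x) = vertex_sum (\<lambda>x. (u x)\<^sup>2 - u x * markov \<mu> u x)"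
    using u by (simp add: vertex_sum_diff)
  finally show ?thesis by (simp add: power2_eq_square right_diff_distrib)
qed

text \<open>The Markov operator shifts the summation index by one, so the difference telescopes to
  the first term minus the first omitted one.\<close>

lemma green_equation: "green \<mu> N y x - markov \<mu> (green \<mu> N y) x = indicator {y} x - transition \<mu> N y x"
proof (induction N)
  case 0 then show ?case by (simp add: green_def markov_def transition_def)
next
  case (Suc N)
  have "markov \<mu> (green \<mu> (Suc N) y) x = markov \<mu> (green \<mu> N y) x + transition \<mu> (Suc N) y x"
    by (simp add: markov_def green_Suc transition_Suc distrib_left sum.distrib)
  then show ?case using Suc green_Suc[of \<mu> N y x] by simp
qed

text \<open>In the pairing given by \<open>energy_eq\<close> and \<open>green_equation\<close>, the
  truncation term has a favourable sign and is dropped; the indicator evaluates the Green function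
  at its pole.\<close>

lemma energy_green_le:
  assumes "y \<in> \<Gamma>" shows "energy \<mu> (green \<mu> N y) \<le> 2 * green \<mu> N y y"
proof -
  have "vertex_sum (\<lambda>x. green \<mu> N y x * (green \<mu> N y x - markov \<mu> (green \<mu> N y) x))
    \<le> vertex_sum (\<lambda>x. green \<mu> N y x * indicator {y} x)"
    by (intro vertex_sum_mono finsupp_mult finsupp_green mult_left_mono green_nonneg)
      (simp add: green_equation transition_nonneg)
  then show ?thesis by (simp add: energy_eq vertex_sum_indicator[OF assms])
qed

lemma semigroup_generated_closed: "g \<in> semigroup_generated G (set_pmf \<mu>) \<Longrightarrow> g \<in> carrier G"
  by (induction rule: semigroup_generated.induct) (use support in auto)

text \<open>A step in the support contributes one non-negative summand of the energy, whence the
  constant \<open>1 / pmf \<mu> g\<close>. For a product, the increment from x to x.gh is split at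
  x.g; the part from x.g to x.gh is the increment for \<open>h\<close> translated by
  \<open>g\<close>, which leaves its vertex sum unchanged.\<close>

lemma increment_energy_le:
  assumes "g \<in> semigroup_generated G (set_pmf \<mu>)"
  shows "\<exists>c\<ge>0. \<forall>u. finsupp u \<longrightarrow> increment_energy g u \<le> c * energy \<mu> u"
  using assms
proof induction
  case (incl g)
  have pos: "0 < pmf \<mu> g" using incl by (simp add: pmf_positive)
  have "increment_energy g u \<le> 1 / pmf \<mu> g * energy \<mu> u" for u
  proof -
    have "pmf \<mu> g * increment_energy g u \<le> energy \<mu> u"
      unfolding energy_def
      by (rule member_le_sum) (use incl finite_support increment_energy_nonneg in auto)
    then show ?thesis using pos by (simp add: field_simps)
  qed
  then show ?case using pos by (intro exI[of _ "1 / pmf \<mu> g"]) simp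
next
  case (mult g h)
  then obtain c d where c: "c \<ge> 0" "\<And>u. finsupp u \<Longrightarrow> increment_energy g u \<le> c * energy \<mu> u"
    and d: "d \<ge> 0" "\<And>u. finsupp u \<Longrightarrow> increment_energy h u \<le> d * energy \<mu> u" by blast
  note gh = mult.hyps[THEN semigroup_generated_closed]
  have "increment_energy (g \<otimes> h) u \<le> (2 * c + 2 * d) * energy \<mu> u" if u: "finsupp u" for u
  proof -
    define w where "w x = (u (act x h) - u x)\<^sup>2" for x
    have w: "finsupp w" unfolding w_def[abs_def] using u gh by simp
    \<comment> \<open>The right-hand side minus the left-hand side is the square of
      \<open>a - 2 * b + c\<close>.\<close>
    have sq: "(a - c)\<^sup>2 \<le> 2 * (a - b)\<^sup>2 + 2 * (b - c)\<^sup>2" for a b c :: real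
      using sum_squares_ge_zero[of "a - 2 * b + c" 0] by (simp add: power2_eq_square algebra_simps)
    have "increment_energy (g \<otimes> h) u \<le> vertex_sum (\<lambda>x. 2 * w (act x g) + 2 * (u (act x g) - u x)\<^sup>2)"
      unfolding increment_energy_def
    proof (rule vertex_sum_mono)
      fix x assume "x \<in> \<Gamma>"
      then show "(u (act x (g \<otimes> h)) - u x)\<^sup>2 \<le> 2 * w (act x g) + 2 * (u (act x g) - u x)\<^sup>2"
        using sq[of "u (act x (g \<otimes> h))" "u x" "u (act x g)"] gh by (simp add: w_def act_mult)
    qed (use u w gh in simp_all)
    also have "\<dots> = 2 * increment_energy h u + 2 * increment_energy g u"
      using u w gh vertex_sum_act[of g w] finsupp_act[of g w]
      by (subst vertex_sum_add) (simp_all add: vertex_sum_cmult increment_energy_def w_def[symmetric])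
    also have "\<dots> \<le> 2 * (d * energy \<mu> u) + 2 * (c * energy \<mu> u)" using c d u by (intro add_mono mult_left_mono) auto
    finally show ?thesis by (simp add: algebra_simps)
  qed
  then show ?case using c d by (intro exI[of _ "2 * c + 2 * d"]) simp
qed

text \<open>Stated for all non-negative \<open>u\<close>, not just for indicators, so that the
  induction can feed an iterate of \<open>markov \<mu>\<close> into the bound for the first factor.
  It serves to compare Green functions with different starting points.\<close>

lemma transition_lower_bound:
  assumes "g \<in> semigroup_generated G (set_pmf \<mu>)"
  shows "\<exists>m. \<exists>c>0. \<forall>u. (\<forall>x\<in>\<Gamma>. 0 \<le> u x) \<longrightarrow> (\<forall>x\<in>\<Gamma>. c * u (act x g) \<le> (markov \<mu> ^^ m) u x)"
  using assms
proof induction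
  case (incl g)
  have "pmf \<mu> g * u (act x g) \<le> markov \<mu> u x" if "\<forall>x\<in>\<Gamma>. 0 \<le> u x" "x \<in> \<Gamma>" for u x
    unfolding markov_def
    by (rule member_le_sum) (use incl finite_support that support act_closed in auto)
  then show ?case using incl by (intro exI[of _ 1] exI[of _ "pmf \<mu> g"]) (simp add: pmf_positive)
next
  case (mult g h)
  obtain m c where c: "c > 0"
      "\<forall>u. (\<forall>x\<in>\<Gamma>. 0 \<le> u x) \<longrightarrow> (\<forall>x\<in>\<Gamma>. c * u (act x g) \<le> (markov \<mu> ^^ m) u x)"
    using mult.IH(1) by auto
  obtain n d where d: "d > 0"
      "\<forall>u. (\<forall>x\<in>\<Gamma>. 0 \<le> u x) \<longrightarrow> (\<forall>x\<in>\<Gamma>. d * u (act x h) \<le> (markov \<mu> ^^ n) u x)"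
    using mult.IH(2) by auto
  note gh = mult.hyps[THEN semigroup_generated_closed]
  have "c * d * u (act x (g \<otimes> h)) \<le> (markov \<mu> ^^ (m + n)) u x" if u: "\<forall>x\<in>\<Gamma>. 0 \<le> u x" and x: "x \<in> \<Gamma>" for u x
  proof -
    have nonneg: "\<forall>x\<in>\<Gamma>. 0 \<le> (markov \<mu> ^^ n) u x"
    proof
      fix z assume z: "z \<in> \<Gamma>"
      have "0 \<le> d * u (act z h)" using d(1) u z gh act_closed by simp
      also have "\<dots> \<le> (markov \<mu> ^^ n) u z" using d(2) u z by simp
      finally show "0 \<le> (markov \<mu> ^^ n) u z" .
    qed
    have "c * (d * u (act (act x g) h)) \<le> c * (markov \<mu> ^^ n) u (act x g)"
      using c(1) d(2) u gh x act_closed by simp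
    also have "\<dots> \<le> (markov \<mu> ^^ m) ((markov \<mu> ^^ n) u) x" using c(2) nonneg x by simp
    finally show ?thesis using x gh by (simp add: act_mult funpow_add mult.assoc)
  qed
  then show ?case using c(1) d(1) by (intro exI[of _ "m + n"] exI[of _ "c * d"]) simp
qed

end

section \<open>The simple random walk and the comparison of Green functions\<close>

abbreviation "simple \<equiv> pmf_of_set K"

lemma set_simple: "set_pmf simple = K"
  using K_finite K_nonempty by simp

lemma simple_support: "set_pmf simple \<subseteq> carrier G" "finite (set_pmf simple)"
  using K_carrier K_finite by (simp_all add: set_simple)

lemma markov_simple: "markov simple u x = (\<Sum>k\<in>K. u (act x k)) / card K"
  unfolding markov_def set_simple using K_finite K_nonempty by (simp add: sum_divide_distrib)

text \<open>Translating the vertices by \<open>k\<close> moves the step from \<open>v\<close> to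
  \<open>u\<close> as its inverse, and inversion permutes \<open>K\<close>.\<close>

lemma markov_simple_symmetric:
  assumes u: "finsupp u" and v: "finsupp v"
  shows "vertex_sum (\<lambda>x. u x * markov simple v x) = vertex_sum (\<lambda>x. markov simple u x * v x)"
proof -
  have act: "vertex_sum (\<lambda>x. u x * v (act x k)) = vertex_sum (\<lambda>x. u (act x (inv k)) * v x)" if "k \<in> K" for k
  proof -
    have k: "k \<in> carrier G" using that K_carrier by blast
    have "vertex_sum (\<lambda>x. u (act x (inv k)) * v x) = vertex_sum (\<lambda>x. u (act (act x k) (inv k)) * v (act x k))"
      by (rule vertex_sum_act[OF k, symmetric])
    also have "\<dots> = vertex_sum (\<lambda>x. u x * v (act x k))"
      by (rule vertex_sum_cong) (simp add: act_inv k)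
    finally show ?thesis by simp
  qed
  have inv: "bij_betw (\<lambda>k. inv k) K K"
    by (rule bij_betw_byWitness[where f'="\<lambda>k. inv k"]) (use K_symmetric K_carrier in auto)
  have eq: "vertex_sum (\<lambda>x. (\<Sum>k\<in>K. f k x) / card K) = (\<Sum>k\<in>K. vertex_sum (f k)) / card K"
    if "\<And>k. k \<in> K \<Longrightarrow> finsupp (f k)" for f
    using vertex_sum_cmult[of "1 / card K" "\<lambda>x. \<Sum>k\<in>K. f k x"] vertex_sum_sum[of K f] that by simp
  have "vertex_sum (\<lambda>x. u x * markov simple v x) = (\<Sum>k\<in>K. vertex_sum (\<lambda>x. u x * v (act x k))) / card K"
    unfolding markov_simple by (subst eq[symmetric]) (use u in \<open>simp_all add: sum_distrib_left\<close>)
  also have "\<dots> = (\<Sum>k\<in>K. vertex_sum (\<lambda>x. u (act x (inv k)) * v x)) / card K" using act by simp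
  also have "\<dots> = (\<Sum>k\<in>K. vertex_sum (\<lambda>x. u (act x k) * v x)) / card K"
    using sum.reindex_bij_betw[OF inv, of "\<lambda>k. vertex_sum (\<lambda>x. u (act x k) * v x)"] by simp
  also have "\<dots> = vertex_sum (\<lambda>x. markov simple u x * v x)"
    unfolding markov_simple
    by (subst eq[symmetric]) (use u K_carrier in \<open>auto simp: sum_distrib_right subset_eq\<close>)
  finally show ?thesis .
qed

text \<open>Expand \<open>0 \<le> energy (u - t v)\<close> for the truncated Green function \<open>v\<close> with pole \<open>y\<close>: pairing
  \<open>u\<close> with \<open>v\<close> reproduces \<open>u y\<close> up to an error that vanishes because the chain is transient, and
  \<open>t = u y / c\<close> is optimal.\<close>

lemma capacity_bound:
  assumes y: "y \<in> \<Gamma>" and u: "finsupp u" and c: "c > 0"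
    and bound: "\<And>x N. x \<in> \<Gamma> \<Longrightarrow> green simple N y x \<le> c"
  shows "(u y)\<^sup>2 \<le> c * energy simple u / 2"
proof -
  define t where "t = u y / c"
  define v where "v N = green simple N y" for N
  define r where "r N = vertex_sum (\<lambda>x. u x * transition simple N y x)" for N
  note S = simple_support
  have v: "finsupp (v N)" for N unfolding v_def using S by simp
  have "2 * t * (u y - r N) \<le> energy simple u / 2 + t\<^sup>2 * c" for N
  proof -
    let ?L = "\<lambda>u x. u x - markov simple u x"
    have L: "finsupp (?L w)" if "finsupp w" for w using that S by simp
    have "0 \<le> energy simple (\<lambda>x. u x - t * v N x)" by (rule energy_nonneg)
    also have "\<dots> = 2 * vertex_sum (\<lambda>x. (u x - t * v N x) * (?L u x - t * ?L (v N) x))"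
      unfolding energy_eq[OF S finsupp_diff[OF u finsupp_cmult[OF v]]]
      by (simp add: markov_simple sum_subtractf diff_divide_distrib algebra_simps flip: sum_distrib_left)
    also have "vertex_sum (\<lambda>x. (u x - t * v N x) * (?L u x - t * ?L (v N) x))
      = vertex_sum (\<lambda>x. ((u x * ?L u x - t * (u x * ?L (v N) x)) - t * (v N x * ?L u x)) + t\<^sup>2 * (v N x * ?L (v N) x))"
      by (rule vertex_sum_cong) (simp add: power2_eq_square algebra_simps)
    also have "\<dots> = vertex_sum (\<lambda>x. u x * ?L u x) - t * vertex_sum (\<lambda>x. u x * ?L (v N) x)
        - t * vertex_sum (\<lambda>x. v N x * ?L u x) + t\<^sup>2 * vertex_sum (\<lambda>x. v N x * ?L (v N) x)"
      using u v L by (subst vertex_sum_add | subst vertex_sum_diff | simp add: vertex_sum_cmult)+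
    also have "vertex_sum (\<lambda>x. v N x * ?L u x) = vertex_sum (\<lambda>x. u x * ?L (v N) x)"
      using markov_simple_symmetric[OF u v[of N]] u v[of N] S
      by (simp add: right_diff_distrib vertex_sum_diff mult.commute)
    also have "vertex_sum (\<lambda>x. u x * ?L (v N) x) = u y - r N"
    proof -
      have "vertex_sum (\<lambda>x. u x * ?L (v N) x) = vertex_sum (\<lambda>x. u x * indicator {y} x - u x * transition simple N y x)"
        unfolding v_def green_equation[OF S] by (simp add: right_diff_distrib)
      also have "\<dots> = u y - r N"
        using u by (subst vertex_sum_diff) (simp_all add: vertex_sum_indicator[OF y] r_def)
      finally show ?thesis .
    qed
    also have "vertex_sum (\<lambda>x. v N x * ?L (v N) x) = energy simple (v N) / 2"
      using energy_eq[OF S v] by simp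
    finally have "2 * t * (u y - r N) \<le> vertex_sum (\<lambda>x. u x * ?L u x) + t\<^sup>2 * (energy simple (v N) / 2)" by simp
    moreover have "energy simple (v N) / 2 \<le> c"
      using energy_green_le[OF S y, of N] bound[OF y, of N] by (simp add: v_def)
    ultimately show ?thesis
      using energy_eq[OF S u] mult_left_mono[of "energy simple (v N) / 2" c "t\<^sup>2"] by simp
  qed
  moreover have "r \<longlonglongrightarrow> 0"
  proof -
    let ?F = "{x \<in> \<Gamma>. u x \<noteq> 0}"
    have r: "r N = (\<Sum>x\<in>?F. u x * transition simple N y x)" for N
    proof -
      have "r N = (\<Sum>\<^sub>\<infinity>x\<in>?F. u x * transition simple N y x)"
        unfolding r_def vertex_sum_def by (rule infsum_cong_neutral) auto
      then show ?thesis using u by (simp add: finsupp_def)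
    qed
    have "(\<lambda>N. transition simple N y x) \<longlonglongrightarrow> 0" if "x \<in> \<Gamma>" for x
    proof (rule summable_LIMSEQ_zero)
      show "summable (\<lambda>N. transition simple N y x)"
        by (rule summableI_nonneg_bounded[where x=c])
          (use bound[OF that] in \<open>simp_all add: transition_nonneg green_def\<close>)
    qed
    then have "(\<lambda>N. \<Sum>x\<in>?F. u x * transition simple N y x) \<longlonglongrightarrow> (\<Sum>x\<in>?F. u x * 0)"
      by (intro tendsto_sum tendsto_mult tendsto_const) simp
    then show ?thesis unfolding ext[of r, OF r] by simp
  qed
  ultimately have "2 * t * (u y - 0) \<le> energy simple u / 2 + t\<^sup>2 * c"
    by (intro tendsto_upperbound[OF tendsto_mult[OF tendsto_const tendsto_diff[OF tendsto_const]]]) auto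
  then show ?thesis using c by (simp add: t_def power2_eq_square field_simps)
qed

text \<open>For the truncated Green function w of \<open>\<mu>\<close>, the chain w(y)^2 <= c
  E_simple(w) / 2 <= c C E_mu(w) / 2 <= c C w(y) improves itself: cancelling w(y) gives a bound that
  does not depend on \<open>N\<close>. The constant \<open>C\<close> averages the comparison
  constants of the generators.\<close>

lemma green_bounded:
  assumes support: "set_pmf \<mu> \<subseteq> carrier G" "finite (set_pmf \<mu>)"
    and nondegenerate: "semigroup_generated G (set_pmf \<mu>) = carrier G"
    and simple: "\<And>y. y \<in> \<Gamma> \<Longrightarrow> \<exists>c>0. \<forall>x\<in>\<Gamma>. \<forall>N. green simple N y x \<le> c"
    and y: "y \<in> \<Gamma>" and x: "x \<in> \<Gamma>"
  shows "\<exists>c. \<forall>N. green \<mu> N y x \<le> c"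
proof -
  obtain c where c: "c > 0" "\<And>x N. x \<in> \<Gamma> \<Longrightarrow> green simple N y x \<le> c" using simple[OF y] by blast
  have "\<forall>k\<in>K. \<exists>d\<ge>0. \<forall>u. finsupp u \<longrightarrow> increment_energy k u \<le> d * energy \<mu> u"
    using increment_energy_le[OF support] nondegenerate K_carrier by blast
  then obtain d where d: "\<And>k. k \<in> K \<Longrightarrow> 0 \<le> d k"
    "\<And>k u. \<lbrakk>k \<in> K; finsupp u\<rbrakk> \<Longrightarrow> increment_energy k u \<le> d k * energy \<mu> u"
    by metis
  define C where "C = (\<Sum>k\<in>K. d k / card K)"
  have compare: "energy simple u \<le> C * energy \<mu> u" if "finsupp u" for u
  proof -
    have "energy simple u = (\<Sum>k\<in>K. increment_energy k u / card K)"
      unfolding energy_def set_simple using K_finite K_nonempty by simp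
    also have "\<dots> \<le> (\<Sum>k\<in>K. d k * energy \<mu> u / card K)"
      by (intro sum_mono divide_right_mono d that) simp_all
    also have "\<dots> = C * energy \<mu> u" unfolding C_def sum_distrib_right by (rule sum.cong) simp_all
    finally show ?thesis .
  qed
  have C: "0 \<le> C" unfolding C_def using d(1) by (intro sum_nonneg) simp
  have diag: "green \<mu> N y y \<le> c * C" for N
  proof (rule ccontr)
    assume *: "\<not> green \<mu> N y y \<le> c * C"
    let ?w = "green \<mu> N y"
    have pos: "?w y > 0" using * C c by (smt (verit) mult_nonneg_nonneg)
    have "(?w y)\<^sup>2 \<le> c * energy simple ?w / 2"
      by (rule capacity_bound[OF y _ c]) (use support in simp)
    also have "\<dots> \<le> c * (C * energy \<mu> ?w) / 2"
      using compare[of ?w] c support by simp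
    also have "\<dots> \<le> c * (C * (2 * ?w y)) / 2"
      using energy_green_le[OF support y, of N] c C by (intro divide_right_mono mult_left_mono) auto
    finally have "?w y * ?w y \<le> (c * C) * ?w y" by (simp add: power2_eq_square mult_ac)
    then show False using * pos by simp
  qed
  \<comment> \<open>To leave the diagonal, write x = y.g. A path from y to x of weight at least
    \<open>b\<close> and length \<open>m\<close> shows that \<open>b\<close> times the probability
    of going from x to y in n steps is at most the probability of returning to y in m + n
    steps.\<close>
  obtain g where g: "g \<in> carrier G" "act y g = x" using act_transitive[OF y x] by blast
  obtain m b where b: "b > 0" "\<And>u z. \<lbrakk>\<forall>x\<in>\<Gamma>. 0 \<le> u x; z \<in> \<Gamma>\<rbrakk> \<Longrightarrow> b * u (act z g) \<le> (markov \<mu> ^^ m) u z"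
    using transition_lower_bound[OF support, of g] g nondegenerate by blast
  have "green \<mu> N y x \<le> c * C / b" for N
  proof -
    have "b * green \<mu> N y x \<le> (\<Sum>n<N. transition \<mu> (m + n) y y)"
    proof -
      have "b * green \<mu> N y x = (\<Sum>n<N. b * transition \<mu> n y (act y g))"
        by (simp add: green_def g sum_distrib_left)
      also have "\<dots> \<le> (\<Sum>n<N. transition \<mu> (m + n) y y)"
        using b(2)[OF _ y, of "transition \<mu> _ y"]
        by (intro sum_mono) (simp add: transition_nonneg, simp add: transition_def funpow_add)
      finally show ?thesis .
    qed
    also have "\<dots> = (\<Sum>n\<in>{m..<m + N}. transition \<mu> n y y)"
      by (rule sum.reindex_bij_witness[of _ "\<lambda>n. n - m" "\<lambda>n. m + n"]) auto
    also have "\<dots> \<le> green \<mu> (m + N) y y"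
      unfolding green_def by (rule sum_mono2) (auto simp: transition_nonneg)
    also have "\<dots> \<le> c * C" by (rule diag)
    finally show ?thesis using b(1) by (simp add: field_simps)
  qed
  then show ?thesis by blast
qed

end

section \<open>Transience of the induced random walk\<close>

text \<open>Instantiated with the step law of the theorem and, in
  \<open>AE_converges_to_end\<close>, also with the uniform law on \<open>K\<close>, so that the
  first-step arguments serve both walks.\<close>

locale schreier_walk = schreier_data G \<Gamma> act K
  for G (structure) and \<Gamma> :: "'x set" and act :: "'x \<Rightarrow> 'a \<Rightarrow> 'x" and K +
  fixes \<mu> :: "'a pmf"
  assumes support: "set_pmf \<mu> \<subseteq> carrier G" and finite_support: "finite (set_pmf \<mu>)"
begin

sublocale W: countable_group_walk G \<mu>
  by unfold_locales (rule countable_carrier, rule support)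

sublocale S: prob_space "increments G \<mu>"
  by (rule W.prob_space_increments)

abbreviation "walk \<equiv> trajectory (mult G) \<one>"

lemma space_increments: "space (increments G \<mu>) = Pi UNIV (\<lambda>_. carrier G)"
  by (simp add: increments_def space_PiM space_restrict_space PiE_def)

lemma walk_measurable: "walk \<in> measurable (increments G \<mu>) (path_space (carrier G))"
  using measurable_compose[OF measurable_Pair1'[of \<one> "count_space (carrier G)"] W.measurable_trajectory_pair]
  by simp

lemma walk_closed: "h \<in> space (increments G \<mu>) \<Longrightarrow> walk h n \<in> carrier G"
  using measurable_space[OF walk_measurable] by (auto simp: space_path_space)

text \<open>Links the two descriptions of the induced walk: the recursive one suits first-step
  arguments, the image of the group walk couples all starting points in one field.\<close>

lemma trajectory_act:
  assumes "h \<in> space (increments G \<mu>)" "x \<in> \<Gamma>"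
  shows "trajectory act x h n = act x (walk h n)"
proof (induction n)
  case (Suc n)
  have "h n \<in> carrier G" using assms by (auto simp: space_increments)
  then show ?case using Suc assms walk_closed by (simp add: act_mult)
qed (simp add: act_one assms)

lemma trajectory_measurable:
  assumes "x \<in> \<Gamma>"
  shows "trajectory act x \<in> measurable (increments G \<mu>) (path_space \<Gamma>)"
proof -
  have "(\<lambda>h. act x (walk h n)) \<in> measurable (increments G \<mu>) (count_space \<Gamma>)" for n
    by (rule measurable_compose[OF measurable_compose[OF walk_measurable component_measurable]])
      (use assms act_closed in auto)
  then have "(\<lambda>h n. act x (walk h n)) \<in> measurable (increments G \<mu>) (path_space \<Gamma>)"
    unfolding path_space_def
    by (intro measurable_PiM_single') (use assms act_closed walk_closed in auto)
  then show ?thesis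
    by (rule measurable_cong[THEN iffD1, rotated]) (simp add: trajectory_act assms fun_eq_iff)
qed

lemma trajectory_event:
  assumes "x \<in> \<Gamma>" shows "{h \<in> space (increments G \<mu>). trajectory act x h n = y} \<in> sets (increments G \<mu>)"
proof -
  have m: "(\<lambda>h. trajectory act x h n) \<in> measurable (increments G \<mu>) (count_space \<Gamma>)"
    by (rule measurable_compose[OF trajectory_measurable[OF assms] component_measurable])
  have "{h \<in> space (increments G \<mu>). trajectory act x h n = y}
    = (\<lambda>h. trajectory act x h n) -` ({y} \<inter> \<Gamma>) \<inter> space (increments G \<mu>)"
    using measurable_space[OF m] by auto
  then show ?thesis using measurable_sets[OF m, of "{y} \<inter> \<Gamma>"] by (simp only:) auto
qed

section \<open>Splitting off the first increment\<close>

lemma trajectory_case_nat: "trajectory f x (case_nat g h) (Suc n) = trajectory f (f x g) h n"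
  by (induction n) simp_all

lemma case_nat_increments:
  "\<lbrakk>g \<in> carrier G; h \<in> space (increments G \<mu>)\<rbrakk> \<Longrightarrow> case_nat g h \<in> space (increments G \<mu>)"
  by (auto simp: space_increments Pi_iff split: nat.split)

text \<open>The Markov property on the level of increments: prepending an independent step to an
  i.i.d. sequence reproduces its law. Finite support turns the integral over the first step into a
  finite sum.\<close>

lemma one_step:
  assumes A: "A \<in> sets (increments G \<mu>)"
  shows "g \<in> carrier G \<Longrightarrow> {h \<in> space (increments G \<mu>). case_nat g h \<in> A} \<in> sets (increments G \<mu>)"
    and "measure (increments G \<mu>) A =
      (\<Sum>g\<in>set_pmf \<mu>. pmf \<mu> g * measure (increments G \<mu>) {h \<in> space (increments G \<mu>). case_nat g h \<in> A})"
proof -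
  let ?S = "increments G \<mu>"
  interpret prob_space W.step by (rule W.prob_space_step)
  interpret Seq: sequence_space W.step by unfold_locales
  let ?f = "\<lambda>(s, \<omega>). case_nat s \<omega>"
  have f: "?f \<in> measurable (W.step \<Otimes>\<^sub>M ?S) ?S"
    unfolding increments_def by measurable
  let ?A = "?f -` A \<inter> space (W.step \<Otimes>\<^sub>M ?S)"
  have sec: "Pair g -` ?A = {h \<in> space ?S. case_nat g h \<in> A}" if "g \<in> carrier G" for g
    using that by (auto simp: space_pair_measure space_restrict_space)
  show sets: "{h \<in> space ?S. case_nat g h \<in> A} \<in> sets ?S" if "g \<in> carrier G" for g
    unfolding sec[OF that, symmetric] by (rule sets_Pair1[OF measurable_sets[OF f A]])
  have "emeasure ?S A = emeasure (distr (W.step \<Otimes>\<^sub>M ?S) ?S ?f) A"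
    using Seq.PiM_iter by (simp add: increments_def)
  also have "\<dots> = (\<integral>\<^sup>+ g. emeasure ?S (Pair g -` ?A) \<partial>W.step)"
    by (subst emeasure_distr[OF f A]) (rule S.emeasure_pair_measure_alt[OF measurable_sets[OF f A]])
  also have "\<dots> = (\<integral>\<^sup>+ g. emeasure ?S (Pair g -` ?A) * indicator (carrier G) g \<partial>measure_pmf \<mu>)"
    by (rule nn_integral_restrict_space) simp
  also have "\<dots> = (\<Sum>g\<in>set_pmf \<mu>. emeasure ?S (Pair g -` ?A) * indicator (carrier G) g * ennreal (pmf \<mu> g))"
    by (rule nn_integral_measure_pmf_finite[OF finite_support]) simp
  also have "\<dots> = (\<Sum>g\<in>set_pmf \<mu>. ennreal (pmf \<mu> g * measure ?S {h \<in> space ?S. case_nat g h \<in> A}))"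
  proof (rule sum.cong[OF refl])
    fix g assume "g \<in> set_pmf \<mu>"
    then have g: "g \<in> carrier G" using support by blast
    then show "emeasure ?S (Pair g -` ?A) * indicator (carrier G) g * ennreal (pmf \<mu> g)
      = ennreal (pmf \<mu> g * measure ?S {h \<in> space ?S. case_nat g h \<in> A})"
      unfolding sec[OF g] by (simp add: S.emeasure_eq_measure ennreal_mult mult.commute)
  qed
  also have "\<dots> = ennreal (\<Sum>g\<in>set_pmf \<mu>. pmf \<mu> g * measure ?S {h \<in> space ?S. case_nat g h \<in> A})"
    by (rule sum_ennreal) simp
  finally show "measure ?S A = (\<Sum>g\<in>set_pmf \<mu>. pmf \<mu> g * measure ?S {h \<in> space ?S. case_nat g h \<in> A})"
    unfolding S.emeasure_eq_measure by (subst (asm) ennreal_inj) (auto intro!: sum_nonneg)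
qed

text \<open>The failure event has probability zero and is a sum of non-negative terms over the first
  increments; each term with positive weight must vanish.\<close>

lemma AE_one_step:
  assumes A: "{h \<in> space (increments G \<mu>). \<not> Q h} \<in> sets (increments G \<mu>)"
    and AE: "AE h in increments G \<mu>. Q h" and g: "g \<in> set_pmf \<mu>"
  shows "AE h in increments G \<mu>. Q (case_nat g h)"
proof -
  let ?S = "increments G \<mu>" and ?A = "{h \<in> space (increments G \<mu>). \<not> Q h}"
  have gG: "g \<in> carrier G" using g support by blast
  have "measure ?S ?A = 0"
    using AE AE_iff_measurable[OF A refl] by (simp add: S.emeasure_eq_measure)
  then have "pmf \<mu> g * measure ?S {h \<in> space ?S. case_nat g h \<in> ?A} = 0"
    using g finite_support unfolding one_step(2)[OF A] by (subst (asm) sum_nonneg_eq_0_iff) auto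
  then have "measure ?S {h \<in> space ?S. case_nat g h \<in> ?A} = 0"
    using g by (simp add: set_pmf_iff)
  moreover have "{h \<in> space ?S. \<not> Q (case_nat g h)} = {h \<in> space ?S. case_nat g h \<in> ?A}"
    using case_nat_increments[OF gG] by auto
  ultimately show ?thesis
    using AE_iff_measurable[OF one_step(1)[OF A gG]] by (simp add: S.emeasure_eq_measure)
qed

lemma measure_trajectory:
  assumes "x \<in> \<Gamma>"
  shows "measure (increments G \<mu>) {h \<in> space (increments G \<mu>). trajectory act x h n = y} = transition \<mu> n y x"
  using assms
proof (induction n arbitrary: x)
  case 0
  show ?case by (cases "x = y") (simp_all add: transition_def S.prob_space)
next
  case (Suc n)
  show ?case
    unfolding one_step(2)[OF trajectory_event[OF Suc.prems]] transition_Suc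
  proof (rule sum.cong[OF refl])
    fix g assume "g \<in> set_pmf \<mu>"
    then have g: "g \<in> carrier G" using support by blast
    have "{h \<in> space (increments G \<mu>). case_nat g h \<in> {h \<in> space (increments G \<mu>). trajectory act x h (Suc n) = y}}
      = {h \<in> space (increments G \<mu>). trajectory act (act x g) h n = y}"
      using case_nat_increments[OF g] trajectory_case_nat[of act x g] by (auto simp del: trajectory.simps)
    then show "pmf \<mu> g * measure (increments G \<mu>) {h \<in> space (increments G \<mu>). case_nat g h \<in>
        {h \<in> space (increments G \<mu>). trajectory act x h (Suc n) = y}} = pmf \<mu> g * transition \<mu> n y (act x g)"
      using Suc.IH[OF act_closed[OF Suc.prems g]] by simp
  qed
qed

section \<open>Last visits and the equivalence of transience with bounded Green functions\<close>

definition last_visit :: "'x \<Rightarrow> nat \<Rightarrow> 'x \<Rightarrow> (nat \<Rightarrow> 'a) set"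
  where "last_visit y n x = {h \<in> space (increments G \<mu>). trajectory act x h n = y \<and>
    (\<forall>m. trajectory act x h (Suc (n + m)) \<noteq> y)}"

lemma last_visit_event:
  assumes "x \<in> \<Gamma>" shows "last_visit y n x \<in> sets (increments G \<mu>)"
  unfolding last_visit_def
  by (intro sets.sets_Collect_conj sets.sets_Collect_countable_All sets.sets_Collect_neg trajectory_event assms)

text \<open>The events of last visiting \<open>y\<close> at time \<open>n\<close> are disjoint, so this factorization bounds the Green
  function by the inverse of the probability of never returning.\<close>

lemma measure_last_visit:
  assumes "x \<in> \<Gamma>"
  shows "measure (increments G \<mu>) (last_visit y n x) = transition \<mu> n y x * measure (increments G \<mu>) (last_visit y 0 y)"
  using assms
proof (induction n arbitrary: x)
  case 0
  show ?case
  proof (cases "x = y")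
    case False
    then have "last_visit y 0 x = {}" by (simp add: last_visit_def)
    then show ?thesis using False by (simp add: transition_def)
  qed (simp add: transition_def)
next
  case (Suc n)
  have "measure (increments G \<mu>) (last_visit y (Suc n) x) = (\<Sum>g\<in>set_pmf \<mu>. pmf \<mu> g *
      (transition \<mu> n y (act x g) * measure (increments G \<mu>) (last_visit y 0 y)))"
    unfolding one_step(2)[OF last_visit_event[OF Suc.prems]]
  proof (rule sum.cong[OF refl])
    fix g assume "g \<in> set_pmf \<mu>"
    then have g: "g \<in> carrier G" using support by blast
    have "{h \<in> space (increments G \<mu>). case_nat g h \<in> last_visit y (Suc n) x} = last_visit y n (act x g)"
      unfolding last_visit_def using case_nat_increments[OF g] trajectory_case_nat[of act x g]
      by (auto simp del: trajectory.simps)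
    then show "pmf \<mu> g * measure (increments G \<mu>) {h \<in> space (increments G \<mu>). case_nat g h \<in> last_visit y (Suc n) x}
      = pmf \<mu> g * (transition \<mu> n y (act x g) * measure (increments G \<mu>) (last_visit y 0 y))"
      using Suc.IH[OF act_closed[OF Suc.prems g]] by simp
  qed
  then show ?case by (simp add: transition_Suc sum_distrib_right mult.assoc)
qed

text \<open>\<open>e\<close> is the probability of never returning to \<open>y\<close>. The bound
  \<open>1 / e\<close> is the same for every start: \<open>capacity_bound\<close> uses it at
  \<open>y\<close> for the energy and at other vertices to let transition probabilities
  vanish.\<close>

lemma green_bounded_if_transient:
  assumes y: "y \<in> \<Gamma>" and transient: "AE h in increments G \<mu>. \<forall>\<^sub>F n in sequentially. trajectory act y h n \<noteq> y"
  shows "\<exists>c>0. \<forall>x\<in>\<Gamma>. \<forall>N. green \<mu> N y x \<le> c"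
proof -
  let ?S = "increments G \<mu>"
  define e where "e = measure ?S (last_visit y 0 y)"
  \<comment> \<open>If \<open>e\<close> were zero, the factorization would make every last-visit
    event null, yet a transient path from \<open>y\<close> has a last visit to
    \<open>y\<close>.\<close>
  have "e \<noteq> 0"
  proof
    assume e: "e = 0"
    have "AE h in ?S. h \<notin> last_visit y n y" for n
      using measure_last_visit[OF y, of y n] e
      by (intro AE_not_in null_setsI last_visit_event y) (simp add: S.emeasure_eq_measure e_def)
    then have "AE h in ?S. \<forall>n. h \<notin> last_visit y n y" by (simp add: AE_all_countable)
    then have "AE h in ?S. False"
      using transient AE_space
    proof eventually_elim
      case (elim h)
      obtain N where N: "\<And>n. n \<ge> N \<Longrightarrow> trajectory act y h n \<noteq> y"
        using elim(2) unfolding eventually_sequentially by blast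
      define n where "n = Max {n. n < N \<and> trajectory act y h n = y}"
      have fin: "finite {n. n < N \<and> trajectory act y h n = y}" by simp
      \<comment> \<open>The start counts as a visit, so the maximum is taken over a non-empty set;
        for the same reason \<open>N\<close> cannot be 0.\<close>
      have "0 \<in> {n. n < N \<and> trajectory act y h n = y}" using N[of 0] by (cases N) auto
      then have "n \<in> {n. n < N \<and> trajectory act y h n = y}" unfolding n_def by (intro Max_in[OF fin]) blast
      moreover have "trajectory act y h (Suc (n + m)) \<noteq> y" for m
      proof
        assume *: "trajectory act y h (Suc (n + m)) = y"
        then have "Suc (n + m) \<in> {n. n < N \<and> trajectory act y h n = y}" using N by (auto simp: not_le[symmetric] simp del: trajectory.simps)
        then have "Suc (n + m) \<le> n" unfolding n_def by (rule Max_ge[OF fin])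
        then show False by simp
      qed
      ultimately have "h \<in> last_visit y n y" using elim(3) by (simp add: last_visit_def del: trajectory.simps)
      then show ?case using elim(1) by blast
    qed
    then show False by simp
  qed
  then have e: "e > 0" by (simp add: e_def zero_less_measure_iff measure_nonneg order.not_eq_order_implies_strict)
  have "green \<mu> N y x \<le> 1 / e" if x: "x \<in> \<Gamma>" for x N
  proof -
    have "green \<mu> N y x * e = (\<Sum>n<N. measure ?S (last_visit y n x))"
      by (simp add: green_def sum_distrib_right measure_last_visit[OF x] e_def)
    also have "\<dots> = measure ?S (\<Union>n<N. last_visit y n x)"
    proof (rule S.finite_measure_finite_Union[symmetric])
      show "disjoint_family_on (\<lambda>n. last_visit y n x) {..<N}"
        unfolding disjoint_family_on_def
      proof (intro ballI impI)
        have "last_visit y m x \<inter> last_visit y n x = {}" if "m < n" for m n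
          using less_imp_Suc_add[OF that] by (auto simp: last_visit_def simp del: trajectory.simps)
        then show "last_visit y m x \<inter> last_visit y n x = {}" if "m \<noteq> n" for m n
          using that by (metis Int_commute nat_neq_iff)
      qed
    qed (use last_visit_event[OF x] in auto)
    also have "\<dots> \<le> 1" by simp
    finally show ?thesis using e by (simp add: field_simps)
  qed
  then show ?thesis using e by (intro exI[of _ "1 / e"]) simp
qed

text \<open>The Green function sums the probabilities of visits to \<open>y\<close>, so this is the
  Borel-Cantelli lemma.\<close>

lemma transient_if_green_bounded:
  assumes x: "x \<in> \<Gamma>" and bound: "\<And>N. green \<mu> N y x \<le> c"
  shows "AE h in increments G \<mu>. \<forall>\<^sub>F n in sequentially. trajectory act x h n \<noteq> y"
proof -
  let ?A = "\<lambda>n. {h \<in> space (increments G \<mu>). trajectory act x h n = y}"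
  have "AE h in increments G \<mu>. \<forall>\<^sub>F n in sequentially. h \<in> space (increments G \<mu>) - ?A n"
  proof (rule borel_cantelli_AE1)
    show "summable (\<lambda>n. measure (increments G \<mu>) (?A n))"
      unfolding measure_trajectory[OF x]
      by (rule summableI_nonneg_bounded[where x=c])
        (use bound in \<open>simp_all add: transition_nonneg green_def\<close>)
  qed (simp_all add: trajectory_event x S.emeasure_eq_measure)
  then show ?thesis by eventually_elim (auto elim: eventually_mono)
qed

end

section \<open>From transience to convergence to an end\<close>

context schreier_data
begin

text \<open>Edges of the graph belong to \<open>K\<close>, while a walk step is a word in
  \<open>K\<close>. The exceptional vertices are those from which following the word meets
  \<open>F\<close>. Both endpoints are kept outside \<open>F\<close> so that the induction over
  words composes.\<close>

lemma bounded_step: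
  assumes "g \<in> carrier G" "finite F"
  shows "\<exists>B. finite B \<and> (\<forall>x\<in>\<Gamma> - B. x \<notin> F \<and> act x g \<notin> F \<and> (\<forall>C\<in>comps F. x \<in> C \<longrightarrow> act x g \<in> C))"
proof -
  have step: "\<exists>B. finite B \<and> (\<forall>x\<in>\<Gamma> - B. x \<notin> F \<and> act x k \<notin> F \<and> (\<forall>C\<in>comps F. x \<in> C \<longrightarrow> act x k \<in> C))"
    if "k \<in> K" for k
  proof (intro exI conjI ballI impI)
    have k: "k \<in> carrier G" using that K_carrier by blast
    \<comment> \<open>The vertices in \<open>F\<close> and those that \<open>k\<close> moves into
      \<open>F\<close>.\<close>
    let ?B = "F \<union> (\<lambda>x. act x (inv k)) ` F"
    show "finite ?B" using assms by simp
    fix x assume x: "x \<in> \<Gamma> - ?B"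
    show "x \<notin> F" using x by simp
    show F: "act x k \<notin> F"
    proof
      assume "act x k \<in> F"
      moreover have "x = act (act x k) (inv k)" using x k by (simp add: act_inv)
      ultimately show False using x by blast
    qed
    show "act x k \<in> C" if "C \<in> comps F" "x \<in> C" for C
      by (rule component_step[OF that \<open>k \<in> K\<close> F])
  qed
  show ?thesis
    using assms(1) unfolding K_generates[symmetric]
  proof induction
    case one
    show ?case using assms(2) by (intro exI[of _ F]) (simp add: act_one)
  next
    case (incl k) then show ?case by (rule step)
  next
    case (inv k) then show ?case by (intro step K_symmetric)
  next
    case (eng g h)
    have gh: "g \<in> carrier G" "h \<in> carrier G" using eng.hyps K_generates by auto
    obtain B where B: "finite B"
      "\<And>x. x \<in> \<Gamma> - B \<Longrightarrow> x \<notin> F \<and> act x g \<notin> F \<and> (\<forall>C\<in>comps F. x \<in> C \<longrightarrow> act x g \<in> C)"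
      using eng.IH(1) by auto
    obtain B' where B': "finite B'"
      "\<And>x. x \<in> \<Gamma> - B' \<Longrightarrow> x \<notin> F \<and> act x h \<notin> F \<and> (\<forall>C\<in>comps F. x \<in> C \<longrightarrow> act x h \<in> C)"
      using eng.IH(2) by auto
    show ?case
    proof (intro exI conjI ballI impI)
      \<comment> \<open>The exceptional set of the second factor is pulled back along the
        first.\<close>
      let ?B = "B \<union> (\<lambda>x. act x (inv g)) ` B'"
      show "finite ?B" using B B' by simp
      fix x assume x: "x \<in> \<Gamma> - ?B"
      have "act x g \<notin> B'"
      proof
        assume "act x g \<in> B'"
        moreover have "x = act (act x g) (inv g)" using x gh by (simp add: act_inv)
        ultimately show False using x by blast
      qed
      then have xg: "act x g \<in> \<Gamma> - B'" using x gh act_closed by blast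
      show "x \<notin> F" using B(2)[of x] x by simp
      show "act x (g \<otimes> h) \<notin> F" using B'(2)[OF xg] x gh by (simp add: act_mult)
      show "act x (g \<otimes> h) \<in> C" if "C \<in> comps F" "x \<in> C" for C
        using B(2)[of x] B'(2)[OF xg] x gh that by (simp add: act_mult)
    qed
  qed
qed

lemma converges_if_transient:
  assumes y: "\<And>n. y n \<in> \<Gamma>" and step: "\<And>n. \<exists>g\<in>A. y (Suc n) = act (y n) g"
    and A: "finite A" "A \<subseteq> carrier G"
    and transient: "\<And>x. x \<in> \<Gamma> \<Longrightarrow> \<forall>\<^sub>F n in sequentially. y n \<noteq> x"
  shows "\<exists>\<omega>. converges_to_end schreier y \<omega>"
  unfolding ex_converges_to_end_iff
proof
  fix F assume "F \<in> {F. finite F \<and> F \<subseteq> \<Gamma>}"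
  then have F: "finite F" by simp
  have "\<forall>g\<in>A. \<exists>B. finite B \<and> (\<forall>x\<in>\<Gamma> - B. x \<notin> F \<and> act x g \<notin> F \<and> (\<forall>C\<in>comps F. x \<in> C \<longrightarrow> act x g \<in> C))"
    using bounded_step[OF _ F] A(2) by blast
  then obtain B where B: "\<forall>g\<in>A. finite (B g) \<and> (\<forall>x\<in>\<Gamma> - B g. x \<notin> F \<and> act x g \<notin> F \<and>
      (\<forall>C\<in>comps F. x \<in> C \<longrightarrow> act x g \<in> C))"
    unfolding bchoice_iff by auto
  have "finite (\<Union>(B ` A) \<inter> \<Gamma>)" using A(1) B by blast
  then have "\<forall>\<^sub>F n in sequentially. \<forall>x\<in>\<Union>(B ` A) \<inter> \<Gamma>. y n \<noteq> x"
    using transient by (intro eventually_ball_finite) auto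
  \<comment> \<open>After time \<open>N\<close> the path avoids the exceptional sets of all
    admissible steps, so its component is frozen.\<close>
  then obtain N where N: "\<And>n g. \<lbrakk>n \<ge> N; g \<in> A\<rbrakk> \<Longrightarrow> y n \<notin> B g"
    unfolding eventually_sequentially using y by blast
  have "y N \<notin> F" using step[of N] B N[of N] y by blast
  then obtain C where C: "C \<in> comps F" "y N \<in> C" using component_exists y by blast
  have "y n \<in> C" if "n \<ge> N" for n
    using that
  proof (induction n rule: dec_induct)
    case (step n)
    obtain g where g: "g \<in> A" "y (Suc n) = act (y n) g" using assms(2)[of n] by blast
    have "y n \<in> \<Gamma> - B g" using y N step(1) g(1) by blast
    then show ?case using B g step.IH C(1) by auto
  qed (rule C(2))
  then have "\<forall>\<^sub>F n in sequentially. y n \<in> C" unfolding eventually_sequentially by blast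
  then show "\<exists>C\<in>comps F. \<forall>\<^sub>F n in sequentially. y n \<in> C" using C(1) by blast
qed

end

context schreier_walk
begin

lemma AE_converges_to_end:
  assumes nondegenerate: "strictly_nondegenerate G \<mu>"
    and transient: "transient_walk \<Gamma> (walk_law G \<Gamma> act simple)"
    and x: "x \<in> \<Gamma>"
  shows "AE h in increments G \<mu>. \<exists>\<omega>. converges_to_end schreier (\<lambda>n. act x (walk h n)) \<omega>"
proof -
  interpret Q: schreier_walk G \<Gamma> act K simple
    by unfold_locales (rule simple_support)+
  have "\<exists>c>0. \<forall>x\<in>\<Gamma>. \<forall>N. green simple N y x \<le> c" if y: "y \<in> \<Gamma>" for y
  proof (rule Q.green_bounded_if_transient[OF y])
    have "AE z in walk_law G \<Gamma> act simple y. \<forall>\<^sub>F n in sequentially. z n \<noteq> y"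
    proof -
      have "AE z in walk_law G \<Gamma> act simple y. \<forall>F. finite F \<and> F \<subseteq> \<Gamma> \<longrightarrow> (\<forall>\<^sub>F n in sequentially. z n \<notin> F)"
        using transient y unfolding transient_walk_def by blast
      then show ?thesis by eventually_elim (drule spec[of _ "{y}"], use y in simp)
    qed
    then show "AE h in increments G simple. \<forall>\<^sub>F n in sequentially. trajectory act y h n \<noteq> y"
      unfolding walk_law_def by (rule AE_distrD[OF Q.trajectory_measurable[OF y]])
  qed
  then have "AE h in increments G \<mu>. \<forall>\<^sub>F n in sequentially. trajectory act x h n \<noteq> y" if "y \<in> \<Gamma>" for y
    using green_bounded[OF support finite_support _ _ that x] nondegenerate transient_if_green_bounded[OF x]
    unfolding strictly_nondegenerate_def by blast
  then have "AE h in increments G \<mu>. \<forall>y\<in>\<Gamma>. \<forall>\<^sub>F n in sequentially. trajectory act x h n \<noteq> y"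
    by (simp add: AE_ball_countable countable_vertices)
  \<comment> \<open>Paths of increments are only known to lie in the carrier everywhere; the finite
    set of steps required by \<open>converges_if_transient\<close> is available almost
    surely.\<close>
  moreover have "AE h in increments G \<mu>. \<forall>n. h n \<in> set_pmf \<mu>"
    unfolding AE_all_countable
  proof
    fix n
    have "AE g in W.step. g \<in> set_pmf \<mu>"
      by (subst AE_restrict_space_iff) (simp_all add: AE_measure_pmf_iff)
    then show "AE h in increments G \<mu>. h n \<in> set_pmf \<mu>"
      unfolding increments_def by (intro AE_PiM_component W.prob_space_step) simp_all
  qed
  ultimately show ?thesis
    using AE_space
  proof eventually_elim
    case (elim h)
    note t = trajectory_act[OF elim(3) x]
    show ?case
    proof (rule converges_if_transient[OF _ _ finite_support support])
      show "act x (walk h n) \<in> \<Gamma>" for n using walk_closed[OF elim(3)] x act_closed by blast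
      show "\<exists>g\<in>set_pmf \<mu>. act x (walk h (Suc n)) = act (act x (walk h n)) g" for n
        unfolding t[symmetric] using elim(2) by auto
      show "\<forall>\<^sub>F n in sequentially. act x (walk h n) \<noteq> y" if "y \<in> \<Gamma>" for y
        using elim(1) that unfolding t by blast
    qed
  qed
qed

end

section \<open>Limit end fields\<close>

context schreier_data
begin

section \<open>Measurability and equivariance of the limit field\<close>

lemma limit_end_in_ends:
  assumes "ends schreier \<noteq> {}" shows "limit_end schreier y \<in> ends schreier"
proof (cases "\<exists>\<omega>. converges_to_end schreier y \<omega>")
  case True
  then show ?thesis using limit_end_eq converges_to_end_iff by metis
next
  case False
  then show ?thesis using assms by (auto simp: limit_end_def some_in_eq)
qed

lemma limit_end_component_iff:
  assumes "\<exists>\<omega>. converges_to_end schreier y \<omega>" and F: "finite F" "F \<subseteq> \<Gamma>" and C: "C \<in> comps F"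
  shows "limit_end schreier y F = C \<longleftrightarrow> (\<forall>\<^sub>F n in sequentially. y n \<in> C)"
proof -
  obtain \<omega> where \<omega>: "converges_to_end schreier y \<omega>" using assms by blast
  then have *: "\<omega> \<in> ends schreier" "\<forall>\<^sub>F n in sequentially. y n \<in> \<omega> F"
    using F by (auto simp: converges_to_end_iff)
  have "\<omega> F = C" if C': "\<forall>\<^sub>F n in sequentially. y n \<in> C"
  proof -
    obtain n where "y n \<in> \<omega> F" "y n \<in> C"
      using eventually_conj[OF *(2) C'] unfolding eventually_sequentially by blast
    then show ?thesis using components_disjoint end_component[OF *(1) F] C by blast
  qed
  then show ?thesis using * limit_end_eq[OF \<omega>] by blast
qed

lemma eventually_event:
  assumes "\<And>n. (\<lambda>x. y x n) \<in> measurable M (count_space \<Gamma>)"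
  shows "{x \<in> space M. \<forall>\<^sub>F n in sequentially. y x n \<in> C} \<in> sets M"
proof -
  have "{x \<in> space M. y x n \<in> C} \<in> sets M" for n
  proof -
    have "{x \<in> space M. y x n \<in> C} = (\<lambda>x. y x n) -` (C \<inter> \<Gamma>) \<inter> space M"
      using measurable_space[OF assms] by auto
    then show ?thesis using measurable_sets[OF assms, of "C \<inter> \<Gamma>"] by (simp only:) auto
  qed
  then show ?thesis
    unfolding eventually_sequentially
    by (intro sets.sets_Collect_countable_Ex sets.sets_Collect_countable_All sets.sets_Collect_imp
        sets.sets_Collect_const)
qed

lemma converges_event:
  assumes "\<And>n. (\<lambda>x. y x n) \<in> measurable M (count_space \<Gamma>)"
  shows "{x \<in> space M. converges_to_end schreier (y x) \<omega>} \<in> sets M"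
proof (cases "\<omega> \<in> ends schreier")
  case True
  then have "{x \<in> space M. converges_to_end schreier (y x) \<omega>}
    = {x \<in> space M. \<forall>F\<in>{F. finite F \<and> F \<subseteq> \<Gamma>}. \<forall>\<^sub>F n in sequentially. y x n \<in> \<omega> F}"
    by (auto simp: converges_to_end_iff)
  then show ?thesis
    by (simp only:) (intro sets.sets_Collect_countable_All' countable_finite_subsets eventually_event assms)
qed (simp add: converges_to_end_iff)

lemma convergent_event:
  assumes "\<And>n. (\<lambda>x. y x n) \<in> measurable M (count_space \<Gamma>)"
  shows "{x \<in> space M. \<exists>\<omega>. converges_to_end schreier (y x) \<omega>} \<in> sets M"
  unfolding ex_converges_to_end_iff
  by (intro sets.sets_Collect_countable_All' sets.sets_Collect_countable_Ex' countable_finite_subsets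
      countable_components eventually_event assms)

lemma act_measurable:
  "\<gamma> \<in> \<Gamma> \<Longrightarrow> (\<lambda>x. act \<gamma> (x n)) \<in> measurable (path_space (carrier G)) (count_space \<Gamma>)"
  by (rule measurable_compose[OF component_measurable]) (use act_closed in auto)

lemma limit_end_field_in_space:
  "ends schreier \<noteq> {} \<Longrightarrow> limit_end_field schreier act x \<in> space (end_fields schreier)"
  using limit_end_in_ends by (auto simp: space_end_fields limit_end_field_def)

lemma limit_end_field_measurable:
  assumes ne: "ends schreier \<noteq> {}"
  shows "limit_end_field schreier act \<in> measurable (path_space (carrier G)) (end_fields schreier)"
proof (rule measurable_end_fields)
  fix \<gamma> F C assume \<gamma>: "\<gamma> \<in> \<Gamma>" and F: "finite F" "F \<subseteq> \<Gamma>" and C: "C \<in> comps F"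
  let ?P = "path_space (carrier G)"
  let ?conv = "\<lambda>x. \<exists>\<omega>. converges_to_end schreier (\<lambda>n. act \<gamma> (x n)) \<omega>"
  \<comment> \<open>Paths without a limit all carry the same default end, so their contribution is
    the whole non-convergence event or empty.\<close>
  have "{x \<in> space ?P. limit_end_field schreier act x \<gamma> F = C}
    = {x \<in> space ?P. ?conv x \<and> (\<forall>\<^sub>F n in sequentially. act \<gamma> (x n) \<in> C)
        \<or> \<not> ?conv x \<and> (SOME \<omega>. \<omega> \<in> ends schreier) F = C}"
  proof (intro Collect_cong conj_cong refl)
    fix x
    show "limit_end_field schreier act x \<gamma> F = C \<longleftrightarrow> ?conv x \<and> (\<forall>\<^sub>F n in sequentially. act \<gamma> (x n) \<in> C)
        \<or> \<not> ?conv x \<and> (SOME \<omega>. \<omega> \<in> ends schreier) F = C"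
      using limit_end_component_iff[OF _ F C] \<gamma>
      by (cases "?conv x") (simp_all add: limit_end_field_def, simp add: limit_end_def)
  qed
  also have "\<dots> \<in> sets ?P"
    by (intro sets.sets_Collect_disj sets.sets_Collect_conj sets.sets_Collect_neg sets.sets_Collect_const
        convergent_event eventually_event act_measurable \<gamma>)
  finally show "{x \<in> space ?P. limit_end_field schreier act x \<gamma> F = C} \<in> sets ?P" .
qed (rule limit_end_field_in_space[OF ne])

text \<open>Exact and not merely almost sure: a path without a limit end keeps the default end after
  the shift.\<close>

lemma limit_end_field_shift: "limit_end_field schreier act (path_shift x) = limit_end_field schreier act x"
  unfolding limit_end_field_def path_shift_def using limit_end_Suc[of "\<lambda>n. act _ (x n)"] by simp

lemma end_field_action_apply:
  "\<phi> \<in> space (end_fields schreier) \<Longrightarrow> end_field_action schreier act g \<phi> = (\<lambda>\<gamma>\<in>\<Gamma>. \<phi> (act \<gamma> g))"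
  by (simp add: end_field_action_def)

lemma end_field_action_closed:
  "\<lbrakk>g \<in> carrier G; \<phi> \<in> space (end_fields schreier)\<rbrakk>
    \<Longrightarrow> end_field_action schreier act g \<phi> \<in> space (end_fields schreier)"
  unfolding end_field_action_apply using act_closed by (auto simp: space_end_fields PiE_iff)

text \<open>Since \<gamma>.(g x_n) = (\<gamma>.g).x_n, left translation of the path evaluates the
  field at \<gamma>.g.\<close>

lemma limit_end_field_translate:
  assumes "ends schreier \<noteq> {}" "g \<in> carrier G" "\<And>n. x n \<in> carrier G"
  shows "limit_end_field schreier act (path_translate G g x)
    = end_field_action schreier act g (limit_end_field schreier act x)"
  unfolding end_field_action_apply[OF limit_end_field_in_space[OF assms(1)]]
  using assms(2,3) act_closed by (intro ext) (simp add: limit_end_field_def path_translate_def act_mult)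

lemma measurable_end_field_action: "measurable_action G (end_fields schreier) (end_field_action schreier act)"
proof -
  let ?X = "space (end_fields schreier)" and ?b = "end_field_action schreier act"
  have one: "?b \<one> \<phi> = \<phi>" if "\<phi> \<in> ?X" for \<phi>
    unfolding end_field_action_apply[OF that]
    using that by (intro ext) (auto simp: act_one space_end_fields PiE_iff extensional_def)
  have mult: "?b (g \<otimes> h) \<phi> = ?b g (?b h \<phi>)" if "\<phi> \<in> ?X" "g \<in> carrier G" "h \<in> carrier G" for g h \<phi>
    unfolding end_field_action_apply[OF end_field_action_closed[OF that(3,1)]]
    unfolding end_field_action_apply[OF that(1)]
    using that act_closed by (intro ext) (simp add: act_mult)
  have bij: "?b g \<in> Bij ?X" if g: "g \<in> carrier G" for g
  proof -
    have "bij_betw (?b g) ?X ?X"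
    proof (rule bij_betw_byWitness[where f'="?b (inv g)"])
      show "\<forall>\<phi>\<in>?X. ?b (inv g) (?b g \<phi>) = \<phi>" "\<forall>\<phi>\<in>?X. ?b g (?b (inv g) \<phi>) = \<phi>"
        using g by (simp_all add: mult[symmetric] one)
    qed (use end_field_action_closed g in auto)
    then show ?thesis by (simp add: Bij_def end_field_action_def)
  qed
  have "?b \<in> hom G (BijGroup ?X)"
  proof (rule homI)
    show "?b g \<in> carrier (BijGroup ?X)" if "g \<in> carrier G" for g
      using bij[OF that] by (simp add: BijGroup_def)
    show "?b (g \<otimes> h) = ?b g \<otimes>\<^bsub>BijGroup ?X\<^esub> ?b h" if "g \<in> carrier G" "h \<in> carrier G" for g h
    proof
      fix \<phi> show "?b (g \<otimes> h) \<phi> = (?b g \<otimes>\<^bsub>BijGroup ?X\<^esub> ?b h) \<phi>"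
        using bij that mult by (cases "\<phi> \<in> ?X") (simp_all add: BijGroup_def compose_def end_field_action_def)
    qed
  qed
  then have "group_action G ?X ?b"
    by (intro group_action.intro group_hom.intro group_hom_axioms.intro group_BijGroup is_group)
  moreover have "?b g \<in> measurable (end_fields schreier) (end_fields schreier)" if g: "g \<in> carrier G" for g
  proof (rule measurable_end_fields)
    fix \<gamma> F C assume *: "\<gamma> \<in> \<Gamma>" "finite F" "F \<subseteq> \<Gamma>"
    have "{\<phi> \<in> ?X. ?b g \<phi> \<gamma> F = C} = {\<phi> \<in> ?X. \<phi> (act \<gamma> g) F = C}"
      using * by (auto simp: end_field_action_apply)
    then show "{\<phi> \<in> ?X. ?b g \<phi> \<gamma> F = C} \<in> sets (end_fields schreier)"
      using end_field_coordinate_measurable[OF measurable_ident_sets[OF refl] act_closed[OF *(1) g] *(2,3)]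
      by simp
  qed (rule end_field_action_closed[OF g])
  ultimately show ?thesis by (simp add: measurable_action_def)
qed

end

section \<open>The law of the limit field as a quotient of the Poisson boundary\<close>

lemma nontrivial_if_quotient_nontrivial:
  assumes "equivariant_quotient G \<nu> a \<kappa> b" "nontrivial \<kappa>"
  shows "nontrivial \<nu>"
  unfolding nontrivial_def
proof
  assume "\<exists>z\<in>space \<nu>. \<nu> = return \<nu> z"
  then obtain z where z: "z \<in> space \<nu>" "\<nu> = return \<nu> z" by blast
  obtain \<phi> where \<phi>: "\<phi> \<in> measurable \<nu> \<kappa>" "\<kappa> = distr \<nu> \<kappa> \<phi>"
    using assms(1) unfolding equivariant_quotient_def by blast
  have "distr \<nu> \<kappa> \<phi> = distr (return \<nu> z) \<kappa> \<phi>" by (rule arg_cong[OF z(2)])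
  also have "\<dots> = return \<kappa> (\<phi> z)" by (rule distr_return[OF \<phi>(1) z(1)])
  finally have "\<kappa> = return \<kappa> (\<phi> z)" using \<phi>(2) by simp
  then show False using assms(2) measurable_space[OF \<phi>(1) z(1)] unfolding nontrivial_def by blast
qed

context schreier_walk
begin

lemma group_walk_eq: "group_walk G \<mu> = distr (increments G \<mu>) (path_space (carrier G)) walk"
  by (simp add: group_walk_def walk_law_def)

lemma AE_group_walk_iff:
  assumes "{x \<in> space (path_space (carrier G)). P x} \<in> sets (path_space (carrier G))"
  shows "(AE x in group_walk G \<mu>. P x) \<longleftrightarrow> (AE h in increments G \<mu>. P (walk h))"
  unfolding group_walk_eq by (rule AE_distr_iff[OF walk_measurable assms])

text \<open>The group walk is the part of the counting walk that starts at the identity. The detour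
  through an enclosing null set covers predicates that are not known to be measurable.\<close>

lemma AE_group_walk_if_counting_walk:
  assumes "AE x in counting_walk G \<mu>. P x"
  shows "AE x in group_walk G \<mu>. P x"
proof -
  let ?N = "path_space (carrier G)"
  obtain A where A: "{x \<in> space (counting_walk G \<mu>). \<not> P x} \<subseteq> A" "A \<in> null_sets (counting_walk G \<mu>)"
    using AE_E[OF assms] by (metis null_setsI)
  have "A \<in> sets ?N" using A(2) by auto
  then have *: "{x \<in> space ?N. x \<notin> A} \<in> sets ?N"
    by (simp add: set_diff_eq[symmetric] sets.compl_sets)
  have "AE x in counting_walk G \<mu>. x \<notin> A" by (rule AE_not_in[OF A(2)])
  then have "AE h in increments G \<mu>. walk h \<notin> A" unfolding W.AE_counting_walk[OF *] by simp
  then have "AE x in group_walk G \<mu>. x \<notin> A" unfolding AE_group_walk_iff[OF *] .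
  then show ?thesis using AE_space by eventually_elim (use A(1) in auto)
qed

text \<open>Every cylinder event of the field is shift-invariant, hence almost surely the preimage
  of an event \<open>T\<close> of the boundary. Countability makes this simultaneous, but at an
  exceptional point of the boundary the events \<open>T\<close> may contradict each other, so the
  points where they describe a field must be singled out measurably.\<close>

lemma factor_through_poisson_boundary:
  assumes pb: "poisson_boundary G \<mu> \<nu> a \<pi>" and ne: "ends schreier \<noteq> {}"
  shows "\<exists>\<phi>\<in>measurable \<nu> (end_fields schreier).
    AE x in counting_walk G \<mu>. \<phi> (\<pi> x) = limit_end_field schreier act x"
proof -
  let ?L = "limit_end_field schreier act" and ?M = "counting_walk G \<mu>"
    and ?Fin = "{F. finite F \<and> F \<subseteq> \<Gamma>}"
  have erg: "ergodic_components ?M path_shift \<nu> \<pi>" using pb by (simp add: poisson_boundary_def)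
  have \<pi>: "\<pi> \<in> measurable ?M \<nu>" using erg by (simp add: ergodic_components_def)
  have L: "?L \<in> measurable ?M (end_fields schreier)"
    using limit_end_field_measurable[OF ne] by (subst measurable_cong_sets[OF sets_path_measures(2) refl])
  have ex_T: "\<exists>T. T \<in> sets \<nu> \<and> (AE x in ?M. ?L x \<gamma> F = C \<longleftrightarrow> \<pi> x \<in> T)" if "\<gamma> \<in> \<Gamma>" "F \<in> ?Fin" for \<gamma> F C
  proof -
    let ?A = "{x \<in> space ?M. ?L x \<gamma> F = C}"
    have "?A \<in> sets ?M" using that by (intro end_field_coordinate_measurable[OF L]) auto
    moreover have "AE x in ?M. path_shift x \<in> ?A \<longleftrightarrow> x \<in> ?A"
      using AE_space by eventually_elim (use W.shift_space in \<open>simp add: limit_end_field_shift\<close>)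
    ultimately obtain T where T: "T \<in> sets \<nu>" "AE x in ?M. x \<in> ?A \<longleftrightarrow> \<pi> x \<in> T"
      using erg unfolding ergodic_components_def by auto
    have "AE x in ?M. ?L x \<gamma> F = C \<longleftrightarrow> \<pi> x \<in> T"
      using T(2) AE_space by eventually_elim simp
    with T(1) show ?thesis by (intro exI conjI)
  qed
  define T where "T \<gamma> F C = (SOME T. T \<in> sets \<nu> \<and> (AE x in ?M. ?L x \<gamma> F = C \<longleftrightarrow> \<pi> x \<in> T))" for \<gamma> F C
  have T: "T \<gamma> F C \<in> sets \<nu>" "AE x in ?M. ?L x \<gamma> F = C \<longleftrightarrow> \<pi> x \<in> T \<gamma> F C"
    if "\<gamma> \<in> \<Gamma>" "F \<in> ?Fin" for \<gamma> F C
    using someI_ex[OF ex_T[OF that, of C]] unfolding T_def by (rule conjunct1, rule conjunct2)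
  have AE_T: "AE x in ?M. \<forall>\<gamma>\<in>\<Gamma>. \<forall>F\<in>?Fin. \<forall>C\<in>comps F. ?L x \<gamma> F = C \<longleftrightarrow> \<pi> x \<in> T \<gamma> F C"
    by (simp only: AE_ball_countable countable_vertices countable_finite_subsets countable_components)
      (intro ballI T(2))
  define codes where "codes \<psi> y \<longleftrightarrow> (\<forall>\<gamma>\<in>\<Gamma>. \<forall>F\<in>?Fin. \<forall>C\<in>comps F. \<psi> \<gamma> F = C \<longleftrightarrow> y \<in> T \<gamma> F C)" for \<psi> y
  \<comment> \<open>The defining conditions of an end, with \<open>y \<in> T \<gamma> F C\<close> in
    the role of the choice of \<open>C\<close> at \<open>F\<close>: exactly one component for each
    finite set, and monotonicity. All quantifiers are countable, hence \<open>good\<close> is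
    measurable; \<open>goodI\<close> and \<open>goodD\<close> show that it is equivalent to the
    existence of a field coded by \<open>y\<close>.\<close>
  define good where "good y \<longleftrightarrow>
    (\<forall>\<gamma>\<in>\<Gamma>. \<forall>F\<in>?Fin. \<exists>C\<in>comps F. \<forall>C'\<in>comps F. y \<in> T \<gamma> F C' \<longleftrightarrow> C' = C) \<and>
    (\<forall>\<gamma>\<in>\<Gamma>. \<forall>F'\<in>?Fin. \<forall>F\<in>?Fin. \<forall>C'\<in>comps F'. \<forall>C\<in>comps F.
      F \<subseteq> F' \<longrightarrow> y \<in> T \<gamma> F' C' \<longrightarrow> y \<in> T \<gamma> F C \<longrightarrow> C' \<subseteq> C)" for y
  have goodI: "good y" if \<psi>: "\<psi> \<in> space (end_fields schreier)" and c: "codes \<psi> y" for y \<psi>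
  proof -
    have e: "\<psi> \<gamma> \<in> ends schreier" if "\<gamma> \<in> \<Gamma>" for \<gamma> using \<psi> that by (auto simp: space_end_fields)
    show ?thesis
      unfolding good_def
    proof (intro conjI ballI impI)
      show "\<exists>C\<in>comps F. \<forall>C'\<in>comps F. y \<in> T \<gamma> F C' \<longleftrightarrow> C' = C" if "\<gamma> \<in> \<Gamma>" "F \<in> ?Fin" for \<gamma> F
        using c that end_component[OF e[OF that(1)], of F] unfolding codes_def
        by (intro bexI[of _ "\<psi> \<gamma> F"]) auto
      fix \<gamma> F' F C' C assume *: "\<gamma> \<in> \<Gamma>" "F' \<in> ?Fin" "F \<in> ?Fin" "C' \<in> comps F'" "C \<in> comps F"
        "F \<subseteq> F'" "y \<in> T \<gamma> F' C'" "y \<in> T \<gamma> F C"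
      then have "\<psi> \<gamma> F' = C'" "\<psi> \<gamma> F = C" using c unfolding codes_def by auto
      then show "C' \<subseteq> C" using end_mono[OF e[OF *(1)], of F' F] * by simp
    qed
  qed
  have goodD: "\<exists>\<psi>. \<psi> \<in> space (end_fields schreier) \<and> codes \<psi> y" if y: "good y" for y
  proof -
    have "\<forall>\<gamma>\<in>\<Gamma>. \<forall>F\<in>?Fin. \<exists>C. C \<in> comps F \<and> (\<forall>C'\<in>comps F. y \<in> T \<gamma> F C' \<longleftrightarrow> C' = C)"
      using conjunct1[OF y[unfolded good_def]] unfolding Bex_def .
    then obtain c where c: "\<forall>\<gamma>\<in>\<Gamma>. \<forall>F\<in>?Fin. c \<gamma> F \<in> comps F \<and> (\<forall>C'\<in>comps F. y \<in> T \<gamma> F C' \<longleftrightarrow> C' = c \<gamma> F)"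
      unfolding bchoice_iff by auto
    define \<psi> where "\<psi> = (\<lambda>\<gamma>\<in>\<Gamma>. \<lambda>F\<in>?Fin. c \<gamma> F)"
    have "\<psi> \<gamma> \<in> ends schreier" if \<gamma>: "\<gamma> \<in> \<Gamma>" for \<gamma>
    proof -
      have c\<gamma>: "c \<gamma> E \<in> comps E" "y \<in> T \<gamma> E (c \<gamma> E)" if "E \<in> ?Fin" for E
        using bspec[OF bspec[OF c \<gamma>] that] by auto
      have "c \<gamma> F' \<subseteq> c \<gamma> F" if F: "F' \<in> ?Fin" "F \<in> ?Fin" "F \<subseteq> F'" for F F'
        by (rule conjunct2[OF y[unfolded good_def], THEN bspec, THEN bspec, THEN bspec, THEN bspec, THEN bspec,
              THEN mp, THEN mp, THEN mp, OF \<gamma> F(1,2) c\<gamma>(1)[OF F(1)] c\<gamma>(1)[OF F(2)] F(3)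
              c\<gamma>(2)[OF F(1)] c\<gamma>(2)[OF F(2)]])
      then show ?thesis
        using c\<gamma>(1) \<gamma> unfolding ends_def \<psi>_def by (auto intro: finite_subset)
    qed
    then have "\<psi> \<in> space (end_fields schreier)" by (auto simp: space_end_fields \<psi>_def)
    moreover have "codes \<psi> y" using c unfolding codes_def \<psi>_def by auto
    ultimately show ?thesis by blast
  qed
  \<comment> \<open>At points that are not good any fixed field would do; the limit field of an
    arbitrary path is one, since \<open>limit_end\<close> always returns an end here.\<close>
  define \<phi> where "\<phi> y = (if good y then SOME \<psi>. \<psi> \<in> space (end_fields schreier) \<and> codes \<psi> y
    else limit_end_field schreier act undefined)" for y
  have \<phi>_good: "\<phi> y \<in> space (end_fields schreier)" "codes (\<phi> y) y" if "good y" for y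
    using someI_ex[OF goodD[OF that]] that by (simp_all add: \<phi>_def)
  have T_event: "{y \<in> space \<nu>. y \<in> T \<gamma> F C} \<in> sets \<nu>" if "\<gamma> \<in> \<Gamma>" "F \<in> ?Fin" for \<gamma> F C
    using T(1)[OF that] by (simp add: Int_def[symmetric] sets.Int)
  have good_event: "{y \<in> space \<nu>. good y} \<in> sets \<nu>"
    unfolding good_def iff_conv_conj_imp
    by (intro sets.sets_Collect_conj sets.sets_Collect_countable_All' sets.sets_Collect_countable_Ex'
        sets.sets_Collect_imp sets.sets_Collect_const countable_vertices countable_finite_subsets
        countable_components T_event)
  have "\<phi> \<in> measurable \<nu> (end_fields schreier)"
  proof (rule measurable_end_fields)
    show "\<phi> y \<in> space (end_fields schreier)" for y
      using \<phi>_good limit_end_field_in_space[OF ne] by (cases "good y") (auto simp: \<phi>_def)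
    fix \<gamma> F C assume *: "\<gamma> \<in> \<Gamma>" "finite F" "F \<subseteq> \<Gamma>" "C \<in> comps F"
    have "\<phi> y \<gamma> F = C \<longleftrightarrow> good y \<and> y \<in> T \<gamma> F C \<or> \<not> good y \<and> limit_end_field schreier act undefined \<gamma> F = C" for y
      using \<phi>_good(2)[of y] * unfolding codes_def by (cases "good y") (auto simp: \<phi>_def)
    then have "{y \<in> space \<nu>. \<phi> y \<gamma> F = C} =
      {y \<in> space \<nu>. good y \<and> y \<in> T \<gamma> F C \<or> \<not> good y \<and> limit_end_field schreier act undefined \<gamma> F = C}"
      by simp
    also have "\<dots> \<in> sets \<nu>"
      using * by (intro sets.sets_Collect_disj sets.sets_Collect_conj sets.sets_Collect_neg
          sets.sets_Collect_const good_event T_event) auto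
    finally show "{y \<in> space \<nu>. \<phi> y \<gamma> F = C} \<in> sets \<nu>" .
  qed
  moreover have "AE x in ?M. \<phi> (\<pi> x) = ?L x"
    using AE_T
  proof eventually_elim
    case (elim x)
    have Lx: "?L x \<in> space (end_fields schreier)" by (rule limit_end_field_in_space[OF ne])
    have "codes (?L x) (\<pi> x)" using elim unfolding codes_def .
    note g = goodI[OF Lx this]
    show ?case
      unfolding end_field_eq_iff[OF \<phi>_good(1)[OF g] Lx]
      using \<phi>_good(2)[OF g] elim unfolding codes_def by auto
  qed
  ultimately show ?thesis by blast
qed

lemma limit_end_field_is_quotient:
  assumes pb: "poisson_boundary G \<mu> \<nu> a \<pi>" and ne: "ends schreier \<noteq> {}"
  shows "equivariant_quotient G \<nu> a (limit_end_law G schreier act \<mu>) (end_field_action schreier act)"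
proof -
  let ?L = "limit_end_field schreier act" and ?b = "end_field_action schreier act"
    and ?\<kappa> = "limit_end_law G schreier act \<mu>"
  have sets: "sets ?\<kappa> = sets (end_fields schreier)" and space: "space ?\<kappa> = space (end_fields schreier)"
    by (simp_all add: limit_end_law_def)
  obtain \<phi> where \<phi>: "\<phi> \<in> measurable \<nu> (end_fields schreier)"
    and \<phi>\<pi>: "AE x in counting_walk G \<mu>. \<phi> (\<pi> x) = ?L x"
    using factor_through_poisson_boundary[OF assms] by blast
  have "\<pi> \<in> measurable (counting_walk G \<mu>) \<nu>"
    using pb by (simp add: poisson_boundary_def ergodic_components_def)
  then have \<pi>: "\<pi> \<in> measurable (group_walk G \<mu>) \<nu>"
    by (simp cong: measurable_cong_sets)
  have \<nu>: "\<nu> = distr (group_walk G \<mu>) \<nu> \<pi>" and a: "\<And>g. g \<in> carrier G \<Longrightarrow> a g \<in> measurable \<nu> \<nu>"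
    and equi: "\<And>g. g \<in> carrier G \<Longrightarrow> AE x in counting_walk G \<mu>. \<pi> (path_translate G g x) = a g (\<pi> x)"
    using pb unfolding poisson_boundary_def measurable_action_def by blast+
  have b: "?b g \<in> measurable (end_fields schreier) (end_fields schreier)" if "g \<in> carrier G" for g
    using measurable_end_field_action that by (simp add: measurable_action_def)
  have "AE y in \<nu>. \<phi> (a g y) = ?b g (\<phi> y)" if g: "g \<in> carrier G" for g
  proof -
    \<comment> \<open>The factorization is needed at \<open>x\<close> and at its translate by
      \<open>g\<close>. The latter starts elsewhere, so an almost sure statement for the group walk
      alone would not control it.\<close>
    have "AE x in counting_walk G \<mu>. \<phi> (a g (\<pi> x)) = ?b g (\<phi> (\<pi> x))"
      using \<phi>\<pi> W.AE_translate[OF g \<phi>\<pi>] equi[OF g] AE_space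
    proof eventually_elim
      case (elim x)
      then show ?case using limit_end_field_translate[OF ne g, of x] by auto
    qed
    then have "AE x in group_walk G \<mu>. \<phi> (a g (\<pi> x)) = ?b g (\<phi> (\<pi> x))"
      by (rule AE_group_walk_if_counting_walk)
    moreover have "{y \<in> space \<nu>. \<phi> (a g y) = ?b g (\<phi> y)} \<in> sets \<nu>"
      by (intro end_field_eq_measurable measurable_compose[OF a[OF g] \<phi>] measurable_compose[OF \<phi> b[OF g]])
    ultimately have "AE y in distr (group_walk G \<mu>) \<nu> \<pi>. \<phi> (a g y) = ?b g (\<phi> y)"
      by (simp add: AE_distr_iff[OF \<pi>])
    then show ?thesis unfolding \<nu>[symmetric] .
  qed
  moreover have "?\<kappa> = distr \<nu> ?\<kappa> \<phi>"
  proof -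
    have GW: "sets (group_walk G \<mu>) = sets (path_space (carrier G))" by simp
    have "?\<kappa> = distr (group_walk G \<mu>) (end_fields schreier) (\<phi> \<circ> \<pi>)"
      unfolding limit_end_law_def
    proof (rule distr_cong_AE)
      show "AE x in group_walk G \<mu>. ?L x = (\<phi> \<circ> \<pi>) x"
        using AE_group_walk_if_counting_walk[OF \<phi>\<pi>] by eventually_elim simp
      show "?L \<in> measurable (group_walk G \<mu>) (end_fields schreier)"
        using limit_end_field_measurable[OF ne] by (simp add: measurable_cong_sets[OF GW refl])
    qed (use measurable_comp[OF \<pi> \<phi>] in simp_all)
    also have "\<dots> = distr (distr (group_walk G \<mu>) \<nu> \<pi>) (end_fields schreier) \<phi>"
      by (rule distr_distr[OF \<phi> \<pi>, symmetric])
    also have "\<dots> = distr \<nu> (end_fields schreier) \<phi>" by (simp only: \<nu>[symmetric])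
    also have "\<dots> = distr \<nu> ?\<kappa> \<phi>" by (rule distr_cong) (simp_all add: sets)
    finally show ?thesis .
  qed
  moreover have "\<phi> \<in> measurable \<nu> ?\<kappa>" using \<phi> by (simp add: measurable_cong_sets[OF refl sets])
  moreover have "measurable_action G ?\<kappa> ?b"
    using measurable_end_field_action
    by (simp add: measurable_action_def space measurable_cong_sets[OF sets sets])
  ultimately show ?thesis unfolding equivariant_quotient_def by blast
qed

section \<open>The dichotomy: triviality of the law and a common limit end\<close>

lemma AE_walk_law_converges_iff:
  assumes "\<gamma> \<in> \<Gamma>"
  shows "(AE y in walk_law G \<Gamma> act \<mu> \<gamma>. converges_to_end schreier y \<omega>) \<longleftrightarrow>
    (AE h in increments G \<mu>. converges_to_end schreier (trajectory act \<gamma> h) \<omega>)"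
  unfolding walk_law_def
  by (rule AE_distr_iff[OF trajectory_measurable[OF assms]]) (intro converges_event component_measurable)

text \<open>This direction makes the two alternatives exclusive. Countability of
  \<open>\<Gamma>\<close> gives convergence from all starting points at once, so the field is almost
  surely constant.\<close>

lemma limit_end_law_trivial:
  assumes \<omega>: "\<omega> \<in> ends schreier"
    and conv: "\<And>\<gamma>. \<gamma> \<in> \<Gamma> \<Longrightarrow> AE y in walk_law G \<Gamma> act \<mu> \<gamma>. converges_to_end schreier y \<omega>"
  shows "\<not> nontrivial (limit_end_law G schreier act \<mu>)"
proof -
  let ?\<kappa> = "limit_end_law G schreier act \<mu>" and ?\<psi> = "\<lambda>\<gamma>\<in>\<Gamma>. \<omega>"
  have ne: "ends schreier \<noteq> {}" using \<omega> by blast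
  have \<psi>: "?\<psi> \<in> space (end_fields schreier)" using \<omega> by (auto simp: space_end_fields)
  have "AE h in increments G \<mu>. \<forall>\<gamma>\<in>\<Gamma>. converges_to_end schreier (trajectory act \<gamma> h) \<omega>"
    using conv by (simp add: AE_ball_countable countable_vertices AE_walk_law_converges_iff)
  then have eq: "AE h in increments G \<mu>. (limit_end_field schreier act \<circ> walk) h = ?\<psi>"
    using AE_space
  proof eventually_elim
    case (elim h)
    have "limit_end schreier (\<lambda>n. act \<gamma> (walk h n)) = \<omega>" if "\<gamma> \<in> \<Gamma>" for \<gamma>
    proof -
      have "trajectory act \<gamma> h = (\<lambda>n. act \<gamma> (walk h n))"
        using trajectory_act[OF elim(2) that] by (rule ext)
      then show ?thesis using elim(1) that limit_end_eq by metis
    qed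
    then show ?case by (simp add: limit_end_field_def cong: restrict_cong)
  qed
  have "?\<kappa> = distr (increments G \<mu>) (end_fields schreier) (limit_end_field schreier act \<circ> walk)"
    unfolding limit_end_law_def group_walk_eq
    by (rule distr_distr[OF limit_end_field_measurable[OF ne] walk_measurable])
  also have "\<dots> = distr (increments G \<mu>) (end_fields schreier) (\<lambda>_. ?\<psi>)"
    by (rule distr_cong_AE[OF refl refl eq])
      (intro measurable_comp[OF walk_measurable limit_end_field_measurable[OF ne]], use \<psi> in simp)
  also have "\<dots> = return (end_fields schreier) ?\<psi>" by (rule S.distr_const[OF \<psi>])
  also have "\<dots> = return ?\<kappa> ?\<psi>" by (rule return_cong) (simp add: limit_end_law_def)
  finally show ?thesis using \<psi> unfolding nontrivial_def by (auto simp: limit_end_law_def)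
qed

lemma constant_limit_if_trivial:
  assumes nondegenerate: "strictly_nondegenerate G \<mu>"
    and conv: "\<And>\<gamma>. \<gamma> \<in> \<Gamma> \<Longrightarrow>
      AE h in increments G \<mu>. \<exists>\<omega>. converges_to_end schreier (\<lambda>n. act \<gamma> (walk h n)) \<omega>"
    and ne: "ends schreier \<noteq> {}" and trivial: "\<not> nontrivial (limit_end_law G schreier act \<mu>)"
  shows "\<exists>\<omega>\<in>ends schreier. \<forall>\<gamma>\<in>\<Gamma>. AE y in walk_law G \<Gamma> act \<mu> \<gamma>. converges_to_end schreier y \<omega>"
proof -
  let ?\<kappa> = "limit_end_law G schreier act \<mu>" and ?L = "limit_end_field schreier act"
  have sets: "sets ?\<kappa> = sets (end_fields schreier)" and space: "space ?\<kappa> = space (end_fields schreier)"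
    by (simp_all add: limit_end_law_def)
  obtain \<psi> where \<psi>: "\<psi> \<in> space (end_fields schreier)" "?\<kappa> = return ?\<kappa> \<psi>"
    using trivial unfolding nontrivial_def space by blast
  \<comment> \<open>Measurability of this singleton is what lets the point mass be read as an almost
    sure equality.\<close>
  have "{\<phi> \<in> space (end_fields schreier). \<phi> = \<psi>} \<in> sets (end_fields schreier)"
    by (rule end_field_eq_measurable) (simp_all add: \<psi>)
  then have "AE \<phi> in return ?\<kappa> \<psi>. \<phi> = \<psi>"
    by (subst AE_return) (simp_all add: pred_def space sets \<psi>(1) conj_commute)
  then have "AE \<phi> in ?\<kappa>. \<phi> = \<psi>" unfolding \<psi>(2)[symmetric] .
  then have "AE h in increments G \<mu>. ?L (walk h) = \<psi>"
    unfolding limit_end_law_def group_walk_eq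
    by (intro AE_distrD[OF walk_measurable] AE_distrD[of ?L])
      (simp_all add: limit_end_field_measurable[OF ne])
  then have limit: "AE h in increments G \<mu>. converges_to_end schreier (trajectory act \<gamma> h) (\<psi> \<gamma>)"
    if \<gamma>: "\<gamma> \<in> \<Gamma>" for \<gamma>
    using conv[OF \<gamma>] AE_space
  proof eventually_elim
    case (elim h)
    have t: "trajectory act \<gamma> h = (\<lambda>n. act \<gamma> (walk h n))"
      using trajectory_act[OF elim(3) \<gamma>] by (rule ext)
    obtain \<omega> where \<omega>: "converges_to_end schreier (\<lambda>n. act \<gamma> (walk h n)) \<omega>" using elim(2) by blast
    then have "\<psi> \<gamma> = \<omega>" using elim(1) \<gamma> limit_end_eq[OF \<omega>] by (auto simp: limit_end_field_def)
    then show ?case using \<omega> t by simp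
  qed
  have invariant: "\<psi> (act \<gamma> g) = \<psi> \<gamma>" if \<gamma>: "\<gamma> \<in> \<Gamma>" and g: "g \<in> set_pmf \<mu>" for \<gamma> g
  proof -
    have \<gamma>g: "act \<gamma> g \<in> \<Gamma>" using \<gamma> g support act_closed by blast
    have event: "{h \<in> space (increments G \<mu>). \<not> converges_to_end schreier (trajectory act \<gamma> h) (\<psi> \<gamma>)}
        \<in> sets (increments G \<mu>)"
      by (intro sets.sets_Collect_neg converges_event measurable_compose[OF trajectory_measurable[OF \<gamma>] component_measurable])
    \<comment> \<open>The path from \<gamma> with first increment \<open>g\<close> converges to
      \<open>\<psi> \<gamma>\<close>; without its first vertex it is a path from \<gamma>.g and
      converges to \<open>\<psi> (act \<gamma> g)\<close>. The equality does not involve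
      \<open>h\<close>, so holding almost surely means holding.\<close>
    have "AE h in increments G \<mu>. \<psi> (act \<gamma> g) = \<psi> \<gamma>"
      using AE_one_step[OF event limit[OF \<gamma>] g] limit[OF \<gamma>g]
    proof eventually_elim
      case (elim h)
      have "converges_to_end schreier (\<lambda>n. trajectory act \<gamma> (case_nat g h) (Suc n)) (\<psi> \<gamma>)"
        using elim(1) converges_to_end_Suc by blast
      then have "converges_to_end schreier (trajectory act (act \<gamma> g) h) (\<psi> \<gamma>)"
        unfolding trajectory_case_nat .
      then show ?case using converges_to_end_unique elim(2) by blast
    qed
    then show ?thesis by (simp add: S.AE_const)
  qed
  have "\<psi> (act \<gamma> g) = \<psi> \<gamma>" if "g \<in> carrier G" "\<gamma> \<in> \<Gamma>" for g \<gamma>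
  proof -
    have "g \<in> semigroup_generated G (set_pmf \<mu>)"
      using that nondegenerate by (simp add: strictly_nondegenerate_def)
    then have "g \<in> carrier G \<and> (\<forall>\<gamma>\<in>\<Gamma>. \<psi> (act \<gamma> g) = \<psi> \<gamma>)"
    proof induction
      case (incl g) then show ?case using invariant support by blast
    next
      case (mult g h) then show ?case using act_closed by (simp add: act_mult)
    qed
    then show ?thesis using that by blast
  qed
  moreover obtain \<gamma>\<^sub>0 where \<gamma>\<^sub>0: "\<gamma>\<^sub>0 \<in> \<Gamma>" using nonempty by blast
  ultimately have const: "\<psi> \<gamma> = \<psi> \<gamma>\<^sub>0" if "\<gamma> \<in> \<Gamma>" for \<gamma>
    using act_transitive[OF \<gamma>\<^sub>0 that] by metis
  show ?thesis
  proof (intro bexI ballI)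
    show "\<psi> \<gamma>\<^sub>0 \<in> ends schreier" using \<psi>(1) \<gamma>\<^sub>0 by (auto simp: space_end_fields)
    show "AE y in walk_law G \<Gamma> act \<mu> \<gamma>. converges_to_end schreier y (\<psi> \<gamma>\<^sub>0)" if "\<gamma> \<in> \<Gamma>" for \<gamma>
      using limit[OF that] const[OF that] by (simp add: AE_walk_law_converges_iff[OF that])
  qed
qed

end

text \<open>The alternatives exclude each other, hence the equivalence with a negation. Almost sure
  convergence is part of the second one, so that the law is that of genuine limits and not of the
  default end. The boundary may be any realization of the Poisson boundary.\<close>

theorem theorem39:
  fixes G :: "('a, 'm) monoid_scheme"
    and \<Gamma> :: "'x set" and act :: "'x \<Rightarrow> 'a \<Rightarrow> 'x" and K :: "'a set"
    and D :: "('x, 'x \<times> 'a) pre_digraph"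
    and \<mu> :: "'a pmf"
    and \<nu> :: "'b measure" and a :: "'a \<Rightarrow> 'b \<Rightarrow> 'b" and \<pi> :: "(nat \<Rightarrow> 'a) \<Rightarrow> 'b"
  assumes "schreier_data G \<Gamma> act K"
    and "D = schreier_graph \<Gamma> act K"
    and "transient_walk \<Gamma> (walk_law G \<Gamma> act (pmf_of_set K))"
    and "set_pmf \<mu> \<subseteq> carrier G"
    and "finite (set_pmf \<mu>)"
    and "strictly_nondegenerate G \<mu>"
    and "poisson_boundary G \<mu> \<nu> a \<pi>"
  shows "(\<exists>\<omega>\<in>ends D. \<forall>\<gamma>\<in>\<Gamma>. AE y in walk_law G \<Gamma> act \<mu> \<gamma>. converges_to_end D y \<omega>)
    \<longleftrightarrow> \<not> ((\<forall>\<gamma>\<in>\<Gamma>. AE x in group_walk G \<mu>. \<exists>\<omega>\<in>ends D. converges_to_end D (\<lambda>n. act \<gamma> (x n)) \<omega>)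
        \<and> equivariant_quotient G \<nu> a (limit_end_law G D act \<mu>) (end_field_action D act)
        \<and> nontrivial (limit_end_law G D act \<mu>)
        \<and> nontrivial \<nu>)"
proof -
  interpret schreier_data G \<Gamma> act K by fact
  interpret schreier_walk G \<Gamma> act K \<mu> by unfold_locales fact+
  have conv: "AE h in increments G \<mu>. \<exists>\<omega>. converges_to_end D (\<lambda>n. act \<gamma> (trajectory (mult G) \<one>\<^bsub>G\<^esub> h n)) \<omega>"
    if "\<gamma> \<in> \<Gamma>" for \<gamma>
    unfolding assms(2) by (rule AE_converges_to_end[OF assms(6,3) that])
  \<comment> \<open>Almost sure convergence from one vertex already provides an end, which is needed
    for \<open>limit_end\<close> to have a default value among the ends.\<close>
  have ne: "ends D \<noteq> {}"
  proof
    assume "ends D = {}"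
    moreover obtain \<gamma> where "\<gamma> \<in> \<Gamma>" using nonempty by blast
    ultimately have "AE h in increments G \<mu>. False"
      using conv[of \<gamma>] by (simp add: converges_to_end_def)
    then show False by simp
  qed
  have quotient: "equivariant_quotient G \<nu> a (limit_end_law G D act \<mu>) (end_field_action D act)"
    using limit_end_field_is_quotient[OF assms(7)] ne unfolding assms(2) by blast
  have "AE x in group_walk G \<mu>. \<exists>\<omega>\<in>ends D. converges_to_end D (\<lambda>n. act \<gamma> (x n)) \<omega>" if "\<gamma> \<in> \<Gamma>" for \<gamma>
  proof -
    have "AE x in group_walk G \<mu>. \<exists>\<omega>. converges_to_end D (\<lambda>n. act \<gamma> (x n)) \<omega>"
      using conv[OF that] unfolding assms(2)
      by (subst AE_group_walk_iff) (intro convergent_event act_measurable that, assumption)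
    then show ?thesis by eventually_elim (auto simp: converges_to_end_def)
  qed
  \<comment> \<open>Convergence and the quotient property always hold, and a non-trivial law forces
    a non-trivial boundary, so the negated conjunction amounts to triviality of the law.\<close>
  moreover have "(\<exists>\<omega>\<in>ends D. \<forall>\<gamma>\<in>\<Gamma>. AE y in walk_law G \<Gamma> act \<mu> \<gamma>. converges_to_end D y \<omega>)
    \<longleftrightarrow> \<not> nontrivial (limit_end_law G D act \<mu>)"
    using limit_end_law_trivial constant_limit_if_trivial[OF assms(6)] conv ne unfolding assms(2) by blast
  ultimately show ?thesis using quotient nontrivial_if_quotient_nontrivial[OF quotient] by blast
qed

end
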